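(* Let $K\subset S^3$ be a knot given by a planar projection with $c^+_K$ positive crossings and $c^-_K$ negative crossings. Then for every $s\in\mathrm{js}_K$ and every $s^*\in\mathrm{js}^*_K$, $$-c^-_K\le s\le c^+_K\qquad\text{and}\qquad -c^-_K\le s^*\le c^+_K .$$
   Context: Colored Jones function: for a knot $K\subset S^3$ and $n\in\mathbb N=\{0,1,2,\dots\}$, $J_{K,n}(q)\in\mathbb Z[q^{\pm1}]$ is the $\mathfrak{sl}_2$ quantum invariant of $K$ colored by the $(n+1)$-dimensional irreducible representation, normalized to be $1$ at the unknot. Explicitly, $J_{K,n}=\langle S_n(K)\rangle/\langle S_n(\text{unknot})\rangle$, where $\langle\cdot\rangle$ is the Kauffman bracket in the variable $A$ with $q=A^{-4}$, knots are given the zero framing, and $S_0=1$, $S_1=z$, $S_{k+1}=zS_k-S_{k-1}$, with $z^k$ denoting $k$ parallel copies of the knot. Thus $J_{K,1}$ is the Jones polynomial, with $J_{K,1}(q)=q+q^3-q^4$ for the right-handed trefoil (whose crossings are positive). $\delta_K(n)$ and $\delta^*_K(n)$ denote the maximum and the minimum degree of $J_{K,n}(q)$ in $q$. It is a known theorem that for all large $n$ each of these is a quadratic quasi-polynomial, i.e. of the form $c_2(n)n^2+c_1(n)n+c_0(n)$ with each $c_j:\mathbb N\to\mathbb Q$ periodic with integral period; its set of slopes is the finite set of values of $2c_2(n)$. $\mathrm{js}_K$ is the set of slopes of $\delta_K$ and $\mathrm{js}^*_K$ is the set of slopes of $\delta^*_K$. *)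

theory Defs
  imports
    Complex_Main
    "HOL-Library.Poly_Mapping"
    "HOL-Computational_Algebra.Polynomial"
    "HOL-Computational_Algebra.Fraction_Field"
begin

section \<open>Planar diagrams\<close>

text \<open>
  A planar projection is recorded in Morse position: it is cut by horizontal lines into layers,
  read from bottom to top, each of which contains one local minimum (\<open>Cup\<close>), one local maximum
  (\<open>Cap\<close>) or one crossing (\<open>Cross\<close>); all other strands of the layer are vertical. Every planar link
  diagram has this form up to isotopy of the plane. The strands meeting a horizontal line are numbered
  \<open>0, 1, ...\<close> from left to right. \<open>Cup i\<close> creates, and \<open>Cap i\<close> joins, the strands at positions
  \<open>i\<close> and \<open>i + 1\<close>. \<open>Cross b i\<close> crosses the strands at positions \<open>i\<close> and \<open>i + 1\<close>; the one running
  from bottom left to top right is the over-strand if \<open>b\<close> holds, and the under-strand otherwise.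
\<close>

datatype piece = Cup nat | Cap nat | Cross bool nat

type_synonym diagram = "piece list"

fun fits :: "piece \<Rightarrow> nat \<Rightarrow> bool" where
  "fits (Cup i) w \<longleftrightarrow> i \<le> w"
| "fits (Cap i) w \<longleftrightarrow> i + 2 \<le> w"
| "fits (Cross b i) w \<longleftrightarrow> i + 2 \<le> w"

fun width_above :: "piece \<Rightarrow> nat \<Rightarrow> nat" where
  "width_above (Cup i) w = w + 2"
| "width_above (Cap i) w = w - 2"
| "width_above (Cross b i) w = w"

primrec closes_from :: "nat \<Rightarrow> diagram \<Rightarrow> bool" where
  "closes_from w [] \<longleftrightarrow> w = 0"
| "closes_from w (p # D) \<longleftrightarrow> fits p w \<and> closes_from (width_above p w) D"

definition link_diagram :: "diagram \<Rightarrow> bool" where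
  "link_diagram D \<longleftrightarrow> closes_from 0 D"

definition width :: "diagram \<Rightarrow> nat \<Rightarrow> nat" where
  "width D t = fold width_above (take t D) 0"

text \<open>The pair \<open>(t, j)\<close> is the intersection of the \<open>j\<close>-th strand with the line below layer \<open>t\<close>.\<close>

definition points :: "diagram \<Rightarrow> (nat \<times> nat) set" where
  "points D = {(t, j). t \<le> length D \<and> j < width D t}"

text \<open>\<open>through p j k\<close>: a strand of the layer \<open>p\<close> runs from bottom position \<open>j\<close> to top position \<open>k\<close>.\<close>

fun through :: "piece \<Rightarrow> nat \<Rightarrow> nat \<Rightarrow> bool" where
  "through (Cup i) j k \<longleftrightarrow> k = (if j < i then j else j + 2)"
| "through (Cap i) j k \<longleftrightarrow> j = (if k < i then k else k + 2)"
| "through (Cross b i) j k \<longleftrightarrow> k = (if j = i then i + 1 else if j = i + 1 then i else j)"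

definition through_arcs :: "diagram \<Rightarrow> ((nat \<times> nat) \<times> (nat \<times> nat)) set" where
  "through_arcs D = {((t, j), (t + 1, k)) | t j k. t < length D \<and>
     (t, j) \<in> points D \<and> (t + 1, k) \<in> points D \<and> through (D ! t) j k}"

definition turn_arcs :: "diagram \<Rightarrow> ((nat \<times> nat) \<times> (nat \<times> nat)) set" where
  "turn_arcs D =
     {((t + 1, i), (t + 1, i + 1)) | t i. t < length D \<and> D ! t = Cup i} \<union>
     {((t, i), (t, i + 1)) | t i. t < length D \<and> D ! t = Cap i}"

definition components :: "diagram \<Rightarrow> (nat \<times> nat) set set" where
  "components D =
     (let r = through_arcs D \<union> turn_arcs D in points D // (r \<union> r\<inverse>)\<^sup>*)"

definition knot_diagram :: "diagram \<Rightarrow> bool" where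
  "knot_diagram D \<longleftrightarrow> link_diagram D \<and> card (components D) = 1"

text \<open>
  An orientation says for each point whether the strand through it is directed upwards. A knot
  diagram has two orientations, and they give the same signs of crossings.
\<close>

definition orientation :: "diagram \<Rightarrow> (nat \<times> nat \<Rightarrow> bool) \<Rightarrow> bool" where
  "orientation D up \<longleftrightarrow>
     (\<forall>(x, y) \<in> through_arcs D. up x = up y) \<and> (\<forall>(x, y) \<in> turn_arcs D. up x \<noteq> up y)"

text \<open>
  If both strands are directed upwards (or both downwards), the crossing is positive iff the
  over-strand joins bottom left to top right; reversing one of the strands changes the sign.
\<close>

definition c_plus :: "diagram \<Rightarrow> (nat \<times> nat \<Rightarrow> bool) \<Rightarrow> nat" where
  "c_plus D up =
     card {t. t < length D \<and> (\<exists>b i. D ! t = Cross b i \<and> b = (up (t, i) = up (t, i + 1)))}"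

definition c_minus :: "diagram \<Rightarrow> (nat \<times> nat \<Rightarrow> bool) \<Rightarrow> nat" where
  "c_minus D up =
     card {t. t < length D \<and> (\<exists>b i. D ! t = Cross b i \<and> b \<noteq> (up (t, i) = up (t, i + 1)))}"

definition writhe :: "diagram \<Rightarrow> (nat \<times> nat \<Rightarrow> bool) \<Rightarrow> int" where
  "writhe D up = int (c_plus D up) - int (c_minus D up)"

section \<open>The Kauffman bracket\<close>

text \<open>Laurent polynomials with integer coefficients: the coefficient of the \<open>k\<close>-th power is \<open>lookup P k\<close>.\<close>

type_synonym laurent = "int \<Rightarrow>\<^sub>0 int"

abbreviation A_pow :: "int \<Rightarrow> laurent" where
  "A_pow k \<equiv> Poly_Mapping.single k 1"

text \<open>
  All states of a diagram, each with its exponent of \<open>A\<close>. The \<open>A\<close>-smoothing joins the two regions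
  swept out by turning the over-strand counterclockwise: for \<open>Cross True i\<close> these are the regions
  above and below the crossing, so the \<open>A\<close>-smoothing consists of two vertical strands.
\<close>

fun states :: "diagram \<Rightarrow> (int \<times> diagram) list" where
  "states [] = [(0, [])]"
| "states (Cup i # D) = map (\<lambda>(a, E). (a, Cup i # E)) (states D)"
| "states (Cap i # D) = map (\<lambda>(a, E). (a, Cap i # E)) (states D)"
| "states (Cross b i # D) =
     map (\<lambda>(a, E). (a + (if b then 1 else - 1), E)) (states D) @
     map (\<lambda>(a, E). (a + (if b then - 1 else 1), Cap i # Cup i # E)) (states D)"

definition loop_value :: laurent where
  "loop_value = - A_pow 2 - A_pow (- 2)"

text \<open>Normalized so that the empty diagram has bracket \<open>1\<close>.\<close>

definition bracket :: "diagram \<Rightarrow> laurent" where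
  "bracket D = (\<Sum>(a, E) \<leftarrow> states D. A_pow a * loop_value ^ card (components E))"

section \<open>Zero framing and parallel copies\<close>

text \<open>
  \<open>cable k D\<close> consists of \<open>k\<close> parallel copies of \<open>D\<close> in the plane: the strand at position \<open>i\<close> becomes the
  strands at positions \<open>k * i, ..., k * i + k - 1\<close>.
\<close>

fun cable_piece :: "nat \<Rightarrow> piece \<Rightarrow> diagram" where
  "cable_piece k (Cup i) = map (\<lambda>m. Cup (k * i + m)) [0..<k]"
| "cable_piece k (Cap i) = map (\<lambda>m. Cap (k * i + m)) (rev [0..<k])"
| "cable_piece k (Cross b i) =
     concat (map (\<lambda>r. map (\<lambda>s. Cross b (k * i + r + s)) [0..<k]) (rev [0..<k]))"

definition cable :: "nat \<Rightarrow> diagram \<Rightarrow> diagram" where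
  "cable k D = concat (map (cable_piece k) D)"

text \<open>
  A diagram represents the framing given by its writhe. To get a diagram of the same knot with the
  zero framing we insert curls of sign opposite to that of the writhe into the leftmost strand just
  above the first layer (which is \<open>Cup 0\<close>). \<open>curl True\<close> has a positive crossing for either orientation.
\<close>

definition curl :: "bool \<Rightarrow> diagram" where
  "curl b = [Cup 1, Cross b 0, Cap 1]"

definition zero_framed :: "diagram \<Rightarrow> (nat \<times> nat \<Rightarrow> bool) \<Rightarrow> diagram" where
  "zero_framed D up =
     take 1 D @ concat (replicate (nat \<bar>writhe D up\<bar>) (curl (writhe D up < 0))) @ drop 1 D"

section \<open>The colored Jones function\<close>

fun chebyshev_S :: "nat \<Rightarrow> int poly" where
  "chebyshev_S 0 = 1"
| "chebyshev_S (Suc 0) = [:0, 1:]"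
| "chebyshev_S (Suc (Suc k)) = [:0, 1:] * chebyshev_S (Suc k) - chebyshev_S k"

text \<open>The bracket of \<open>S\<^sub>n\<close> evaluated at the diagram \<open>D\<close>, where \<open>z\<^sup>k\<close> stands for \<open>cable k D\<close>.\<close>

definition S_bracket :: "nat \<Rightarrow> diagram \<Rightarrow> laurent" where
  "S_bracket n D =
     (\<Sum>k\<le>degree (chebyshev_S n). of_int (coeff (chebyshev_S n) k) * bracket (cable k D))"

definition unknot :: diagram where
  "unknot = [Cup 0, Cap 0]"

text \<open>
  The colored Jones function, in the field of fractions of the ring of Laurent polynomials in \<open>A\<close>.
  That it is a Laurent polynomial in \<open>q = A\<^sup>-\<^sup>4\<close> is a theorem on knots.
\<close>

definition colored_jones :: "diagram \<Rightarrow> (nat \<times> nat \<Rightarrow> bool) \<Rightarrow> nat \<Rightarrow> laurent fract" where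
  "colored_jones D up n = Fract (S_bracket n (zero_framed D up)) (S_bracket n unknot)"

section \<open>Degrees\<close>

text \<open>
  Maximum and minimum degree in \<open>A\<close> of a nonzero rational function: the degree of the numerator minus
  that of the denominator, for any representation as a fraction of Laurent polynomials.
\<close>

definition max_degree_A :: "laurent fract \<Rightarrow> int" where
  "max_degree_A x =
     (THE d. \<exists>f g. f \<noteq> 0 \<and> g \<noteq> 0 \<and> x = Fract f g \<and> d = Max (Poly_Mapping.keys f) - Max (Poly_Mapping.keys g))"

definition min_degree_A :: "laurent fract \<Rightarrow> int" where
  "min_degree_A x =
     (THE d. \<exists>f g. f \<noteq> 0 \<and> g \<noteq> 0 \<and> x = Fract f g \<and> d = Min (Poly_Mapping.keys f) - Min (Poly_Mapping.keys g))"

text \<open>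
  Maximum and minimum degree in \<open>q\<close>. Since \<open>q = A\<^sup>-\<^sup>4\<close>, the highest power of \<open>q\<close> is the lowest power
  of \<open>A\<close>. The lemmas \<open>delta_eq_Max\<close> and \<open>delta_star_eq_Min\<close> below show that these are the usual degrees
  of the Laurent polynomial in \<open>q\<close>.
\<close>

definition delta :: "diagram \<Rightarrow> (nat \<times> nat \<Rightarrow> bool) \<Rightarrow> nat \<Rightarrow> rat" where
  "delta D up n = - of_int (min_degree_A (colored_jones D up n)) / 4"

definition delta_star :: "diagram \<Rightarrow> (nat \<times> nat \<Rightarrow> bool) \<Rightarrow> nat \<Rightarrow> rat" where
  "delta_star D up n = - of_int (max_degree_A (colored_jones D up n)) / 4"

definition of_q :: "laurent \<Rightarrow> laurent" where
  "of_q P = (\<Sum>k\<in>Poly_Mapping.keys P. Poly_Mapping.single (- 4 * k) (Poly_Mapping.lookup P k))"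

subsection \<open>Agreement with the degrees of a Laurent polynomial in q\<close>

lemma lookup_of_q: "Poly_Mapping.lookup (of_q P) (- 4 * k) = Poly_Mapping.lookup P k"
proof -
  have "Poly_Mapping.lookup (of_q P) (- 4 * k) = (\<Sum>j\<in>Poly_Mapping.keys P. if j = k then Poly_Mapping.lookup P j else 0)"
    unfolding of_q_def lookup_sum by (rule sum.cong) (auto simp: lookup_single when_def)
  also have "\<dots> = Poly_Mapping.lookup P k"
    by (simp add: in_keys_iff)
  finally show ?thesis .
qed

lemma keys_of_q: "Poly_Mapping.keys (of_q P) = (\<lambda>k. - 4 * k) ` Poly_Mapping.keys P"
proof
  have "Poly_Mapping.keys (of_q P) \<subseteq> (\<Union>k\<in>Poly_Mapping.keys P. Poly_Mapping.keys (Poly_Mapping.single (- 4 * k) (Poly_Mapping.lookup P k)))"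
    unfolding of_q_def by (rule keys_sum)
  also have "\<dots> \<subseteq> (\<lambda>k. - 4 * k) ` Poly_Mapping.keys P"
    by (auto split: if_splits)
  finally show "Poly_Mapping.keys (of_q P) \<subseteq> (\<lambda>k. - 4 * k) ` Poly_Mapping.keys P" .
next
  show "(\<lambda>k. - 4 * k) ` Poly_Mapping.keys P \<subseteq> Poly_Mapping.keys (of_q P)"
  proof
    fix x assume "x \<in> (\<lambda>k. - 4 * k) ` Poly_Mapping.keys P"
    then obtain k where "k \<in> Poly_Mapping.keys P" and x: "x = - 4 * k" by blast
    then show "x \<in> Poly_Mapping.keys (of_q P)"
      unfolding x in_keys_iff lookup_of_q by simp
  qed
qed

lemma sum_of_monomials:
  fixes f :: laurent
  shows "(\<Sum>i\<in>Poly_Mapping.keys f. Poly_Mapping.single i (Poly_Mapping.lookup f i)) = f"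
  by (rule poly_mapping_eqI) (simp add: lookup_sum lookup_single when_def in_keys_iff)

lemma lookup_times_extremal:
  fixes f g :: laurent
  assumes "\<And>i j. i \<in> Poly_Mapping.keys f \<Longrightarrow> j \<in> Poly_Mapping.keys g \<Longrightarrow> i + j = a + b \<Longrightarrow> i = a \<and> j = b"
  shows "Poly_Mapping.lookup (f * g) (a + b) = Poly_Mapping.lookup f a * Poly_Mapping.lookup g b"
proof -
  have "f * g = (\<Sum>i\<in>Poly_Mapping.keys f. Poly_Mapping.single i (Poly_Mapping.lookup f i)) *
      (\<Sum>j\<in>Poly_Mapping.keys g. Poly_Mapping.single j (Poly_Mapping.lookup g j))"
    by (simp only: sum_of_monomials)
  also have "\<dots> = (\<Sum>i\<in>Poly_Mapping.keys f. \<Sum>j\<in>Poly_Mapping.keys g. Poly_Mapping.single (i + j) (Poly_Mapping.lookup f i * Poly_Mapping.lookup g j))"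
    by (simp add: sum_product mult_single)
  finally have "Poly_Mapping.lookup (f * g) (a + b) =
      (\<Sum>i\<in>Poly_Mapping.keys f. \<Sum>j\<in>Poly_Mapping.keys g. (if i + j = a + b then Poly_Mapping.lookup f i * Poly_Mapping.lookup g j else 0))"
    by (simp add: lookup_sum lookup_single when_def)
  also have "\<dots> = (\<Sum>i\<in>Poly_Mapping.keys f. \<Sum>j\<in>Poly_Mapping.keys g. (if i = a then if j = b then Poly_Mapping.lookup f i * Poly_Mapping.lookup g j else 0 else 0))"
    using assms by (intro sum.cong refl) auto
  also have "\<dots> = (\<Sum>i\<in>Poly_Mapping.keys f. (if i = a then (\<Sum>j\<in>Poly_Mapping.keys g. if j = b then Poly_Mapping.lookup f i * Poly_Mapping.lookup g j else 0) else 0))"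
    by (intro sum.cong refl) auto
  also have "\<dots> = Poly_Mapping.lookup f a * Poly_Mapping.lookup g b"
    by (simp add: in_keys_iff)
  finally show ?thesis .
qed

lemma extremal_keys_times:
  fixes f g :: laurent
  assumes "f \<noteq> 0" "g \<noteq> 0"
  shows "Max (Poly_Mapping.keys (f * g)) = Max (Poly_Mapping.keys f) + Max (Poly_Mapping.keys g)"
    and "Min (Poly_Mapping.keys (f * g)) = Min (Poly_Mapping.keys f) + Min (Poly_Mapping.keys g)"
proof -
  have ne: "Poly_Mapping.keys f \<noteq> {}" "Poly_Mapping.keys g \<noteq> {}" using assms by simp_all
  have le: "k \<le> Max (Poly_Mapping.keys f) + Max (Poly_Mapping.keys g) \<and> Min (Poly_Mapping.keys f) + Min (Poly_Mapping.keys g) \<le> k"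
    if k: "k \<in> Poly_Mapping.keys (f * g)" for k
  proof -
    obtain i j where "k = i + j" "i \<in> Poly_Mapping.keys f" "j \<in> Poly_Mapping.keys g"
      using keys_mult[of f g] k by blast
    then show ?thesis by (auto intro!: add_mono)
  qed
  have "Poly_Mapping.lookup (f * g) (Max (Poly_Mapping.keys f) + Max (Poly_Mapping.keys g)) = Poly_Mapping.lookup f (Max (Poly_Mapping.keys f)) * Poly_Mapping.lookup g (Max (Poly_Mapping.keys g))"
    by (rule lookup_times_extremal) (smt (verit) Max_ge finite_keys)+
  moreover have "Poly_Mapping.lookup f (Max (Poly_Mapping.keys f)) \<noteq> 0" "Poly_Mapping.lookup g (Max (Poly_Mapping.keys g)) \<noteq> 0"
    using ne Max_in[OF finite_keys] by (auto simp: in_keys_iff)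
  ultimately have "Max (Poly_Mapping.keys f) + Max (Poly_Mapping.keys g) \<in> Poly_Mapping.keys (f * g)"
    by (simp add: in_keys_iff)
  then show "Max (Poly_Mapping.keys (f * g)) = Max (Poly_Mapping.keys f) + Max (Poly_Mapping.keys g)"
    using le by (intro Max_eqI) auto
  have "Poly_Mapping.lookup (f * g) (Min (Poly_Mapping.keys f) + Min (Poly_Mapping.keys g)) = Poly_Mapping.lookup f (Min (Poly_Mapping.keys f)) * Poly_Mapping.lookup g (Min (Poly_Mapping.keys g))"
    by (rule lookup_times_extremal) (smt (verit) Min_le finite_keys)+
  moreover have "Poly_Mapping.lookup f (Min (Poly_Mapping.keys f)) \<noteq> 0" "Poly_Mapping.lookup g (Min (Poly_Mapping.keys g)) \<noteq> 0"
    using ne Min_in[OF finite_keys] by (auto simp: in_keys_iff)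
  ultimately have "Min (Poly_Mapping.keys f) + Min (Poly_Mapping.keys g) \<in> Poly_Mapping.keys (f * g)"
    by (simp add: in_keys_iff)
  then show "Min (Poly_Mapping.keys (f * g)) = Min (Poly_Mapping.keys f) + Min (Poly_Mapping.keys g)"
    using le by (intro Min_eqI) auto
qed

lemma max_degree_A_Fract:
  assumes "f \<noteq> 0" "g \<noteq> 0"
  shows "max_degree_A (Fract f g) = Max (Poly_Mapping.keys f) - Max (Poly_Mapping.keys g)"
  unfolding max_degree_A_def
proof (rule the_equality)
  show "\<exists>f' g'. f' \<noteq> 0 \<and> g' \<noteq> 0 \<and> Fract f g = Fract f' g' \<and>
      Max (Poly_Mapping.keys f) - Max (Poly_Mapping.keys g) = Max (Poly_Mapping.keys f') - Max (Poly_Mapping.keys g')"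
    using assms by blast
next
  fix d
  assume "\<exists>f' g'. f' \<noteq> 0 \<and> g' \<noteq> 0 \<and> Fract f g = Fract f' g' \<and> d = Max (Poly_Mapping.keys f') - Max (Poly_Mapping.keys g')"
  then obtain f' g' where *: "f' \<noteq> 0" "g' \<noteq> 0" "Fract f g = Fract f' g'"
    "d = Max (Poly_Mapping.keys f') - Max (Poly_Mapping.keys g')" by blast
  then have "f * g' = f' * g" using assms by (simp add: eq_fract)
  then have "Max (Poly_Mapping.keys f) + Max (Poly_Mapping.keys g') = Max (Poly_Mapping.keys f') + Max (Poly_Mapping.keys g)"
    using extremal_keys_times(1) assms * by metis
  then show "d = Max (Poly_Mapping.keys f) - Max (Poly_Mapping.keys g)" using * by simp
qed

lemma min_degree_A_Fract:
  assumes "f \<noteq> 0" "g \<noteq> 0"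
  shows "min_degree_A (Fract f g) = Min (Poly_Mapping.keys f) - Min (Poly_Mapping.keys g)"
  unfolding min_degree_A_def
proof (rule the_equality)
  show "\<exists>f' g'. f' \<noteq> 0 \<and> g' \<noteq> 0 \<and> Fract f g = Fract f' g' \<and>
      Min (Poly_Mapping.keys f) - Min (Poly_Mapping.keys g) = Min (Poly_Mapping.keys f') - Min (Poly_Mapping.keys g')"
    using assms by blast
next
  fix d
  assume "\<exists>f' g'. f' \<noteq> 0 \<and> g' \<noteq> 0 \<and> Fract f g = Fract f' g' \<and> d = Min (Poly_Mapping.keys f') - Min (Poly_Mapping.keys g')"
  then obtain f' g' where *: "f' \<noteq> 0" "g' \<noteq> 0" "Fract f g = Fract f' g'"
    "d = Min (Poly_Mapping.keys f') - Min (Poly_Mapping.keys g')" by blast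
  then have "f * g' = f' * g" using assms by (simp add: eq_fract)
  then have "Min (Poly_Mapping.keys f) + Min (Poly_Mapping.keys g') = Min (Poly_Mapping.keys f') + Min (Poly_Mapping.keys g)"
    using extremal_keys_times(2) assms * by metis
  then show "d = Min (Poly_Mapping.keys f) - Min (Poly_Mapping.keys g)" using * by simp
qed

lemma of_q_nonzero: "P \<noteq> 0 \<Longrightarrow> of_q P \<noteq> 0"
  using keys_of_q[of P] by auto

lemma delta_eq_Max:
  assumes "colored_jones D up n = Fract (of_q P) 1" "P \<noteq> 0"
  shows "delta D up n = of_int (Max (Poly_Mapping.keys P))"
proof -
  have "Min (Poly_Mapping.keys (of_q P)) = - 4 * Max (Poly_Mapping.keys P)"
    unfolding keys_of_q using assms(2) by (intro Min_eqI) auto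
  then show ?thesis
    unfolding delta_def assms(1)
    using min_degree_A_Fract[of "of_q P" 1] of_q_nonzero[OF assms(2)] by simp
qed

lemma delta_star_eq_Min:
  assumes "colored_jones D up n = Fract (of_q P) 1" "P \<noteq> 0"
  shows "delta_star D up n = of_int (Min (Poly_Mapping.keys P))"
proof -
  have "Max (Poly_Mapping.keys (of_q P)) = - 4 * Min (Poly_Mapping.keys P)"
    unfolding keys_of_q using assms(2) by (intro Max_eqI) auto
  then show ?thesis
    unfolding delta_star_def assms(1)
    using max_degree_A_Fract[of "of_q P" 1] of_q_nonzero[OF assms(2)] by simp
qed

section \<open>Slopes\<close>

definition periodic :: "(nat \<Rightarrow> rat) \<Rightarrow> bool" where
  "periodic c \<longleftrightarrow> (\<exists>p>0. \<forall>n. c (n + p) = c n)"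

definition quasi_polynomial_for ::
    "(nat \<Rightarrow> rat) \<Rightarrow> (nat \<Rightarrow> rat) \<Rightarrow> (nat \<Rightarrow> rat) \<Rightarrow> (nat \<Rightarrow> rat) \<Rightarrow> bool" where
  "quasi_polynomial_for d c2 c1 c0 \<longleftrightarrow>
     periodic c2 \<and> periodic c1 \<and> periodic c0 \<and>
     (\<forall>\<^sub>F n in sequentially. d n = c2 n * of_nat n ^ 2 + c1 n * of_nat n + c0 n)"

text \<open>The coefficients are determined by the function, so there is at most one choice of \<open>c2\<close>.\<close>

definition slopes :: "(nat \<Rightarrow> rat) \<Rightarrow> rat set" where
  "slopes d = {2 * c2 n | c2 c1 c0 n. quasi_polynomial_for d c2 c1 c0}"

definition js :: "diagram \<Rightarrow> (nat \<times> nat \<Rightarrow> bool) \<Rightarrow> rat set" where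
  "js D up = slopes (delta D up)"

definition js_star :: "diagram \<Rightarrow> (nat \<times> nat \<Rightarrow> bool) \<Rightarrow> rat set" where
  "js_star D up = slopes (delta_star D up)"

end

theory Submission imports Defs begin

text \<open>Evaluate the Kauffman bracket at a large real number $A = a$ by the Temperley--Lieb
  representation on $(\mathbb{C}^2)^{\otimes n}$ and let the quantum group of $\mathfrak{sl}_2$ act on
  the $k$ parallel strands of a cable. The projection onto the isotypic component of highest weight
  $r \le k$ is a polynomial in the Casimir element, so it slides through cabled crossings, cups and
  caps; inserted at one point of a knot it may therefore be inserted at all of them. On this component
  a cabled crossing has norm at most $a^{r^2+2r}$ and a curl acts by the scalar $\pm a^{\pm(r^2+2r)}$,
  while cups and caps cost a factor $O(a^k)$ each. Cancelling the writhe with curls, the evaluation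
  of the zero-framed $k$-cable grows at most like $a^{2c^-(k^2+2k)+O(k)}$, which bounds the degree in
  $A$. The mirror image bounds the degree from the other side. Both bounds pass to the colored Jones
  function because $q = A^{-4}$ and $S_n$ involves only cables with $k \le n$.\<close>

text \<open>A bound for all components at once does not suffice: a crossing of the cable can cost
  a^(k^2+2k), while the curl meant to compensate it may act on a small component and gain nothing.
  Costs and gains balance only if crossings and curls carry the same label \<open>r\<close>, hence
  the projections on every arc. They can be moved because one strand taken around \<open>N\<close>
  parallel strands, from either side, acts as a combination of the Casimir elements of
  \<open>N\<close> and \<open>N + 1\<close> strands. The same identity yields the possible
  eigenvalues, the branching rule and the full twist. The norm of a cabled crossing is read off from
  its square, which is the full twist of all strands divided by the twists of the two bundles. This
  needs positivity: for real \<open>a\<close> crossings are symmetric, and \<open>E\<close> and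
  \<open>F\<close> are adjoint. Labels above \<open>2 * r\<close> are excluded by comparing the
  sizes of Casimir eigenvalues, which requires \<open>a\<close> to be bounded below. Degree 2 c^-
  n^2 in \<open>A\<close> means -(c^-/2) n^2 in \<open>q\<close>, that is, slope -c^-.\<close>

text \<open>All tensor powers of $\mathbb{C}^2$ act on functions of infinite spin configurations, so that
  diagrams of any width are elements of a single algebra.\<close>

type_synonym conf = "nat \<Rightarrow> bool"
type_synonym vec = "conf \<Rightarrow> real"

text \<open>Packaging linear maps as a type makes them a \<open>real_algebra_1\<close>, so that
  identities between diagrams become ring computations.\<close>

typedef endo = "{T :: vec \<Rightarrow> vec. \<forall>a b f g. T (\<lambda>s. a * f s + b * g s) = (\<lambda>s. a * T f s + b * T g s)}"
  morphisms app Endo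
  by (rule exI[of _ "\<lambda>f. f"]) simp

setup_lifting type_definition_endo

lemma app_linear: "app T (\<lambda>s. a * f s + b * g s) = (\<lambda>s. a * app T f s + b * app T g s)"
  using app[of T] by simp

instantiation endo :: real_algebra_1
begin

lift_definition zero_endo :: endo is "\<lambda>f s. 0" by simp
lift_definition one_endo :: endo is "\<lambda>f. f" by simp
lift_definition plus_endo :: "endo \<Rightarrow> endo \<Rightarrow> endo" is "\<lambda>S T f s. S f s + T f s"
  by (simp add: algebra_simps)
lift_definition minus_endo :: "endo \<Rightarrow> endo \<Rightarrow> endo" is "\<lambda>S T f s. S f s - T f s"
  by (simp add: algebra_simps)
lift_definition uminus_endo :: "endo \<Rightarrow> endo" is "\<lambda>T f s. - T f s"
  by (simp add: algebra_simps)
lift_definition scaleR_endo :: "real \<Rightarrow> endo \<Rightarrow> endo" is "\<lambda>c T f s. c * T f s"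
  by (simp add: algebra_simps)
lift_definition times_endo :: "endo \<Rightarrow> endo \<Rightarrow> endo" is "\<lambda>S T f. S (T f)"
  by simp

instance
proof
  fix x y z :: endo and a b :: real
  show "x * (y + z) = x * y + x * z"
  proof transfer
    fix S T U :: "vec \<Rightarrow> vec"
    assume *: "\<forall>a b f g. S (\<lambda>s. a * f s + b * g s) = (\<lambda>s. a * S f s + b * S g s)"
    show "(\<lambda>f. S (\<lambda>s. T f s + U f s)) = (\<lambda>f s. S (T f) s + S (U f) s)"
      using *[rule_format, of 1 _ 1] by simp
  qed
  show "x * a *\<^sub>R y = a *\<^sub>R (x * y)"
  proof transfer
    fix S T :: "vec \<Rightarrow> vec" and a
    assume *: "\<forall>a b f g. S (\<lambda>s. a * f s + b * g s) = (\<lambda>s. a * S f s + b * S g s)"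
    show "(\<lambda>f. S (\<lambda>s. a * T f s)) = (\<lambda>f s. a * S (T f) s)"
    proof
      fix f
      show "S (\<lambda>s. a * T f s) = (\<lambda>s. a * S (T f) s)"
        using *[rule_format, of a "T f" 0 "T f"] by simp
    qed
  qed
  show "(0::endo) \<noteq> 1"
  proof transfer
    show "(\<lambda>f s. 0) \<noteq> (\<lambda>f :: vec. f)"
    proof
      assume "(\<lambda>f s. 0) = (\<lambda>f :: vec. f)"
      then have "(\<lambda>s. 0) = (\<lambda>s :: conf. 1 :: real)" by metis
      then show False by (metis zero_neq_one)
    qed
  qed
qed (transfer; auto simp: algebra_simps fun_eq_iff)+

end

section \<open>Elementary operators: matrix units, cups and caps\<close>

lemma app_simps [simp]:
  "app 0 f s = 0" "app 1 f = f" "app (x + y) f s = app x f s + app y f s"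
  "app (x - y) f s = app x f s - app y f s" "app (- x) f s = - app x f s"
  "app (c *\<^sub>R x) f s = c * app x f s" "app (x * y) f = app x (app y f)"
  by (transfer; simp)+

lemma endo_eqI: "(\<And>f s. app x f s = app y f s) \<Longrightarrow> x = y"
  by (simp add: app_inject[symmetric] fun_eq_iff)

lemma app_sum: "app (\<Sum>i\<in>I. x i) f s = (\<Sum>i\<in>I. app (x i) f s)"
  by (induction I rule: infinite_finite_induct) auto

lemma app_cmult: "app T (\<lambda>s. c * f s) s' = c * app T f s'"
  using app_linear[of T c f 0 f] by (simp add: fun_eq_iff)

text \<open>The matrix unit with row \<open>x\<close> and column \<open>y\<close> in the tensor
  factor \<open>i\<close>.\<close>

lift_definition mu :: "nat \<Rightarrow> bool \<Rightarrow> bool \<Rightarrow> endo" is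
  "\<lambda>i x y f s. if s i = x then f (s(i := y)) else 0"
  by (simp add: fun_eq_iff)

lemma app_mu: "app (mu i x y) f s = (if s i = x then f (s(i := y)) else 0)"
  by transfer simp

definition del2 :: "nat \<Rightarrow> conf \<Rightarrow> conf" where
  "del2 i s = (\<lambda>j. if j < i then s j else s (Suc (Suc j)))"

definition ins2 :: "nat \<Rightarrow> bool \<Rightarrow> bool \<Rightarrow> conf \<Rightarrow> conf" where
  "ins2 i x y s = (\<lambda>j. if j < i then s j else if j = i then x else if j = Suc i then y else s (j - 2))"

text \<open>The weights are those of the invariant vector in the tensor square of the
  two-dimensional representation, scaled so that zigzags become straight and a circle has the
  Kauffman value at \<open>a\<close>.\<close>

lift_definition cupw :: "real \<Rightarrow> nat \<Rightarrow> endo" is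
  "\<lambda>a i f s. (if s i = s (Suc i) then 0 else if s i then - (1 / a) else a) * f (del2 i s)"
  by (simp add: fun_eq_iff algebra_simps)

lift_definition capw :: "real \<Rightarrow> nat \<Rightarrow> endo" is
  "\<lambda>a i f s. (1 / a) * f (ins2 i True False s) - a * f (ins2 i False True s)"
  by (simp add: fun_eq_iff algebra_simps)

lemma app_cupw:
  "app (cupw a i) f s = (if s i = s (Suc i) then 0 else if s i then - (1 / a) else a) * f (del2 i s)"
  by transfer simp

lemma app_capw:
  "app (capw a i) f s = (1 / a) * f (ins2 i True False s) - a * f (ins2 i False True s)"
  by transfer simp

abbreviation "n0 i \<equiv> mu i False False"
abbreviation "n1 i \<equiv> mu i True True"
abbreviation "ee i \<equiv> mu i False True"
abbreviation "ff i \<equiv> mu i True False"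

lemma mu_mult: "mu i x y * mu i z w = (if y = z then mu i x w else 0)"
  by (rule endo_eqI) (simp add: app_mu)

lemma mu_mult_left: "mu i x y * (mu i z w * t) = (if y = z then mu i x w * t else 0)"
  by (simp add: mult.assoc[symmetric] mu_mult)

lemma mu_commute: "i \<noteq> j \<Longrightarrow> mu i x y * mu j z w = mu j z w * mu i x y"
  by (rule endo_eqI) (auto simp: app_mu fun_upd_twist)

lemma mu_complete: "n0 i + n1 i = 1"
  by (rule endo_eqI) (auto simp: app_mu fun_upd_idem)

lemma position_cases:
  obtains "j < i" | "j = i" | "j = Suc i" | m where "j = Suc (Suc m)" "i \<le> m"
proof -
  have "j < i \<or> j = i \<or> j = Suc i \<or> (\<exists>m\<ge>i. j = Suc (Suc m))"
    by presburger
  then show thesis using that by blast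
qed

lemma ins2_high [simp]: "i \<le> m \<Longrightarrow> ins2 i x y s (Suc (Suc m)) = s m"
  by (simp add: ins2_def)

lemma ins2_low [simp]: "j < i \<Longrightarrow> ins2 i x y s j = s j"
  by (simp add: ins2_def)

lemma ins2_at [simp]: "ins2 i x y s i = x" "ins2 i x y s (Suc i) = y"
  by (auto simp: ins2_def)

lemma mu_cup_low: "j < i \<Longrightarrow> mu j x y * cupw a i = cupw a i * mu j x y"
proof (rule endo_eqI)
  fix f s assume "j < i"
  then have "del2 i (s(j := y)) = (del2 i s)(j := y)" by (auto simp: del2_def fun_eq_iff)
  then show "app (mu j x y * cupw a i) f s = app (cupw a i * mu j x y) f s"
    using \<open>j < i\<close> by (simp add: app_mu app_cupw) (simp add: del2_def)
qed

lemma mu_cup_high: "i \<le> j \<Longrightarrow> mu (Suc (Suc j)) x y * cupw a i = cupw a i * mu j x y"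
proof (rule endo_eqI)
  fix f s assume "i \<le> j"
  then have "del2 i (s(Suc (Suc j) := y)) = (del2 i s)(j := y)" by (auto simp: del2_def fun_eq_iff)
  then show "app (mu (Suc (Suc j)) x y * cupw a i) f s = app (cupw a i * mu j x y) f s"
    using \<open>i \<le> j\<close> by (simp add: app_mu app_cupw) (simp add: del2_def)
qed

lemma mu_cap_low: "j < i \<Longrightarrow> mu j x y * capw a i = capw a i * mu j x y"
proof (rule endo_eqI)
  fix f s assume "j < i"
  then have "ins2 i u v (s(j := y)) = (ins2 i u v s)(j := y)" for u v by (auto simp: ins2_def fun_eq_iff)
  then show "app (mu j x y * capw a i) f s = app (capw a i * mu j x y) f s"
    using \<open>j < i\<close> by (simp add: app_mu app_capw)
qed

lemma mu_cap_high: "i \<le> j \<Longrightarrow> mu j x y * capw a i = capw a i * mu (Suc (Suc j)) x y"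
proof (rule endo_eqI)
  fix f s assume "i \<le> j"
  have "ins2 i u v (s(j := y)) = (ins2 i u v s)(Suc (Suc j) := y)" for u v
  proof (rule ext)
    fix l
    show "ins2 i u v (s(j := y)) l = ((ins2 i u v s)(Suc (Suc j) := y)) l"
      using \<open>i \<le> j\<close> by (rule_tac position_cases[of l i]) auto
  qed
  then show "app (mu j x y * capw a i) f s = app (capw a i * mu (Suc (Suc j)) x y) f s"
    using \<open>i \<le> j\<close> by (simp add: app_mu app_capw)
qed

lemma del2_ins2 [simp]: "del2 i (ins2 i x y s) = s"
  by (auto simp: del2_def ins2_def)

lemma ins2_del2: "ins2 i x y (del2 i s) = s(i := x, Suc i := y)"
proof
  fix j
  show "ins2 i x y (del2 i s) j = (s(i := x, Suc i := y)) j"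
    by (rule position_cases[of j i]) (auto simp: del2_def)
qed

text \<open>The bound gives \<open>a^2\<close> at least 25, which beats the constant 24 that arises
  in \<open>P_triangle\<close>; it also makes the Casimir eigenvalues \<open>cas j\<close> increase
  with \<open>j\<close>.\<close>

locale skein =
  fixes a :: real
  assumes a_ge: "a \<ge> 5"
begin

lemma a_pos [simp]: "a > 0" and a_neq [simp]: "a \<noteq> 0"
  using a_ge by auto

section \<open>Temperley--Lieb relations at a real parameter\<close>

definition cup where "cup i = cupw a i"
definition cap where "cap i = capw a i"
definition U where "U i = cup i * cap i"

lemma cap_cup: "cap i * cup i = (- (a^2) - 1 / a^2) *\<^sub>R 1"
  by (rule endo_eqI) (simp add: cap_def cup_def app_capw app_cupw power2_eq_square field_simps)

lemma cap_Suc_cup: "cap (Suc i) * cup i = 1"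
proof (rule endo_eqI)
  fix f s
  have "del2 i (ins2 (Suc i) x y s) = s" if "y = s i" for x y
  proof
    fix j
    show "del2 i (ins2 (Suc i) x y s) j = s j"
      using that by (cases "j < i"; cases "j = i") (auto simp: del2_def ins2_def)
  qed
  then show "app (cap (Suc i) * cup i) f s = app 1 f s"
    by (auto simp: cap_def cup_def app_capw app_cupw)
qed

lemma cap_cup_Suc: "cap i * cup (Suc i) = 1"
proof (rule endo_eqI)
  fix f s
  have "del2 (Suc i) (ins2 i x y s) = s" if "x = s i" for x y
  proof
    fix j
    show "del2 (Suc i) (ins2 i x y s) j = s j"
      using that by (cases "j < i"; cases "j = i") (auto simp: del2_def ins2_def)
  qed
  moreover have "ins2 i x y s (Suc (Suc i)) = s i" for x y by simp
  ultimately show "app (cap i * cup (Suc i)) f s = app 1 f s"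
    by (auto simp: cap_def cup_def app_capw app_cupw)
qed

lemma app_U: "app (U i) f s = (if s i = s (Suc i) then 0
   else if s i then f (s(i := False, Suc i := True)) - f s / a^2
   else f (s(i := True, Suc i := False)) - a^2 * f s)"
proof -
  have id: "s(i := s i, Suc i := s (Suc i)) = s" by simp
  consider "s i = s (Suc i)" | "s i" "\<not> s (Suc i)" | "\<not> s i" "s (Suc i)" by auto
  then show ?thesis
    by cases (use id in \<open>simp_all add: U_def cap_def cup_def app_capw app_cupw ins2_del2 field_simps power2_eq_square\<close>)
qed

end

section \<open>Commutation of operators with disjoint supports\<close>

lemma mult_eq_left: "x * y = z \<Longrightarrow> x * (y * t) = z * t" for x y z t :: "'a::semigroup_mult"
  by (simp add: mult.assoc[symmetric])

lemma commute_left: "x * y = y * x \<Longrightarrow> x * (y * t) = y * (x * t)" for x y t :: "'a::semigroup_mult"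
  by (simp add: mult.assoc[symmetric])

lemma commute_mult:
  fixes x y z :: "'a::semigroup_mult"
  assumes "x * y = y * x" "x * z = z * x" shows "x * (y * z) = y * z * x"
proof -
  have "x * (y * z) = (y * x) * z" by (simp add: assms(1)[symmetric] mult.assoc)
  also have "\<dots> = y * z * x" by (simp add: assms(2) mult.assoc)
  finally show ?thesis .
qed

lemma mult_commute:
  fixes x y z :: "'a::semigroup_mult"
  assumes "y * x = x * y" "z * x = x * z" shows "(y * z) * x = x * (y * z)"
  using commute_mult[of x y z] assms by simp

text \<open>Reduces identities between operators on two adjacent strands to the four states of these
  strands.\<close>

lemma two_site_eqI:
  assumes "\<And>f t x y. app X f (t(i := x, Suc i := y)) = app Y f (t(i := x, Suc i := y))"
  shows "X = Y"
proof (rule endo_eqI)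
  fix f and s :: conf
  have "s(i := s i, Suc i := s (Suc i)) = s" by simp
  with assms[of f s "s i" "s (Suc i)"] show "app X f s = app Y f s" by simp
qed

lemma upd_swap: "t(Suc i := y, i := x) = t(i := x, Suc i := y)"
  by (simp add: fun_upd_twist)

text \<open>The operators supported on the strands in \<open>I\<close>. Membership stands in for
  explicit computation whenever two operators act at different places.\<close>

inductive_set alg :: "nat set \<Rightarrow> endo set" for I where
  mu: "i \<in> I \<Longrightarrow> mu i x y \<in> alg I"
| one: "1 \<in> alg I"
| add: "x \<in> alg I \<Longrightarrow> y \<in> alg I \<Longrightarrow> x + y \<in> alg I"
| mult: "x \<in> alg I \<Longrightarrow> y \<in> alg I \<Longrightarrow> x * y \<in> alg I"
| scale: "x \<in> alg I \<Longrightarrow> c *\<^sub>R x \<in> alg I"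

lemma alg_zero: "0 \<in> alg I"
  using alg.scale[OF alg.one, where c = 0] by simp

lemma alg_diff: "x \<in> alg I \<Longrightarrow> y \<in> alg I \<Longrightarrow> x - y \<in> alg I"
  using alg.add[of x I "(- 1) *\<^sub>R y"] alg.scale[of y I "- 1"] by simp

lemma alg_mono:
  assumes "x \<in> alg I" "I \<subseteq> J" shows "x \<in> alg J"
  using assms by (induction) (auto intro: alg.intros)

lemma alg_commute_mu: "x \<in> alg I \<Longrightarrow> j \<notin> I \<Longrightarrow> x * mu j u v = mu j u v * x"
proof (induction rule: alg.induct)
  case (mu i x y)
  then show ?case by (metis mu_commute)
next
  case (mult x y)
  then show ?case by (intro mult_commute) auto
qed (simp_all add: algebra_simps)

lemma alg_commute:
  assumes "y \<in> alg J" "x \<in> alg I" "I \<inter> J = {}" shows "x * y = y * x"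
  using assms
proof (induction rule: alg.induct)
  case (mu i u v)
  then show ?case by (intro alg_commute_mu) auto
next
  case (mult y z)
  then show ?case by (intro commute_mult) auto
qed (simp_all add: algebra_simps)

lemma alg_cup_low:
  assumes "x \<in> alg I" "I \<subseteq> {..<i}" shows "x * cupw a i = cupw a i * x"
  using assms
proof (induction rule: alg.induct)
  case (mu j u v)
  then show ?case by (intro mu_cup_low) auto
next
  case (mult y z)
  then show ?case by (intro mult_commute) auto
qed (simp_all add: algebra_simps)

lemma alg_cap_low:
  assumes "x \<in> alg I" "I \<subseteq> {..<i}" shows "x * capw a i = capw a i * x"
  using assms
proof (induction rule: alg.induct)
  case (mu j u v)
  then show ?case by (intro mu_cap_low) auto
next
  case (mult y z)
  then show ?case by (intro mult_commute) auto
qed (simp_all add: algebra_simps)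

section \<open>The quantum group on one and two strands\<close>

context skein
begin

text \<open>With quantum parameter q = a^2 this is q - 1/q. Correspondingly \<open>kp\<close> and
  \<open>km\<close> are square roots of the usual Cartan generator and its inverse, which gives the
  symmetric form of the coproduct.\<close>

definition dd where "dd = a^2 - 1 / a^2"
definition cc where "cc = a - 1 / a^3"
definition kp where "kp i = a *\<^sub>R n0 i + (1/a) *\<^sub>R n1 i"
definition km where "km i = (1/a) *\<^sub>R n0 i + a *\<^sub>R n1 i"
text \<open>Kauffman's resolution of a crossing with \<open>x\<close> in place of \<open>A\<close>;
  the two signs are \<open>x = a\<close> and \<open>x = 1 / a\<close>.\<close>

definition rr where "rr x i = x *\<^sub>R 1 + (1/x) *\<^sub>R U i"

lemma a_gt1: "a > 1" "a^2 > 1" "a^4 > 1"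
  using a_ge by (simp_all add: one_less_power)

lemma dd_pos: "dd > 0"
proof -
  have "1 / a^2 < 1" using a_gt1(2) by simp
  then show ?thesis unfolding dd_def using a_gt1(2) by linarith
qed

lemma cc_eq: "cc = dd / a"
  by (simp add: dd_def cc_def field_simps eval_nat_numeral)

lemma U_mu: "U i = ee i * ff (Suc i) + ff i * ee (Suc i) - a^2 *\<^sub>R (n0 i * n1 (Suc i)) - (1/a^2) *\<^sub>R (n1 i * n0 (Suc i))"
  apply (rule two_site_eqI[of _ i])
  subgoal for f t x y by (cases x; cases y) (simp_all add: app_mu app_U upd_swap)
  done

lemma U_alg: "U i \<in> alg {i, Suc i}"
  unfolding U_mu by (intro alg_diff alg.add alg.scale alg.mult alg.mu) auto

lemma rr_alg: "rr x i \<in> alg {i, Suc i}"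
  unfolding rr_def by (intro alg.add alg.scale alg.one U_alg)

lemma kp_alg: "kp i \<in> alg {i}" and km_alg: "km i \<in> alg {i}"
  unfolding kp_def km_def by (intro alg.add alg.scale alg.one alg.mu; simp)+

lemma kp_km: "kp i * km i = 1" "km i * kp i = 1"
  by (rule endo_eqI, auto simp: kp_def km_def app_mu fun_upd_idem)+

text \<open>Four-by-four matrix identities. The first four drive the induction for
  \<open>M_formula\<close>, the next four the one for \<open>M'_formula\<close>; the last four say
  that a crossing commutes with the coproducts of the generators.\<close>

lemma
  shows rr_n0: "rr a i * n0 i * rr a i = n0 (Suc i) * (kp i * kp i)" (is ?A)
  and rr_n1: "rr a i * n1 i * rr a i = n1 (Suc i) * (km i * km i) + (cc * cc) *\<^sub>R (n0 (Suc i) * (ff i * ee i))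
     + cc *\<^sub>R (ee (Suc i) * (ff i * km i)) + cc *\<^sub>R (ff (Suc i) * (km i * ee i))" (is ?B)
  and rr_ee: "rr a i * ee i * rr a i = ee (Suc i) + cc *\<^sub>R (n0 (Suc i) * (kp i * ee i))" (is ?C)
  and rr_ff: "rr a i * ff i * rr a i = ff (Suc i) + cc *\<^sub>R (n0 (Suc i) * (ff i * kp i))" (is ?D)
  and rr_n1': "rr a i * n1 (Suc i) * rr a i = n1 i * (km (Suc i) * km (Suc i))" (is ?E)
  and rr_n0': "rr a i * n0 (Suc i) * rr a i = n0 i * (kp (Suc i) * kp (Suc i)) + (cc * cc) *\<^sub>R (n1 i * (ee (Suc i) * ff (Suc i)))
     + cc *\<^sub>R (ff i * (ee (Suc i) * kp (Suc i))) + cc *\<^sub>R (ee i * (kp (Suc i) * ff (Suc i)))" (is ?F)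
  and rr_ee': "rr a i * ee (Suc i) * rr a i = ee i + cc *\<^sub>R (n1 i * (ee (Suc i) * km (Suc i)))" (is ?G)
  and rr_ff': "rr a i * ff (Suc i) * rr a i = ff i + cc *\<^sub>R (n1 i * (km (Suc i) * ff (Suc i)))" (is ?H)
  and rr_cop_ee: "rr a i * (ee i * kp (Suc i) + km i * ee (Suc i)) = (ee i * kp (Suc i) + km i * ee (Suc i)) * rr a i" (is ?I)
  and rr_cop_ff: "rr a i * (ff i * kp (Suc i) + km i * ff (Suc i)) = (ff i * kp (Suc i) + km i * ff (Suc i)) * rr a i" (is ?J)
  and rr_cop_kp: "rr a i * (kp i * kp (Suc i)) = kp i * kp (Suc i) * rr a i" (is ?K)
  and rr_cop_km: "rr a i * (km i * km (Suc i)) = km i * km (Suc i) * rr a i" (is ?L)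
proof -
  note [simp] = rr_def kp_def km_def cc_def app_mu app_U upd_swap field_simps power2_eq_square power3_eq_cube
  note * = two_site_eqI[of _ i]
  show ?A apply (rule *) subgoal for f t x y by (cases x; cases y) simp_all done
  show ?B apply (rule *) subgoal for f t x y by (cases x; cases y) simp_all done
  show ?C apply (rule *) subgoal for f t x y by (cases x; cases y) simp_all done
  show ?D apply (rule *) subgoal for f t x y by (cases x; cases y) simp_all done
  show ?E apply (rule *) subgoal for f t x y by (cases x; cases y) simp_all done
  show ?F apply (rule *) subgoal for f t x y by (cases x; cases y) simp_all done
  show ?G apply (rule *) subgoal for f t x y by (cases x; cases y) simp_all done
  show ?H apply (rule *) subgoal for f t x y by (cases x; cases y) simp_all done
  show ?I apply (rule *) subgoal for f t x y by (cases x; cases y) simp_all done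
  show ?J apply (rule *) subgoal for f t x y by (cases x; cases y) simp_all done
  show ?K apply (rule *) subgoal for f t x y by (cases x; cases y) simp_all done
  show ?L apply (rule *) subgoal for f t x y by (cases x; cases y) simp_all done
qed

lemma kp_sq: "kp i * kp i = (a^2) *\<^sub>R n0 i + (1/a^2) *\<^sub>R n1 i"
  and km_sq: "km i * km i = (1/a^2) *\<^sub>R n0 i + (a^2) *\<^sub>R n1 i"
  by (simp_all add: kp_def km_def algebra_simps mu_mult power2_eq_square)

lemma kp_ee: "kp i * ee i = a *\<^sub>R ee i" and ee_kp: "ee i * kp i = (1/a) *\<^sub>R ee i"
  and kp_ff: "kp i * ff i = (1/a) *\<^sub>R ff i" and ff_kp: "ff i * kp i = a *\<^sub>R ff i"
  and km_ee: "km i * ee i = (1/a) *\<^sub>R ee i" and ee_km: "ee i * km i = a *\<^sub>R ee i"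
  and km_ff: "km i * ff i = a *\<^sub>R ff i" and ff_km: "ff i * km i = (1/a) *\<^sub>R ff i"
  by (simp_all add: kp_def km_def algebra_simps mu_mult)

lemma ee_ff_diff: "ee i * ff i - ff i * ee i = (1/dd) *\<^sub>R (kp i * kp i - km i * km i)"
proof -
  have "kp i * kp i - km i * km i = dd *\<^sub>R (n0 i - n1 i)"
    by (simp add: kp_sq km_sq dd_def algebra_simps)
  then show ?thesis
    using dd_pos by (simp add: mu_mult)
qed

subsection \<open>Blocks of strands\<close>

text \<open>$K$, $L = K^{-1}$, $E$, $F$ and $C$ are the generators and the Casimir element of the quantum
  group with parameter $a^2$, acting on the strands $p, \dots, p+N-1$.\<close>

primrec K where "K p 0 = 1" | "K p (Suc N) = K p N * kp (p + N)"
primrec L where "L p 0 = 1" | "L p (Suc N) = L p N * km (p + N)"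
primrec E where "E p 0 = 0" | "E p (Suc N) = E p N * kp (p + N) + L p N * ee (p + N)"
primrec F where "F p 0 = 0" | "F p (Suc N) = F p N * kp (p + N) + L p N * ff (p + N)"
text \<open>The right factor acts first. Thus \<open>Rr\<close> carries the strand at position
  \<open>p\<close> to the right across the next \<open>N\<close> strands, and \<open>Rl\<close>
  carries the strand at position \<open>p + N\<close> to the left across \<open>N\<close> strands to
  position \<open>p\<close>.\<close>

primrec Rr where "Rr x p 0 = 1" | "Rr x p (Suc N) = rr x (p + N) * Rr x p N"
primrec Rl where "Rl x p 0 = 1" | "Rl x p (Suc N) = Rl x p N * rr x (p + N)"

definition C where
  "C p N = F p N * E p N + (1/dd^2) *\<^sub>R ((a^2) *\<^sub>R (K p N * K p N) + (1/a^2) *\<^sub>R (L p N * L p N))"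

lemma K_alg: "K p N \<in> alg {p..<p + N}" and L_alg: "L p N \<in> alg {p..<p + N}"
proof (induction N)
  case (Suc N)
  { case 1 show ?case using alg_mono[OF Suc(1), of "{p..<p + Suc N}"] alg_mono[OF kp_alg[of "p + N"], of "{p..<p + Suc N}"]
      by (auto intro: alg.mult) }
  { case 2 show ?case using alg_mono[OF Suc(2), of "{p..<p + Suc N}"] alg_mono[OF km_alg[of "p + N"], of "{p..<p + Suc N}"]
      by (auto intro: alg.mult) }
qed (auto intro: alg.one)

lemma E_alg: "E p N \<in> alg {p..<p + N}" and F_alg: "F p N \<in> alg {p..<p + N}"
proof (induction N)
  case (Suc N)
  let ?I = "{p..<p + Suc N}"
  have *: "kp (p + N) \<in> alg ?I" "ee (p + N) \<in> alg ?I" "ff (p + N) \<in> alg ?I" "L p N \<in> alg ?I" "E p N \<in> alg ?I" "F p N \<in> alg ?I"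
    using alg_mono[OF kp_alg[of "p + N"], of ?I] alg_mono[OF L_alg[of p N], of ?I] alg_mono[OF Suc(1), of ?I] alg_mono[OF Suc(2), of ?I]
    by (auto intro: alg.mu)
  { case 1 show ?case using * by (auto intro!: alg.mult alg.add) }
  { case 2 show ?case using * by (auto intro!: alg.mult alg.add) }
qed (auto intro: alg_zero)

lemma C_alg: "C p N \<in> alg {p..<p + N}"
  unfolding C_def by (intro alg.intros E_alg F_alg K_alg L_alg)

lemma Rr_alg: "Rr x p N \<in> alg {p..<p + Suc N}" and Rl_alg: "Rl x p N \<in> alg {p..<p + Suc N}"
proof (induction N)
  case (Suc N)
  let ?I = "{p..<p + Suc (Suc N)}"
  have *: "rr x (p + N) \<in> alg ?I" "Rr x p N \<in> alg ?I" "Rl x p N \<in> alg ?I"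
    using alg_mono[OF rr_alg[of x "p + N"], of ?I] alg_mono[OF Suc(1), of ?I] alg_mono[OF Suc(2), of ?I]
    by auto
  { case 1 show ?case using * by (auto intro!: alg.mult) }
  { case 2 show ?case using * by (auto intro!: alg.mult) }
qed (auto intro: alg.one)

lemmas block_algs = K_alg L_alg E_alg F_alg C_alg
lemma block_site:
  assumes "p + N \<le> j"
  shows "x \<in> alg {p..<p + N} \<Longrightarrow> y \<in> alg {j} \<Longrightarrow> x * y = y * x"
  using assms by (auto intro: alg_commute)

lemma mu_alg: "mu i x y \<in> alg {i}" by (rule alg.mu) simp

lemma K_left: "K p (Suc N) = kp p * K (Suc p) N" and L_left: "L p (Suc N) = km p * L (Suc p) N"
proof (induction N)
  case (Suc N)
  { case 1 show ?case using Suc(1) by (simp add: mult.assoc) }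
  { case 2 show ?case using Suc(2) by (simp add: mult.assoc) }
qed auto

lemma E_left: "E p (Suc N) = ee p * K (Suc p) N + km p * E (Suc p) N"
  and F_left: "F p (Suc N) = ff p * K (Suc p) N + km p * F (Suc p) N"
proof (induction N)
  case (Suc N)
  have EE: "E p (Suc (Suc N)) = E p (Suc N) * kp (p + Suc N) + L p (Suc N) * ee (p + Suc N)"
   and FF: "F p (Suc (Suc N)) = F p (Suc N) * kp (p + Suc N) + L p (Suc N) * ff (p + Suc N)"
    by (rule E.simps F.simps)+
  { case 1 show ?case unfolding EE Suc(1) L_left by (simp add: algebra_simps) }
  { case 2 show ?case unfolding FF Suc(2) L_left by (simp add: algebra_simps) }
qed auto

lemma Rr_left: "Rr x p (Suc N) = Rr x (Suc p) N * rr x p"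
  by (induction N) (simp_all add: mult.assoc)

lemma Rl_left: "Rl x p (Suc N) = rr x p * Rl x (Suc p) N"
  by (induction N) (simp_all add: mult.assoc[symmetric])

lemma K_L: "K p N * L p N = 1" "L p N * K p N = 1"
proof (induction N)
  case (Suc N)
  have c: "L p N * kp (p + N) = kp (p + N) * L p N" "K p N * km (p + N) = km (p + N) * K p N"
    by (rule block_site[OF order_refl L_alg kp_alg], rule block_site[OF order_refl K_alg km_alg])
  have "K p (Suc N) * L p (Suc N) = K p N * (kp (p + N) * L p N) * km (p + N)" by (simp add: mult.assoc)
  also have "\<dots> = (K p N * L p N) * (kp (p + N) * km (p + N))" unfolding c[symmetric] by (simp add: mult.assoc)
  finally show "K p (Suc N) * L p (Suc N) = 1" using Suc by (simp add: kp_km)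
  have "L p (Suc N) * K p (Suc N) = L p N * (km (p + N) * K p N) * kp (p + N)" by (simp add: mult.assoc)
  also have "\<dots> = (L p N * K p N) * (km (p + N) * kp (p + N))" unfolding c[symmetric] by (simp add: mult.assoc)
  finally show "L p (Suc N) * K p (Suc N) = 1" using Suc by (simp add: kp_km)
qed auto

lemma block_comm:
  assumes "p + N = s"
  shows "K p N * mu s x y = mu s x y * K p N" "L p N * mu s x y = mu s x y * L p N"
    "E p N * mu s x y = mu s x y * E p N" "F p N * mu s x y = mu s x y * F p N"
    "K p N * kp s = kp s * K p N" "L p N * kp s = kp s * L p N"
    "E p N * kp s = kp s * E p N" "F p N * kp s = kp s * F p N"
    "K p N * km s = km s * K p N" "L p N * km s = km s * L p N"
    "E p N * km s = km s * E p N" "F p N * km s = km s * F p N"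
  using block_site[of p N s] assms block_algs[of p N] mu_alg[of s] kp_alg[of s] km_alg[of s]
  by auto

lemma block_comm_left:
  "K (Suc s) N * mu s x y = mu s x y * K (Suc s) N" "L (Suc s) N * mu s x y = mu s x y * L (Suc s) N"
  "E (Suc s) N * mu s x y = mu s x y * E (Suc s) N" "F (Suc s) N * mu s x y = mu s x y * F (Suc s) N"
  "K (Suc s) N * kp s = kp s * K (Suc s) N" "L (Suc s) N * kp s = kp s * L (Suc s) N"
  "E (Suc s) N * kp s = kp s * E (Suc s) N" "F (Suc s) N * kp s = kp s * F (Suc s) N"
  "K (Suc s) N * km s = km s * K (Suc s) N" "L (Suc s) N * km s = km s * L (Suc s) N"
  "E (Suc s) N * km s = km s * E (Suc s) N" "F (Suc s) N * km s = km s * F (Suc s) N"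
  using block_algs[of "Suc s" N] by (auto intro!: alg_commute[OF mu_alg] alg_commute[OF kp_alg] alg_commute[OF km_alg])

text \<open>The coproduct respects the relations of the quantum group, so they pass from
  \<open>N\<close> strands and one strand to \<open>N + 1\<close>. In \<open>E_F\<close> the mixed
  terms cancel and the two differences of squares telescope.\<close>

lemma block_relations:
  shows K_E: "K p N * E p N = (a^2) *\<^sub>R (E p N * K p N)"
  and K_F: "K p N * F p N = (1/a^2) *\<^sub>R (F p N * K p N)"
  and L_E: "L p N * E p N = (1/a^2) *\<^sub>R (E p N * L p N)"
  and L_F: "L p N * F p N = (a^2) *\<^sub>R (F p N * L p N)"
  and E_F: "E p N * F p N = F p N * E p N + (1/dd) *\<^sub>R (K p N * K p N - L p N * L p N)"
proof (induction N)
  case (Suc N)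
  define s where "s = p + N"
  have pN: "p + N = s" "N + p = s" by (simp_all add: s_def)
  note c = block_comm[OF pN(1)]
  note c = c c[THEN commute_left]
  note e = kp_ee[of s] ee_kp[of s] kp_ff[of s] ff_kp[of s] km_ee[of s] ee_km[of s] km_ff[of s] ff_km[of s]
    kp_km[of s]
  note e = e e[THEN mult_eq_left]
  have kl: "K p N * (L p N * t) = t" "L p N * (K p N * t) = t" for t
    by (simp_all add: mult.assoc[symmetric] K_L)
  have b: "K p N * (E p N * t) = (a^2) *\<^sub>R (E p N * (K p N * t))"
    "K p N * (F p N * t) = (1/a^2) *\<^sub>R (F p N * (K p N * t))"
    "L p N * (E p N * t) = (1/a^2) *\<^sub>R (E p N * (L p N * t))"
    "L p N * (F p N * t) = (a^2) *\<^sub>R (F p N * (L p N * t))" for t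
    using Suc(1-4)[THEN mult_eq_left, of t] by (simp_all add: mult.assoc)
  note simps = distrib_left distrib_right mult.assoc c e K_L kl Suc(1-4) b scaleR_right_distrib power2_eq_square pN
  { case 1 show ?case by (simp add: simps) }
  { case 2 show ?case by (simp add: simps) }
  { case 3 show ?case by (simp add: simps) }
  { case 4 show ?case by (simp add: simps) }
  { case 5
    have "E p (Suc N) * F p (Suc N) - F p (Suc N) * E p (Suc N)
      = (E p N * F p N - F p N * E p N) * (kp s * kp s) + (L p N * L p N) * (ee s * ff s - ff s * ee s)"
      by (simp add: simps algebra_simps)
    also have "\<dots> = (1/dd) *\<^sub>R ((K p N * K p N - L p N * L p N) * (kp s * kp s) + L p N * L p N * (kp s * kp s - km s * km s))"
    proof -
      have d: "E p N * F p N - F p N * E p N = (1/dd) *\<^sub>R (K p N * K p N - L p N * L p N)"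
        using Suc(5) by (simp add: algebra_simps)
      show ?thesis unfolding d ee_ff_diff by (simp add: scaleR_right_distrib)
    qed
    also have "\<dots> = (1/dd) *\<^sub>R (K p (Suc N) * K p (Suc N) - L p (Suc N) * L p (Suc N))"
      by (simp add: simps algebra_simps)
    finally show ?case by (simp add: algebra_simps) }
qed auto

section \<open>The monodromy of one strand around a block\<close>

lemma sandwich: "x * b = b * x \<Longrightarrow> x * (y * b) * x = (x * y * x) * b" for x y b :: "'a::semigroup_mult"
  by (simp add: mult.assoc)

text \<open>The monodromy of one strand around $N$ parallel strands, in terms of the generators, is a
  linear combination of the Casimir elements of $N$ and of $N + 1$ strands; this is what makes the
  Casimir elements slide through crossings.\<close>

lemma M_formula:
  "Rr a p N * Rl a p N = n0 (p+N) * (K p N * K p N) + n1 (p+N) * (L p N * L p N)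
    + (cc * cc) *\<^sub>R (n0 (p+N) * (F p N * E p N)) + cc *\<^sub>R (ee (p+N) * (F p N * L p N)) + cc *\<^sub>R (ff (p+N) * (L p N * E p N))"
proof (induction N)
  case (Suc N)
  define s where "s = p + N"
  have pN: "p + N = s" "N + p = s" by (simp_all add: s_def)
  let ?R = "rr a s"
  have RB: "?R * x = x * ?R" if "x \<in> alg {p..<p+N}" for x
    using alg_commute[OF that rr_alg] by (auto simp: s_def)
  have RB': "?R * (y * x) * ?R = (?R * y * ?R) * x" if "x \<in> alg {p..<p+N}" for x y
    using sandwich[OF RB[OF that]] .
  note al = block_algs[of p N]
  note c = block_comm[OF refl, of p N, folded s_def]
  note c = c c[THEN commute_left]
  have kl: "K p N * (L p N * t) = t" "L p N * (K p N * t) = t" for t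
    by (simp_all add: mult.assoc[symmetric] K_L)
  note kk = kp_km kp_km[THEN mult_eq_left]
  have ss: "mu s x y * mu (Suc s) z w = mu (Suc s) z w * mu s x y"
    "kp s * mu (Suc s) z w = mu (Suc s) z w * kp s" "km s * mu (Suc s) z w = mu (Suc s) z w * km s" for x y z w
    by (auto intro!: alg_commute[OF mu_alg] mu_alg kp_alg km_alg)
  note ss = ss ss[THEN commute_left]
  \<comment> \<open>The moving strand passes its nearest neighbour first and again on its return, so
    a further strand multiplies the old monodromy by the same crossing on both sides.\<close>
  have "Rr a p (Suc N) * Rl a p (Suc N) = ?R * (Rr a p N * Rl a p N) * ?R"
    by (simp add: s_def mult.assoc)
  also have "\<dots> = (?R * n0 s * ?R) * (K p N * K p N) + (?R * n1 s * ?R) * (L p N * L p N)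
    + (cc * cc) *\<^sub>R ((?R * n0 s * ?R) * (F p N * E p N)) + cc *\<^sub>R ((?R * ee s * ?R) * (F p N * L p N)) + cc *\<^sub>R ((?R * ff s * ?R) * (L p N * E p N))"
    unfolding Suc.IH s_def[symmetric]
    using al by (simp only: distrib_left distrib_right mult_scaleR_left mult_scaleR_right RB' alg.mult)
  also have "\<dots> = n0 (p + Suc N) * (K p (Suc N) * K p (Suc N)) + n1 (p + Suc N) * (L p (Suc N) * L p (Suc N))
    + (cc * cc) *\<^sub>R (n0 (p + Suc N) * (F p (Suc N) * E p (Suc N))) + cc *\<^sub>R (ee (p + Suc N) * (F p (Suc N) * L p (Suc N)))
    + cc *\<^sub>R (ff (p + Suc N) * (L p (Suc N) * E p (Suc N)))"
    unfolding rr_n0 rr_n1 rr_ee rr_ff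
    by (simp add: pN distrib_left distrib_right mult.assoc c kl K_L kk ss scaleR_right_distrib ac_simps)
  finally show ?case .
qed (simp add: mu_complete)

text \<open>The reflected situation: the first strand goes around the \<open>N\<close> strands on
  its right. Here the block is extended next to the moving strand, at its left end, so the induction
  must let \<open>p\<close> vary.\<close>

lemma M'_formula:
  "Rl a p N * Rr a p N = n1 p * (L (Suc p) N * L (Suc p) N) + n0 p * (K (Suc p) N * K (Suc p) N)
    + (cc * cc) *\<^sub>R (n1 p * (E (Suc p) N * F (Suc p) N)) + cc *\<^sub>R (ff p * (E (Suc p) N * K (Suc p) N)) + cc *\<^sub>R (ee p * (K (Suc p) N * F (Suc p) N))"
proof (induction N arbitrary: p)
  case (Suc N)
  let ?R = "rr a p" and ?q = "Suc (Suc p)"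
  have RB: "?R * x = x * ?R" if "x \<in> alg {?q..<?q+N}" for x
    using alg_commute[OF that rr_alg] by auto
  have RB': "?R * (y * x) * ?R = (?R * y * ?R) * x" if "x \<in> alg {?q..<?q+N}" for x y
    using sandwich[OF RB[OF that]] .
  note al = block_algs[of ?q N]
  note c = block_comm_left[of "Suc p" N]
  note c = c c[THEN commute_left]
  have kl: "K ?q N * (L ?q N * t) = t" "L ?q N * (K ?q N * t) = t" for t
    by (simp_all add: mult.assoc[symmetric] K_L)
  note kk = kp_km kp_km[THEN mult_eq_left]
  have ss: "mu (Suc p) x y * mu p z w = mu p z w * mu (Suc p) x y"
    "kp (Suc p) * mu p z w = mu p z w * kp (Suc p)" "km (Suc p) * mu p z w = mu p z w * km (Suc p)" for x y z w
    by (auto intro!: alg_commute[OF mu_alg] mu_alg kp_alg km_alg)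
  note ss = ss ss[THEN commute_left]
  have "Rl a p (Suc N) * Rr a p (Suc N) = ?R * (Rl a (Suc p) N * Rr a (Suc p) N) * ?R"
    unfolding Rl_left Rr_left by (simp add: mult.assoc)
  also have "\<dots> = (?R * n1 (Suc p) * ?R) * (L ?q N * L ?q N) + (?R * n0 (Suc p) * ?R) * (K ?q N * K ?q N)
    + (cc * cc) *\<^sub>R ((?R * n1 (Suc p) * ?R) * (E ?q N * F ?q N)) + cc *\<^sub>R ((?R * ff (Suc p) * ?R) * (E ?q N * K ?q N)) + cc *\<^sub>R ((?R * ee (Suc p) * ?R) * (K ?q N * F ?q N))"
    unfolding Suc.IH
    using al by (simp only: distrib_left distrib_right mult_scaleR_left mult_scaleR_right RB' alg.mult)
  also have "\<dots> = n1 p * (L (Suc p) (Suc N) * L (Suc p) (Suc N)) + n0 p * (K (Suc p) (Suc N) * K (Suc p) (Suc N))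
    + (cc * cc) *\<^sub>R (n1 p * (E (Suc p) (Suc N) * F (Suc p) (Suc N))) + cc *\<^sub>R (ff p * (E (Suc p) (Suc N) * K (Suc p) (Suc N)))
    + cc *\<^sub>R (ee p * (K (Suc p) (Suc N) * F (Suc p) (Suc N)))"
    unfolding rr_n0' rr_n1' rr_ee' rr_ff' K_left L_left E_left F_left
    by (simp add: distrib_left distrib_right mult.assoc c kl K_L kk ss scaleR_right_distrib ac_simps)
  finally show ?case .
qed (use mu_complete in \<open>simp add: add.commute\<close>)

definition al where "al = dd / a^2"
text \<open>A name for this constant keeps denominators out of sight of the simplifier; powers of
  \<open>a\<close> then cancel through \<open>bb_simps\<close>.\<close>

definition bb where "bb = 1 / a^2"

lemma al_pos: "al > 0" using dd_pos by (simp add: al_def)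

lemma bb_simps: "a^2 * bb = 1" "bb * a^2 = 1" "dd = a^2 - bb" "al = dd * bb" "cc * cc = dd * dd * bb" "bb > 0"
  by (simp_all add: bb_def dd_def al_def cc_eq power2_eq_square)

lemma bb_simps_left: "a^2 * (bb * t) = t" "bb * (a^2 * t) = t" "bb * a^4 = a^2"
  by (simp_all add: bb_def eval_nat_numeral)

lemma dd_a2: "dd * a^2 = a^2 * a^2 - 1" and dd_bb: "bb * dd = 1 - bb * bb"
  unfolding bb_simps(3) by (simp_all only: left_diff_distrib right_diff_distrib bb_simps(1,2))

section \<open>Casimir elements and their quadratic relation\<close>

lemma block_rel:
  "K p N * E p N = (a^2) *\<^sub>R (E p N * K p N)"
  "K p N * F p N = bb *\<^sub>R (F p N * K p N)"
  "L p N * E p N = bb *\<^sub>R (E p N * L p N)"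
  "L p N * F p N = (a^2) *\<^sub>R (F p N * L p N)"
  "K p N * L p N = 1" "L p N * K p N = 1"
  unfolding bb_def by (rule block_relations K_L)+

lemma block_rel_left:
  "K p N * (E p N * t) = (a^2) *\<^sub>R (E p N * (K p N * t))"
  "K p N * (F p N * t) = bb *\<^sub>R (F p N * (K p N * t))"
  "L p N * (E p N * t) = bb *\<^sub>R (E p N * (L p N * t))"
  "L p N * (F p N * t) = (a^2) *\<^sub>R (F p N * (L p N * t))"
  "K p N * (L p N * t) = t" "L p N * (K p N * t) = t"
  by (simp_all add: mult.assoc[symmetric] block_rel)

lemma C_bb: "C p N = F p N * E p N + (1/(dd*dd)) *\<^sub>R ((a^2) *\<^sub>R (K p N * K p N) + bb *\<^sub>R (L p N * L p N))"
  by (simp add: C_def bb_def power2_eq_square[of dd])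

text \<open>Reordering \<open>F\<close> and \<open>E\<close> by \<open>E_F\<close> exchanges the
  weights of the squares of \<open>K\<close> and \<open>L\<close>. The two forms of the Casimir
  element correspond to the two ends of a block and to the two legs of a cup.\<close>

lemma C_alt: "C p N = E p N * F p N + (1/(dd*dd)) *\<^sub>R (bb *\<^sub>R (K p N * K p N) + (a^2) *\<^sub>R (L p N * L p N))"
proof -
  have *: "1 / dd = (1 / (dd*dd)) * a^2 - (1 / (dd*dd)) * bb"
  proof -
    have "1 / dd = (1 / (dd*dd)) * (a^2 - bb)" unfolding bb_simps(3)[symmetric] using dd_pos by simp
    then show ?thesis by (simp only: right_diff_distrib)
  qed
  show ?thesis
    unfolding C_bb E_F * by (simp add: scaleR_right_distrib scaleR_left_diff_distrib scaleR_right_diff_distrib)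
qed

lemma C_K: "C p N * K p N = K p N * C p N" and C_L: "C p N * L p N = L p N * C p N"
  by (simp_all add: C_bb distrib_left distrib_right mult.assoc block_rel block_rel_left scaleR_right_distrib bb_simps(1,2))

lemma C_E: "C p N * E p N = E p N * C p N"
proof -
  have "C p N * E p N = E p N * F p N * E p N + (1/(dd*dd)) *\<^sub>R ((a^2) *\<^sub>R (E p N * K p N * K p N) + bb *\<^sub>R (E p N * L p N * L p N))"
    unfolding C_alt
    by (simp add: distrib_left distrib_right mult.assoc block_rel block_rel_left scaleR_right_distrib bb_simps_left bb_simps(1,2))
  then show ?thesis
    by (simp add: C_bb distrib_left mult.assoc)
qed

lemma C_F: "C p N * F p N = F p N * C p N"
proof -
  have "C p N * F p N = F p N * E p N * F p N + (1/(dd*dd)) *\<^sub>R (bb *\<^sub>R (F p N * K p N * K p N) + (a^2) *\<^sub>R (F p N * L p N * L p N))"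
    unfolding C_bb
    by (simp add: distrib_left distrib_right mult.assoc block_rel block_rel_left scaleR_right_distrib bb_simps_left bb_simps(1,2))
  then show ?thesis
    by (simp add: C_alt distrib_left mult.assoc)
qed

lemma site_squares:
  "kp i * kp i - bb *\<^sub>R 1 = dd *\<^sub>R n0 i"
  "(a^2) *\<^sub>R (kp i * kp i) - 1 = (dd * a^2) *\<^sub>R n0 i"
  "(a^2) *\<^sub>R (km i * km i) - 1 = (dd * a^2) *\<^sub>R n1 i"
  "bb *\<^sub>R (km i * km i) - (bb * bb) *\<^sub>R 1 = (bb * dd) *\<^sub>R n1 i"
  "bb *\<^sub>R (kp i * kp i) - (bb * bb) *\<^sub>R 1 = (bb * dd) *\<^sub>R n0 i"
  "km i * km i - bb *\<^sub>R 1 = dd *\<^sub>R n1 i"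
  unfolding kp_sq km_sq bb_def[symmetric] mu_complete[of i, symmetric] dd_a2 dd_bb
  by (simp_all add: scaleR_right_distrib scaleR_left_diff_distrib bb_simps(1-3))

lemma coefs: "al * dd = cc * cc" "al / (dd * dd) * (dd * a^2) = 1" "al + al / (dd * dd) * (bb * dd) = 1"
  "al * a = cc"
proof -
  show "al * dd = cc * cc" by (simp add: bb_simps)
  show "al * a = cc" by (simp add: al_def cc_eq power2_eq_square)
  have "al / (dd * dd) * (dd * a^2) = bb * a^2" using dd_pos by (simp add: bb_simps(4))
  then show "al / (dd * dd) * (dd * a^2) = 1" by (simp add: bb_simps(2))
  have "al / (dd * dd) * (bb * dd) = bb * bb" using dd_pos by (simp add: bb_simps(4))
  moreover have "al + bb * bb = 1" using dd_bb by (simp add: bb_simps(4) mult.commute)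
  ultimately show "al + al / (dd * dd) * (bb * dd) = 1" by simp
qed

text \<open>Expanding the larger Casimir element by the coproduct produces the operator entries of
  \<open>M_formula\<close>. Subtracting \<open>bb *\<^sub>R C p N\<close> turns the diagonal
  coefficients into multiples of \<open>n0\<close> and \<open>n1\<close>, by
  \<open>site_squares\<close>.\<close>

lemma M_Casimir: "Rr a p N * Rl a p N = al *\<^sub>R (C p (Suc N) - bb *\<^sub>R C p N)"
proof -
  define s where "s = p + N"
  have pN: "p + N = s" "N + p = s" by (simp_all add: s_def)
  let ?X = "F p N * E p N" and ?Y = "K p N * K p N" and ?Z = "L p N * L p N" and ?P = "F p N * L p N" and ?Q = "L p N * E p N"
  note c = block_comm[OF pN(1)]
  note c = c c[THEN commute_left]
  have CS: "C p (Suc N) = (kp s * kp s) * ?X + (kp s * ee s) * ?P + (ff s * kp s) * ?Q + (ff s * ee s) * ?Z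
     + (1/(dd*dd)) *\<^sub>R ((a^2) *\<^sub>R ((kp s * kp s) * ?Y) + bb *\<^sub>R ((km s * km s) * ?Z))"
    by (simp add: C_bb pN distrib_left distrib_right mult.assoc c block_rel_left block_rel(5,6) scaleR_right_distrib ac_simps)
  have "al *\<^sub>R (C p (Suc N) - bb *\<^sub>R C p N) =
     al *\<^sub>R ((kp s * kp s - bb *\<^sub>R 1) * ?X) + al *\<^sub>R ((kp s * ee s) * ?P) + al *\<^sub>R ((ff s * kp s) * ?Q)
     + (al/(dd*dd)) *\<^sub>R (((a^2) *\<^sub>R (kp s * kp s) - (bb * a^2) *\<^sub>R 1) * ?Y)
     + (al *\<^sub>R (ff s * ee s) + (al / (dd*dd)) *\<^sub>R (bb *\<^sub>R (km s * km s) - (bb * bb) *\<^sub>R 1)) * ?Z"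
    unfolding CS C_bb[of p N]
    by (simp add: scaleR_right_distrib scaleR_right_diff_distrib distrib_left distrib_right left_diff_distrib right_diff_distrib mult.assoc)
  also have "\<dots> = (al * dd) *\<^sub>R (n0 s * ?X) + cc *\<^sub>R (ee s * ?P) + cc *\<^sub>R (ff s * ?Q)
     + (al/(dd*dd) * (dd * a^2)) *\<^sub>R (n0 s * ?Y) + (al + al/(dd*dd) * (bb*dd)) *\<^sub>R (n1 s * ?Z)"
    unfolding bb_simps(2) scaleR_one site_squares kp_ee ff_kp mu_mult
    by (simp add: scaleR_left_distrib distrib_right) (simp add: coefs(4))
  finally show ?thesis
    unfolding M_formula coefs pN by (simp add: ac_simps)
qed

lemma M'_Casimir: "Rl a p N * Rr a p N = al *\<^sub>R (C p (Suc N) - bb *\<^sub>R C (Suc p) N)"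
proof -
  let ?q = "Suc p" let ?s = p
  let ?X = "E ?q N * F ?q N" and ?Y = "K ?q N * K ?q N" and ?Z = "L ?q N * L ?q N" and ?P = "E ?q N * K ?q N" and ?Q = "K ?q N * F ?q N"
  note c = block_comm_left[of p N]
  note c = c c[THEN commute_left]
  have CS: "C p (Suc N) = (km ?s * km ?s) * ?X + (km ?s * ff ?s) * ?P + (ee ?s * km ?s) * ?Q + (ee ?s * ff ?s) * ?Y
     + (1/(dd*dd)) *\<^sub>R (bb *\<^sub>R ((kp ?s * kp ?s) * ?Y) + (a^2) *\<^sub>R ((km ?s * km ?s) * ?Z))"
    unfolding C_alt[of p] E_left F_left K_left L_left
    by (simp add: distrib_left distrib_right mult.assoc c block_rel_left block_rel(5,6) scaleR_right_distrib ac_simps)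
  have "al *\<^sub>R (C p (Suc N) - bb *\<^sub>R C ?q N) =
     al *\<^sub>R ((km ?s * km ?s - bb *\<^sub>R 1) * ?X) + al *\<^sub>R ((km ?s * ff ?s) * ?P) + al *\<^sub>R ((ee ?s * km ?s) * ?Q)
     + (al/(dd*dd)) *\<^sub>R (((a^2) *\<^sub>R (km ?s * km ?s) - (bb * a^2) *\<^sub>R 1) * ?Z)
     + (al *\<^sub>R (ee ?s * ff ?s) + (al / (dd*dd)) *\<^sub>R (bb *\<^sub>R (kp ?s * kp ?s) - (bb * bb) *\<^sub>R 1)) * ?Y"
    unfolding CS C_alt[of ?q N]
    by (simp add: scaleR_right_distrib scaleR_right_diff_distrib distrib_left distrib_right left_diff_distrib right_diff_distrib mult.assoc)
  also have "\<dots> = (al * dd) *\<^sub>R (n1 ?s * ?X) + cc *\<^sub>R (ff ?s * ?P) + cc *\<^sub>R (ee ?s * ?Q)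
     + (al/(dd*dd) * (dd * a^2)) *\<^sub>R (n1 ?s * ?Z) + (al + al/(dd*dd) * (bb*dd)) *\<^sub>R (n0 ?s * ?Y)"
    unfolding bb_simps(2) scaleR_one site_squares km_ff ee_km mu_mult
    by (simp add: scaleR_left_distrib distrib_right) (simp add: coefs(4))
  finally show ?thesis
    unfolding M'_formula coefs by (simp add: ac_simps)
qed

lemma M_Casimir_commute: "C p N * (Rr a p N * Rl a p N) = Rr a p N * Rl a p N * C p N"
proof -
  have u: "C p N * mu (p+N) x y = mu (p+N) x y * C p N" for x y
    by (rule block_site[OF order_refl C_alg mu_alg])
  have m: "C p N * (x * y) = x * y * C p N" if "C p N * x = x * C p N" "C p N * y = y * C p N" for x y
    using that by (rule commute_mult)
  have ad: "C p N * (x + y) = (x + y) * C p N" if "C p N * x = x * C p N" "C p N * y = y * C p N" for x y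
    using that by (simp add: distrib_left distrib_right)
  have sc: "C p N * (t *\<^sub>R x) = (t *\<^sub>R x) * C p N" if "C p N * x = x * C p N" for x t
    using that by simp
  show ?thesis
    unfolding M_formula by (intro m ad sc u C_K C_L C_E C_F)
qed

text \<open>A Cayley--Hamilton identity: over the last strand \<open>M\<close> is a 2 by 2 matrix
  with entries in the quantum group of the block, its trace being replaced by
  \<open>(cc * cc) *\<^sub>R C p N\<close> and its determinant by \<open>bb * bb\<close>.\<close>

lemma M_quadratic:
  defines "M \<equiv> \<lambda>p N. Rr a p N * Rl a p N"
  shows "M p N * M p N = (cc * cc) *\<^sub>R (C p N * M p N) - (bb * bb) *\<^sub>R 1"
proof -
  define s where "s = p + N"
  have pN: "p + N = s" "N + p = s" by (simp_all add: s_def)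
  define A0 where "A0 = K p N * K p N + (cc*cc) *\<^sub>R (F p N * E p N)"
  define A1 where "A1 = cc *\<^sub>R (F p N * L p N)"
  define A2 where "A2 = cc *\<^sub>R (L p N * E p N)"
  define A3 where "A3 = L p N * L p N"
  note c = block_comm[OF pN(1)]
  note c = c c[THEN commute_left]
  have Ac: "A0 * mu s x y = mu s x y * A0" "A1 * mu s x y = mu s x y * A1" "A2 * mu s x y = mu s x y * A2" "A3 * mu s x y = mu s x y * A3" for x y
    by (simp_all add: A0_def A1_def A2_def A3_def distrib_left distrib_right mult.assoc c)
  note Ac = Ac Ac[THEN commute_left]
  have Cc: "C p N * mu s x y = mu s x y * C p N" for x y
    by (rule block_site[OF _ C_alg mu_alg]) (simp add: pN)
  note Cc = Cc Cc[THEN commute_left]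
  have M: "M p N = n0 s * A0 + n1 s * A3 + ee s * A1 + ff s * A2"
    unfolding M_def M_formula A0_def A1_def A2_def A3_def pN by (simp add: distrib_left)
  define D where "D = (cc*cc) *\<^sub>R C p N"
  have bbcc: "cc * cc / (dd * dd) = bb" using dd_pos by (simp add: bb_simps(5))
  have q: "(cc * cc) *\<^sub>R ((1 / (dd * dd)) *\<^sub>R x) = bb *\<^sub>R x" for x :: endo
    using bbcc by simp
  \<comment> \<open>The two forms of the Casimir element give two expansions of the quantum trace;
    each entry of the matrix identity uses the one that fits it.\<close>
  have D0: "D = A0 + (bb * bb) *\<^sub>R A3"
    unfolding D_def A0_def A3_def C_bb by (simp only: scaleR_right_distrib q) (simp add: bb_simps(2))
  have D3: "D = (cc*cc) *\<^sub>R (E p N * F p N) + (bb * bb) *\<^sub>R (K p N * K p N) + A3"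
    unfolding D_def A3_def C_alt by (simp only: scaleR_right_distrib q) (simp add: bb_simps(2))
  have DA: "D * A0 = A0 * D" "D * A2 = A2 * D"
    unfolding D_def A0_def A2_def
    by (simp_all add: distrib_left distrib_right scaleR_right_distrib mult.assoc C_K C_E C_F C_L C_K[THEN commute_left] C_L[THEN commute_left] C_F[THEN commute_left])
  have mm: "mu s x y * mu s z w = (if y = z then mu s x w else 0)" "mu s x y * (mu s z w * t) = (if y = z then mu s x w * t else 0)" for x y z w t
    by (rule mu_mult, rule mu_mult_left)
  have MM: "M p N * M p N = n0 s * (A0 * A0 + A1 * A2) + ee s * (A0 * A1 + A1 * A3) + ff s * (A2 * A0 + A3 * A2) + n1 s * (A2 * A1 + A3 * A3)"
    unfolding M by (simp add: distrib_left distrib_right mult.assoc Ac mm)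
  have CM: "(cc * cc) *\<^sub>R (C p N * M p N) = n0 s * (D * A0) + ee s * (D * A1) + ff s * (D * A2) + n1 s * (D * A3)"
    unfolding M D_def by (simp add: distrib_left distrib_right mult.assoc Cc scaleR_right_distrib)
  have "A1 * A3 = (bb * bb) *\<^sub>R (A3 * A1)"
    by (simp add: A1_def A3_def mult.assoc block_rel block_rel_left bb_simps(1,2) bb_simps_left)
  then have i1: "A0 * A1 + A1 * A3 = D * A1"
    unfolding D0 by (simp add: distrib_right)
  have "A3 * A2 = (bb * bb) *\<^sub>R (A2 * A3)"
    by (simp add: A2_def A3_def mult.assoc block_rel block_rel_left bb_simps(1,2) bb_simps_left)
  moreover have "D * A2 = A2 * A0 + (bb * bb) *\<^sub>R (A2 * A3)"
    unfolding DA(2) by (simp add: D0 distrib_left)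
  ultimately have i2: "A2 * A0 + A3 * A2 = D * A2" by simp
  have i3: "A2 * A1 + A3 * A3 = D * A3 - (bb * bb) *\<^sub>R 1"
    unfolding D3 by (simp add: A1_def A2_def A3_def distrib_left distrib_right scaleR_right_distrib mult.assoc block_rel block_rel_left bb_simps(1,2) bb_simps_left)
  have i0: "A0 * A0 + A1 * A2 = D * A0 - (bb * bb) *\<^sub>R 1"
    unfolding D0 by (simp add: A0_def A1_def A2_def A3_def distrib_left distrib_right scaleR_right_distrib mult.assoc block_rel block_rel_left bb_simps(1,2) bb_simps_left algebra_simps)
  have "(bb * bb) *\<^sub>R n0 s + (bb * bb) *\<^sub>R n1 s = (bb * bb) *\<^sub>R (1 :: endo)"
    by (simp only: scaleR_right_distrib[symmetric] mu_complete)
  then show ?thesis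
    unfolding MM CM i0 i1 i2 i3 by (simp add: right_diff_distrib algebra_simps)
qed

lemma Casimir_commute: "C p N * C p (Suc N) = C p (Suc N) * C p N"
proof -
  have "C p (Suc N) = (1/al) *\<^sub>R (Rr a p N * Rl a p N) + bb *\<^sub>R C p N"
    unfolding M_Casimir using al_pos by simp
  then show ?thesis
    using M_Casimir_commute[of p N] by (simp add: distrib_left distrib_right)
qed

text \<open>Where \<open>C p N\<close> is a scalar, at most two eigenvalues remain for
  \<open>C p (Suc N)\<close>. This is the algebraic form of tensoring an irreducible representation
  with the two-dimensional one.\<close>

lemma Casimir_quadratic:
  "(C p (Suc N) - bb *\<^sub>R C p N) * (C p (Suc N) - (a^2) *\<^sub>R C p N) = - (1/(dd*dd)) *\<^sub>R 1"
proof -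
  define M where "M = Rr a p N * Rl a p N"
  have 1: "C p (Suc N) - bb *\<^sub>R C p N = (1/al) *\<^sub>R M"
    unfolding M_def M_Casimir using al_pos by simp
  then have "C p (Suc N) = (1/al) *\<^sub>R M + bb *\<^sub>R C p N" by (simp add: algebra_simps)
  then have 2: "C p (Suc N) - (a^2) *\<^sub>R C p N = (1/al) *\<^sub>R M - dd *\<^sub>R C p N"
    by (simp add: bb_simps(3) scaleR_left_diff_distrib)
  have "(C p (Suc N) - bb *\<^sub>R C p N) * (C p (Suc N) - (a^2) *\<^sub>R C p N) = (1/(al*al)) *\<^sub>R (M * M - (al * dd) *\<^sub>R (C p N * M))"
    unfolding 1 2 using M_Casimir_commute[of p N, folded M_def] al_pos
    by (simp add: right_diff_distrib scaleR_right_diff_distrib)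
  also have "\<dots> = (1/(al*al)) *\<^sub>R (- (bb * bb) *\<^sub>R 1)"
    unfolding M_def M_quadratic coefs by simp
  also have "\<dots> = - (1/(dd*dd)) *\<^sub>R 1"
    using bb_simps(6) dd_pos by (simp add: bb_simps(4))
  finally show ?thesis .
qed

subsection \<open>Braid relations\<close>

definition av where "av b = (if b then a else 1 / a)"
abbreviation crossing_op where "crossing_op b \<equiv> rr (av b)"

lemma av_pos [simp]: "av b > 0" and av_neq [simp]: "av b \<noteq> 0"
  by (auto simp: av_def)

lemma U_U: "U i * U i = (- (a^2) - 1 / a^2) *\<^sub>R U i"
proof -
  have "U i * U i = cup i * (cap i * cup i) * cap i" by (simp add: U_def mult.assoc)
  then show ?thesis by (simp add: cap_cup U_def)
qed

lemma U_U_U: "U i * U (Suc i) * U i = U i" "U (Suc i) * U i * U (Suc i) = U (Suc i)"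
proof -
  have "U i * U (Suc i) * U i = cup i * (cap i * cup (Suc i)) * (cap (Suc i) * cup i) * cap i"
    by (simp add: U_def mult.assoc)
  then show "U i * U (Suc i) * U i = U i" by (simp add: cap_cup_Suc cap_Suc_cup U_def)
  have "U (Suc i) * U i * U (Suc i) = cup (Suc i) * (cap (Suc i) * cup i) * (cap i * cup (Suc i)) * cap (Suc i)"
    by (simp add: U_def mult.assoc)
  then show "U (Suc i) * U i * U (Suc i) = U (Suc i)" by (simp add: cap_cup_Suc cap_Suc_cup U_def)
qed

lemma loop_value_av: "- (a^2) - 1 / a^2 = - (av b * av b) - 1 / (av b * av b)"
  by (simp add: av_def power2_eq_square)

lemma rb_inverse: "crossing_op b i * crossing_op (\<not> b) i = 1"
proof -
  have "av (\<not> b) = 1 / av b" by (simp add: av_def)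
  then have "crossing_op b i * crossing_op (\<not> b) i = 1 + (av b * av b + 1 / (av b * av b)) *\<^sub>R U i + U i * U i"
    by (simp add: rr_def distrib_left distrib_right scaleR_left_distrib scaleR_right_distrib algebra_simps)
  then show ?thesis
    unfolding U_U loop_value_av[of b] by (simp add: scaleR_left_distrib scaleR_left_diff_distrib)
qed

lemma braid: "crossing_op b i * crossing_op b (Suc i) * crossing_op b i = crossing_op b (Suc i) * crossing_op b i * crossing_op b (Suc i)"
proof -
  define x where "x = av b"
  have x: "x \<noteq> 0" by (simp add: x_def)
  have tw: "x *\<^sub>R v + x *\<^sub>R v = (x * 2) *\<^sub>R v" for v :: endo
    by (simp add: scaleR_left_distrib[symmetric])
  have e: "rr x i * rr x j * rr x i = (x*x*x) *\<^sub>R 1 + (x + x) *\<^sub>R U i + x *\<^sub>R U j + (1/x) *\<^sub>R (U i * U i)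
     + (1/x) *\<^sub>R (U i * U j) + (1/x) *\<^sub>R (U j * U i) + (1/(x*x*x)) *\<^sub>R (U i * U j * U i)" for i j
    using x by (simp add: rr_def distrib_left distrib_right mult.assoc scaleR_right_distrib)
      (simp add: algebra_simps scaleR_left_distrib tw)
  \<comment> \<open>The coefficient of \<open>U i\<close>: the linear terms, the loop in
    \<open>U i * U i\<close>, and \<open>U i * U j * U i = U i\<close>. The loop value reduces it to
    \<open>x\<close>, which makes the expansion symmetric in \<open>i\<close> and
    \<open>j\<close>.\<close>
  have z: "((x + x) + (1/x) * (- (x*x) - 1 / (x*x)) + 1/(x*x*x)) = x"
    using x by (simp add: field_simps)
  have e': "rr x i * rr x j * rr x i = (x*x*x) *\<^sub>R 1 + x *\<^sub>R U i + x *\<^sub>R U j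
     + (1/x) *\<^sub>R (U i * U j) + (1/x) *\<^sub>R (U j * U i)" if "U i * U j * U i = U i" for i j
  proof -
    have "rr x i * rr x j * rr x i = (x*x*x) *\<^sub>R 1 + ((x + x) + (1/x) * (- (x*x) - 1 / (x*x)) + 1/(x*x*x)) *\<^sub>R U i + x *\<^sub>R U j
     + (1/x) *\<^sub>R (U i * U j) + (1/x) *\<^sub>R (U j * U i)"
      unfolding e that U_U loop_value_av[of b] x_def[symmetric]
      by (simp add: scaleR_left_distrib algebra_simps tw)
    then show ?thesis unfolding z .
  qed
  show ?thesis
    unfolding x_def[symmetric] e'[OF U_U_U(1)] e'[OF U_U_U(2)] by (simp add: algebra_simps)
qed

lemma kink: "cap (Suc i) * crossing_op b i * cup (Suc i) = (- (av b ^ 3)) *\<^sub>R 1"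
proof -
  have "cap (Suc i) * U i * cup (Suc i) = (cap (Suc i) * cup i) * (cap i * cup (Suc i))" by (simp add: U_def mult.assoc)
  then have "cap (Suc i) * U i * cup (Suc i) = 1" by (simp add: cap_cup_Suc cap_Suc_cup)
  moreover have "cap (Suc i) * crossing_op b i * cup (Suc i) = av b *\<^sub>R (cap (Suc i) * cup (Suc i)) + (1 / av b) *\<^sub>R (cap (Suc i) * U i * cup (Suc i))"
    by (simp add: rr_def distrib_left distrib_right)
  ultimately have "cap (Suc i) * crossing_op b i * cup (Suc i) = (av b * (- (av b * av b) - 1 / (av b * av b)) + 1 / av b) *\<^sub>R 1"
    unfolding cap_cup loop_value_av[of b] by (simp add: scaleR_left_distrib)
  also have "av b * (- (av b * av b) - 1 / (av b * av b)) + 1 / av b = - (av b ^ 3)"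
    by (simp add: field_simps power3_eq_cube)
  finally show ?thesis .
qed

lemma Rr_Rl_inverse: "Rr (av b) p N * Rl (av (\<not> b)) p N = 1" "Rl (av b) p N * Rr (av (\<not> b)) p N = 1"
proof (induction N)
  case (Suc N)
  have "Rr (av b) p (Suc N) * Rl (av (\<not> b)) p (Suc N) = crossing_op b (p+N) * (Rr (av b) p N * Rl (av (\<not> b)) p N) * crossing_op (\<not> b) (p+N)"
    by (simp add: mult.assoc)
  then show "Rr (av b) p (Suc N) * Rl (av (\<not> b)) p (Suc N) = 1"
    unfolding Suc by (simp add: rb_inverse)
  have "Rl (av b) p (Suc N) * Rr (av (\<not> b)) p (Suc N) = Rl (av b) p N * (crossing_op b (p+N) * crossing_op (\<not> b) (p+N)) * Rr (av (\<not> b)) p N"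
    by (simp add: mult.assoc)
  then show "Rl (av b) p (Suc N) * Rr (av (\<not> b)) p (Suc N) = 1"
    unfolding rb_inverse using Suc by simp
qed auto

subsection \<open>Invariance of the Casimir elements\<close>

text \<open>\<open>U i\<close> is a combination of \<open>rr a i\<close> and \<open>1\<close>, so
  commuting with a crossing does not depend on its parameter.\<close>

lemma rr_commute_any:
  assumes "rr a i * y = y * rr a i" shows "rr x i * y = y * rr x i"
proof -
  have "U i = a *\<^sub>R rr a i - (a * a) *\<^sub>R 1" by (simp add: rr_def scaleR_right_distrib)
  then have "U i * y = y * U i" using assms by (simp add: left_diff_distrib right_diff_distrib)
  then show ?thesis by (simp add: rr_def distrib_left distrib_right)
qed

text \<open>Strands are stripped from the right end of the block until the crossing sits on the last
  two; there the claim is the two-strand computation for coproducts.\<close>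

lemma rr_block:
  assumes "p \<le> i" "i + 2 \<le> p + N"
  shows "rr a i * K p N = K p N * rr a i" "rr a i * L p N = L p N * rr a i"
    "rr a i * E p N = E p N * rr a i" "rr a i * F p N = F p N * rr a i"
proof -
  have "rr a i * K p N = K p N * rr a i \<and> rr a i * L p N = L p N * rr a i
    \<and> rr a i * E p N = E p N * rr a i \<and> rr a i * F p N = F p N * rr a i"
    using assms(2)
  proof (induction N)
    case (Suc N)
    show ?case
    proof (cases "i + 2 \<le> p + N")
      case True
      have m: "rr a i * (x * y) = x * y * rr a i" if "rr a i * x = x * rr a i" "rr a i * y = y * rr a i" for x y
        using that by (rule commute_mult)
      have ad: "rr a i * (x + y) = (x + y) * rr a i" if "rr a i * x = x * rr a i" "rr a i * y = y * rr a i" for x y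
        using that by (simp add: distrib_left distrib_right)
      have s: "rr a i * x = x * rr a i" if "x \<in> alg {p + N}" for x
        using True by (intro alg_commute[OF that rr_alg]) auto
      show ?thesis using Suc.IH True
        by (auto intro!: m ad s[OF kp_alg] s[OF km_alg] s[OF mu_alg])
    next
      case False
      then obtain N' where N: "N = Suc N'" "i = p + N'" using Suc.prems assms(1)
        by (metis Suc_leI add_2_eq_Suc' add_Suc_right add_diff_cancel_left' le_antisym le_iff_add not_less_eq_eq)
      have b: "rr a i * x = x * rr a i" if "x \<in> alg {p..<p+N'}" for x
        using alg_commute[OF that rr_alg] by (auto simp: N)
      have sand: "rr a i * (x * y) = x * y * rr a i" if "x \<in> alg {p..<p+N'}" "rr a i * y = y * rr a i" for x y
        using b[OF that(1)] that(2) by (rule commute_mult)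
      have "K p (Suc N) = K p N' * (kp i * kp (Suc i))" "L p (Suc N) = L p N' * (km i * km (Suc i))"
        by (simp_all add: N mult.assoc)
      moreover have "E p (Suc N) = E p N' * (kp i * kp (Suc i)) + L p N' * (ee i * kp (Suc i) + km i * ee (Suc i))"
        "F p (Suc N) = F p N' * (kp i * kp (Suc i)) + L p N' * (ff i * kp (Suc i) + km i * ff (Suc i))"
        by (simp_all add: N algebra_simps)
      moreover note sand[OF K_alg rr_cop_kp] sand[OF L_alg rr_cop_km] sand[OF L_alg rr_cop_ee] sand[OF L_alg rr_cop_ff]
        sand[OF E_alg rr_cop_kp] sand[OF F_alg rr_cop_kp]
      ultimately show ?thesis by (simp only: distrib_left distrib_right)
    qed
  qed (use assms(1) in auto)
  then show "rr a i * K p N = K p N * rr a i" "rr a i * L p N = L p N * rr a i"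
    "rr a i * E p N = E p N * rr a i" "rr a i * F p N = F p N * rr a i" by auto
qed

lemma rr_C:
  assumes "p \<le> i" "i + 2 \<le> p + N"
  shows "rr x i * C p N = C p N * rr x i"
proof (rule rr_commute_any)
  have m: "rr a i * (x * y) = x * y * rr a i" if "rr a i * x = x * rr a i" "rr a i * y = y * rr a i" for x y
    using that by (rule commute_mult)
  show "rr a i * C p N = C p N * rr a i"
    unfolding C_bb by (simp add: distrib_left distrib_right m rr_block[OF assms])
qed

lemma Rr_C_outer:
  assumes "p \<le> q" "q + M < p + N"
  shows "Rr x q M * C p N = C p N * Rr x q M" "Rl x q M * C p N = C p N * Rl x q M"
  using assms(2)
proof (induction M)
  case (Suc M)
  { case 1 then show ?case using Suc assms rr_C[of p "q+M" N x] by (simp add: mult_commute) }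
  { case 2 then show ?case using Suc assms rr_C[of p "q+M" N x] by (simp add: mult_commute) }
qed auto

text \<open>Both bracketings of \<open>Rl\<close>, \<open>Rr\<close>, \<open>Rl\<close> agree, so
  \<open>Rl\<close> intertwines the two monodromies. These are combinations of Casimir elements, and
  the one of \<open>N + 1\<close> strands commutes with all crossings inside the block; what remains
  is the statement for \<open>N\<close> strands.\<close>

lemma slide_a:
  shows "Rl a p N * C p N = C (Suc p) N * Rl a p N" "Rr a p N * C (Suc p) N = C p N * Rr a p N"
proof -
  have o: "Rr a p N * C p (Suc N) = C p (Suc N) * Rr a p N" "Rl a p N * C p (Suc N) = C p (Suc N) * Rl a p N"
    by (rule Rr_C_outer; simp)+
  have "Rl a p N * (Rr a p N * Rl a p N) = (Rl a p N * Rr a p N) * Rl a p N" by (simp add: mult.assoc)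
  then have "bb *\<^sub>R (Rl a p N * C p N) = bb *\<^sub>R (C (Suc p) N * Rl a p N)"
    unfolding M_Casimir M'_Casimir using al_pos o by (simp add: right_diff_distrib left_diff_distrib)
  then show "Rl a p N * C p N = C (Suc p) N * Rl a p N" using bb_simps(6) by simp
  have "Rr a p N * (Rl a p N * Rr a p N) = (Rr a p N * Rl a p N) * Rr a p N" by (simp add: mult.assoc)
  then have "bb *\<^sub>R (Rr a p N * C (Suc p) N) = bb *\<^sub>R (C p N * Rr a p N)"
    unfolding M_Casimir M'_Casimir using al_pos o by (simp add: right_diff_distrib left_diff_distrib)
  then show "Rr a p N * C (Suc p) N = C p N * Rr a p N" using bb_simps(6) by simp
qed

lemma conj_inverse:
  fixes x y c d :: endo
  assumes "x * c = d * x" "x * y = 1" "y * x = 1"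
  shows "y * d = c * y"
proof -
  have "y * d = y * (d * x) * y" by (simp add: mult.assoc assms)
  also have "\<dots> = (y * x) * c * y" by (simp add: assms(1)[symmetric] mult.assoc)
  finally show ?thesis by (simp add: assms)
qed

lemma slide:
  shows Rl_C: "Rl (av b) p N * C p N = C (Suc p) N * Rl (av b) p N"
    and Rr_C: "Rr (av b) p N * C (Suc p) N = C p N * Rr (av b) p N"
proof -
  have t: "av True = a" by (simp add: av_def)
  have "Rl (av False) p N * C p N = C (Suc p) N * Rl (av False) p N"
    by (rule conj_inverse[OF slide_a(2)]) (use Rr_Rl_inverse[of True] Rr_Rl_inverse[of False] t in auto)
  moreover have "Rr (av False) p N * C (Suc p) N = C p N * Rr (av False) p N"
    by (rule conj_inverse[OF slide_a(1)]) (use Rr_Rl_inverse[of True] Rr_Rl_inverse[of False] t in auto)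
  ultimately show "Rl (av b) p N * C p N = C (Suc p) N * Rl (av b) p N"
    "Rr (av b) p N * C (Suc p) N = C p N * Rr (av b) p N"
    using slide_a t by (cases b; simp)+
qed

subsection \<open>Crossings of cables\<close>

text \<open>The bundle of \<open>M\<close> strands starting at \<open>p\<close> crosses the
  \<open>N\<close> strands on its right; afterwards the \<open>N\<close> strands start at
  \<open>p\<close> and the \<open>M\<close> strands at \<open>p + N\<close>.\<close>

primrec X where
  "X x p 0 N = 1"
| "X x p (Suc M) N = Rr x p N * X x (Suc p) M N"

lemma X_alg: "X x p M N \<in> alg {p..<p + M + N}"
proof (induction M arbitrary: p)
  case (Suc M)
  then show ?case
    using alg_mono[OF Rr_alg[of x p N], of "{p..<p + Suc M + N}"] alg_mono[OF Suc[of "Suc p"], of "{p..<p + Suc M + N}"]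
    by (auto intro: alg.mult)
qed (auto intro: alg.one)

lemma X_0 [simp]: "X x p M 0 = 1"
  by (induction M arbitrary: p) auto

text \<open>The grid of crossings is read by columns instead of rows: crossings at distant places
  commute.\<close>

lemma X_grid_bottom: "X x p M (Suc N) = X x (Suc p) M N * Rl x p M"
proof (induction M arbitrary: p)
  case (Suc M)
  have c: "rr x p * X x (Suc (Suc p)) M N = X x (Suc (Suc p)) M N * rr x p"
    by (rule alg_commute[OF X_alg rr_alg]) auto
  have "X x p (Suc M) (Suc N) = Rr x (Suc p) N * (rr x p * X x (Suc (Suc p)) M N) * Rl x (Suc p) M"
    by (simp only: X.simps Suc Rr_left mult.assoc)
  also have "\<dots> = X x (Suc p) (Suc M) N * Rl x p (Suc M)"
    unfolding c Rl_left by (simp add: mult.assoc)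
  finally show ?case .
qed auto

lemma X_grid_top: "X x p M (Suc N) = Rl x (p + N) M * X x p M N"
proof (induction M arbitrary: p)
  case (Suc M)
  have c: "Rr x p N * Rl x (Suc (p + N)) M = Rl x (Suc (p + N)) M * Rr x p N"
    by (rule alg_commute[OF Rl_alg Rr_alg]) auto
  have "X x p (Suc M) (Suc N) = rr x (p + N) * (Rr x p N * Rl x (Suc (p + N)) M) * X x (Suc p) M N"
    by (simp add: Suc mult.assoc)
  also have "\<dots> = Rl x (p + N) (Suc M) * X x p (Suc M) N"
    unfolding c Rl_left by (simp add: mult.assoc)
  finally show ?case .
qed auto

lemma X_snoc: "X x p (Suc M) N = X x p M N * Rr x (p + M) N"
proof (induction M arbitrary: p)
  case (Suc M)
  have "X x p (Suc (Suc M)) N = Rr x p N * X x (Suc p) (Suc M) N" by (rule X.simps)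
  also have "\<dots> = Rr x p N * (X x (Suc p) M N * Rr x (Suc p + M) N)" using Suc[of "Suc p"] by simp
  finally show ?case by (simp add: mult.assoc)
qed simp

text \<open>The two moving strands may cross each other before or after they pass the
  \<open>N\<close> strands; each strand passed is one braid relation.\<close>

lemma Rr_Rr: "Rr (av b) p (Suc N) * Rr (av b) (Suc p) N = Rr (av b) p N * Rr (av b) (Suc p) N * crossing_op b p"
proof (induction N)
  case (Suc N)
  let ?R = "crossing_op b" and ?x = "av b"
  have c: "?R (Suc (p + N)) * Rr ?x p N = Rr ?x p N * ?R (Suc (p + N))"
    by (rule alg_commute[OF Rr_alg rr_alg]) auto
  have "Rr ?x p (Suc (Suc N)) * Rr ?x (Suc p) (Suc N) = ?R (Suc (p+N)) * ?R (p+N) * (Rr ?x p N * ?R (Suc (p+N))) * Rr ?x (Suc p) N"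
    by (simp add: mult.assoc)
  also have "\<dots> = (?R (Suc (p+N)) * ?R (p+N) * ?R (Suc (p+N))) * Rr ?x p N * Rr ?x (Suc p) N"
    unfolding c[symmetric] by (simp add: mult.assoc)
  also have "\<dots> = ?R (p+N) * ?R (Suc (p+N)) * (Rr ?x p (Suc N) * Rr ?x (Suc p) N)"
    unfolding braid[symmetric] by (simp add: mult.assoc)
  also have "\<dots> = ?R (p+N) * (?R (Suc (p+N)) * Rr ?x p N) * Rr ?x (Suc p) N * ?R p"
    unfolding Suc by (simp add: mult.assoc)
  also have "\<dots> = Rr ?x p (Suc N) * Rr ?x (Suc p) (Suc N) * ?R p"
    unfolding c by (simp add: mult.assoc)
  finally show ?case .
qed simp

text \<open>The third Reidemeister move for bundles of \<open>M\<close>, 1 and \<open>N\<close>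
  strands: the single middle strand is pushed to the other side of the crossing of the two
  bundles.\<close>

lemma cable_braid:
  "Rl (av b) (p + N) M * X (av b) p M N * Rr (av b) (p + M) N = Rr (av b) p N * X (av b) (Suc p) M N * Rl (av b) p M"
proof (induction M arbitrary: p)
  case (Suc M)
  let ?R = "crossing_op b" and ?x = "av b"
  have c1: "Rl ?x (Suc (p+N)) M * Rr ?x p N = Rr ?x p N * Rl ?x (Suc (p+N)) M"
    by (rule alg_commute[OF Rr_alg Rl_alg]) auto
  have c2: "?R p * X ?x (Suc (Suc p)) M N = X ?x (Suc (Suc p)) M N * ?R p"
    by (rule alg_commute[OF X_alg rr_alg]) auto
  have "Rl ?x (p+N) (Suc M) * X ?x p (Suc M) N * Rr ?x (p + Suc M) N
      = ?R (p+N) * (Rl ?x (Suc (p+N)) M * Rr ?x p N) * X ?x (Suc p) M N * Rr ?x (Suc p + M) N"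
    unfolding Rl_left by (simp add: mult.assoc)
  also have "\<dots> = ?R (p+N) * Rr ?x p N * (Rl ?x (Suc p + N) M * X ?x (Suc p) M N * Rr ?x (Suc p + M) N)"
    unfolding c1 by (simp add: mult.assoc)
  also have "\<dots> = (Rr ?x p (Suc N) * Rr ?x (Suc p) N) * X ?x (Suc (Suc p)) M N * Rl ?x (Suc p) M"
    unfolding Suc by (simp add: mult.assoc)
  also have "\<dots> = Rr ?x p N * Rr ?x (Suc p) N * (?R p * X ?x (Suc (Suc p)) M N) * Rl ?x (Suc p) M"
    unfolding Rr_Rr by (simp add: mult.assoc)
  also have "\<dots> = Rr ?x p N * X ?x (Suc p) (Suc M) N * Rl ?x p (Suc M)"
    unfolding c2 Rl_left by (simp add: mult.assoc)
  finally show ?case .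
qed simp

lemma X_C_right: "X (av b) p M N * C (p + M) N = C p N * X (av b) p M N"
proof (induction M arbitrary: p)
  case (Suc M)
  have "X (av b) p (Suc M) N * C (p + Suc M) N = Rr (av b) p N * (X (av b) (Suc p) M N * C (Suc p + M) N)"
    by (simp add: mult.assoc)
  also have "\<dots> = (Rr (av b) p N * C (Suc p) N) * X (av b) (Suc p) M N"
    unfolding Suc by (simp add: mult.assoc)
  finally show ?case unfolding Rr_C by (simp add: mult.assoc)
qed simp

lemma X_C_left: "X (av b) p M N * C p M = C (p + N) M * X (av b) p M N"
proof (induction N)
  case (Suc N)
  have "X (av b) p M (Suc N) * C p M = (Rl (av b) (p + N) M * C (p + N) M) * X (av b) p M N"
    unfolding X_grid_top using Suc by (simp add: mult.assoc)
  then show ?case unfolding Rl_C X_grid_top by (simp add: mult.assoc)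
qed simp

lemma X_inverse: "X (av b) p M N * X (av (\<not> b)) p N M = 1"
proof (induction M arbitrary: p)
  case (Suc M)
  have "X (av b) p (Suc M) N * X (av (\<not> b)) p N (Suc M)
    = Rr (av b) p N * (X (av b) (Suc p) M N * X (av (\<not> b)) (Suc p) N M) * Rl (av (\<not> b)) p N"
    unfolding X_grid_bottom by (simp add: mult.assoc)
  then show ?case unfolding Suc by (simp add: Rr_Rl_inverse)
qed simp

text \<open>The full twist: the last strand is brought to the front, the others are twisted, and it
  is brought back.\<close>

primrec T where
  "T x p 0 = 1"
| "T x p (Suc N) = Rr x p N * T x (Suc p) N * Rl x p N"

primrec CupN where "CupN p 0 = 1" | "CupN p (Suc N) = cup (p + N) * CupN p N"
primrec CapN where "CapN p 0 = 1" | "CapN p (Suc N) = CapN p N * cap (p + N)"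

lemma CupN_low: "x \<in> alg I \<Longrightarrow> I \<subseteq> {..<p} \<Longrightarrow> x * CupN p N = CupN p N * x"
proof (induction N)
  case (Suc N)
  then have "x * cup (p + N) = cup (p + N) * x"
    unfolding cup_def by (intro alg_cup_low[of _ I]) auto
  then show ?case using Suc by (simp add: commute_mult)
qed simp

lemma CapN_low: "x \<in> alg I \<Longrightarrow> I \<subseteq> {..<p} \<Longrightarrow> x * CapN p N = CapN p N * x"
proof (induction N)
  case (Suc N)
  then have "x * cap (p + N) = cap (p + N) * x"
    unfolding cap_def by (intro alg_cap_low[of _ I]) auto
  then show ?case using Suc by (simp add: commute_mult)
qed simp

text \<open>The innermost strand is pulled out of the curl. Its self-crossing is a kink with factor
  minus the cube of \<open>av b\<close>, and by \<open>cable_braid\<close> the rest of it slides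
  outwards and surrounds the curl of the other \<open>N\<close> strands, as in the recursion for
  \<open>T\<close>.\<close>

lemma cable_curl:
  "CapN (p + N) N * X (av b) p N N * CupN (p + N) N = ((- (av b ^ 3)) ^ N) *\<^sub>R T (av b) p N"
proof (induction N arbitrary: p)
  case (Suc N)
  let ?x = "av b" and ?q = "Suc (p + N)" and ?r = "Suc (p + N + N)"
  have c1: "crossing_op b (p + N + N) * X ?x p N N = X ?x p N N * crossing_op b (p + N + N)"
    by (rule alg_commute[OF X_alg rr_alg]) auto
  have c2: "y * cap ?r = cap ?r * y" "y * cup ?r = cup ?r * y" if "y \<in> alg {p..<?r}" for y
  proof -
    have ivl: "{p..<?r} \<subseteq> {..<?r}" by auto
    show "y * cap ?r = cap ?r * y" "y * cup ?r = cup ?r * y"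
      unfolding cup_def cap_def by (rule alg_cap_low[OF that ivl], rule alg_cup_low[OF that ivl])
  qed
  have in_alg: "Rl ?x (p+N) N \<in> alg {p..<?r}" "X ?x p N N \<in> alg {p..<?r}" "Rr ?x (p+N) N \<in> alg {p..<?r}"
    by (rule alg_mono[OF Rl_alg] alg_mono[OF X_alg] alg_mono[OF Rr_alg]; auto)+
  have c3: "CapN ?q N * Rr ?x p N = Rr ?x p N * CapN ?q N" "CupN ?q N * Rl ?x p N = Rl ?x p N * CupN ?q N"
  proof -
    have ivl: "{p..<p + Suc N} \<subseteq> {..<?q}" by auto
    show "CapN ?q N * Rr ?x p N = Rr ?x p N * CapN ?q N" "CupN ?q N * Rl ?x p N = Rl ?x p N * CupN ?q N"
      by (rule CapN_low[OF Rr_alg ivl, symmetric], rule CupN_low[OF Rl_alg ivl, symmetric])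
  qed
  \<comment> \<open>Isolates the crossing of the innermost strand with itself: the last strands of
    both bundles are joined by the innermost cup and cap.\<close>
  have "X ?x p (Suc N) (Suc N) = Rl ?x (p + N) N * (crossing_op b (p + N + N) * X ?x p N N) * Rr ?x (p + N) N"
    unfolding X_grid_top X_snoc by (simp add: mult.assoc)
  also have "\<dots> = (Rl ?x (p + N) N * X ?x p N N) * crossing_op b (p + N + N) * Rr ?x (p + N) N"
    unfolding c1 by (simp add: mult.assoc)
  finally have "CapN ?q (Suc N) * X ?x p (Suc N) (Suc N) * CupN ?q (Suc N)
     = CapN ?q N * (cap ?r * (Rl ?x (p + N) N * X ?x p N N)) * crossing_op b (p + N + N) * (Rr ?x (p + N) N * cup ?r) * CupN ?q N"
    by (simp add: mult.assoc)
  also have "cap ?r * (Rl ?x (p + N) N * X ?x p N N) = (Rl ?x (p + N) N * X ?x p N N) * cap ?r"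
    using c2(1)[OF alg.mult[OF in_alg(1,2)]] by simp
  also have "Rr ?x (p + N) N * cup ?r = cup ?r * Rr ?x (p + N) N"
    by (rule c2(2)[OF in_alg(3)])
  also have "CapN ?q N * ((Rl ?x (p + N) N * X ?x p N N) * cap ?r) * crossing_op b (p + N + N) * (cup ?r * Rr ?x (p + N) N) * CupN ?q N
    = CapN ?q N * (Rl ?x (p + N) N * X ?x p N N) * (cap ?r * crossing_op b (p + N + N) * cup ?r) * Rr ?x (p + N) N * CupN ?q N"
    by (simp add: mult.assoc)
  also have "\<dots> = (- (av b ^ 3)) *\<^sub>R (CapN ?q N * (Rl ?x (p + N) N * X ?x p N N * Rr ?x (p + N) N) * CupN ?q N)"
    unfolding kink by (simp add: mult.assoc)
  also have "\<dots> = (- (av b ^ 3)) *\<^sub>R ((CapN ?q N * Rr ?x p N) * X ?x (Suc p) N N * (Rl ?x p N * CupN ?q N))"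
    unfolding cable_braid by (simp add: mult.assoc)
  also have "\<dots> = (- (av b ^ 3)) *\<^sub>R (Rr ?x p N * (CapN (Suc p + N) N * X ?x (Suc p) N N * CupN (Suc p + N) N) * Rl ?x p N)"
    unfolding c3(1) c3(2)[symmetric] by (simp add: mult.assoc)
  also have "\<dots> = ((- (av b ^ 3)) ^ Suc N) *\<^sub>R T ?x p (Suc N)"
    unfolding Suc.IH by (simp add: mult.assoc)
  finally show ?case by simp
qed simp

subsection \<open>Invariance of cups and caps\<close>

lemma del2_upd: "del2 i (s(i := x)) = del2 i s" "del2 i (s(Suc i := x)) = del2 i s"
  by (auto simp: del2_def fun_eq_iff)

lemma ins2_upd: "(ins2 i x y s)(i := z) = ins2 i z y s" "(ins2 i x y s)(Suc i := z) = ins2 i x z s"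
  by (auto simp: ins2_def fun_eq_iff)

lemma site_cup:
  "kp i * (kp (Suc i) * cup i) = cup i" "km i * (km (Suc i) * cup i) = cup i"
  "ee i * (kp (Suc i) * cup i) + km i * (ee (Suc i) * cup i) = 0"
  "ff i * (kp (Suc i) * cup i) + km i * (ff (Suc i) * cup i) = 0"
  by (rule endo_eqI; auto simp: cup_def kp_def km_def app_mu app_cupw del2_upd)+

lemma site_cap:
  "cap i * (kp i * kp (Suc i)) = cap i" "cap i * (km i * km (Suc i)) = cap i"
  "cap i * (ee i * kp (Suc i)) + cap i * (km i * ee (Suc i)) = 0"
  "cap i * (ff i * kp (Suc i)) + cap i * (km i * ff (Suc i)) = 0"
  by (rule endo_eqI; auto simp: cap_def kp_def km_def app_mu app_capw ins2_upd)+

lemma K_split: "K p (M + N) = K p M * K (p + M) N" and L_split: "L p (M + N) = L p M * L (p + M) N"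
  by (induction N) (simp_all add: mult.assoc add.assoc)

lemma E_split: "E p (M + N) = E p M * K (p + M) N + L p M * E (p + M) N"
  and F_split: "F p (M + N) = F p M * K (p + M) N + L p M * F (p + M) N"
  by (induction N) (simp_all add: mult.assoc add.assoc distrib_left distrib_right L_split)

lemma kp_shift: "i \<le> j \<Longrightarrow> kp (Suc (Suc j)) * cup i = cup i * kp j" "i \<le> j \<Longrightarrow> km (Suc (Suc j)) * cup i = cup i * km j"
  "i \<le> j \<Longrightarrow> cap i * kp (Suc (Suc j)) = kp j * cap i" "i \<le> j \<Longrightarrow> cap i * km (Suc (Suc j)) = km j * cap i"
  by (simp_all add: kp_def km_def cup_def cap_def distrib_left distrib_right mu_cup_high mu_cap_high)

lemma commute2:
  fixes x y x' y' c :: endo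
  assumes "x * c = c * x'" "y * c = c * y'"
  shows "x * y * c = c * (x' * y')" "(x + y) * c = c * (x' + y')"
proof -
  have "x * y * c = x * (c * y')" by (simp add: assms mult.assoc)
  also have "\<dots> = (x * c) * y'" by (simp add: mult.assoc)
  finally show "x * y * c = c * (x' * y')" by (simp add: assms mult.assoc)
  show "(x + y) * c = c * (x' + y')" by (simp add: assms distrib_left distrib_right)
qed

lemma block_cup_shift:
  assumes "i \<le> p"
  shows "K (p + 2) N * cup i = cup i * K p N" "L (p + 2) N * cup i = cup i * L p N"
    "E (p + 2) N * cup i = cup i * E p N" "F (p + 2) N * cup i = cup i * F p N"
proof -
  have "K (p + 2) N * cup i = cup i * K p N \<and> L (p + 2) N * cup i = cup i * L p N
    \<and> E (p + 2) N * cup i = cup i * E p N \<and> F (p + 2) N * cup i = cup i * F p N"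
  proof (induction N)
    case (Suc N)
    have e: "p + 2 + N = Suc (Suc (p + N))" by simp
    show ?case unfolding K.simps L.simps E.simps F.simps e using Suc assms
      by (intro conjI commute2 kp_shift) (auto simp: cup_def intro: mu_cup_high)
  qed auto
  then show "K (p + 2) N * cup i = cup i * K p N" "L (p + 2) N * cup i = cup i * L p N"
    "E (p + 2) N * cup i = cup i * E p N" "F (p + 2) N * cup i = cup i * F p N" by auto
qed

lemma block_cap_shift:
  assumes "i \<le> p"
  shows "cap i * K (p + 2) N = K p N * cap i" "cap i * L (p + 2) N = L p N * cap i"
    "cap i * E (p + 2) N = E p N * cap i" "cap i * F (p + 2) N = F p N * cap i"
proof -
  have "K p N * cap i = cap i * K (p + 2) N \<and> L p N * cap i = cap i * L (p + 2) N
    \<and> E p N * cap i = cap i * E (p + 2) N \<and> F p N * cap i = cap i * F (p + 2) N"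
  proof (induction N)
    case (Suc N)
    have e: "p + 2 + N = Suc (Suc (p + N))" by simp
    show ?case unfolding K.simps L.simps E.simps F.simps e using Suc assms
      by (intro conjI commute2 kp_shift[symmetric]) (auto simp: cap_def intro: mu_cap_high)
  qed auto
  then show "cap i * K (p + 2) N = K p N * cap i" "cap i * L (p + 2) N = L p N * cap i"
    "cap i * E (p + 2) N = E p N * cap i" "cap i * F (p + 2) N = F p N * cap i" by auto
qed

lemma C_cup_shift: "i \<le> p \<Longrightarrow> C (p + 2) N * cup i = cup i * C p N"
  unfolding C_bb using commute2(1)[OF block_cup_shift(4,3)] commute2(1)[OF block_cup_shift(1,1)] commute2(1)[OF block_cup_shift(2,2)]
  by (simp add: distrib_left distrib_right scaleR_right_distrib)

lemma C_cap_shift: "i \<le> p \<Longrightarrow> cap i * C (p + 2) N = C p N * cap i"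
  unfolding C_bb using commute2(1)[OF block_cap_shift(4,3)[symmetric]] commute2(1)[OF block_cap_shift(1,1)[symmetric]] commute2(1)[OF block_cap_shift(2,2)[symmetric]]
  by (simp add: distrib_left distrib_right scaleR_right_distrib)

lemma CupN_shift: "p \<le> q \<Longrightarrow> C (q + 2 * N) n * CupN p N = CupN p N * C q n"
proof (induction N)
  case (Suc N)
  have "C (q + 2 * Suc N) n * CupN p (Suc N) = (C (q + 2 * N + 2) n * cup (p + N)) * CupN p N"
    by (simp add: mult.assoc add.commute add.left_commute)
  also have "\<dots> = cup (p + N) * (C (q + 2 * N) n * CupN p N)"
    using Suc.prems by (subst C_cup_shift) (auto simp: mult.assoc)
  finally show ?case using Suc by (simp add: mult.assoc)
qed simp

lemma CapN_shift: "p \<le> q \<Longrightarrow> CapN p N * C (q + 2 * N) n = C q n * CapN p N"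
proof (induction N)
  case (Suc N)
  have "CapN p (Suc N) * C (q + 2 * Suc N) n = CapN p N * (cap (p + N) * C (q + 2 * N + 2) n)"
    by (simp add: mult.assoc add.commute add.left_commute)
  also have "\<dots> = (CapN p N * C (q + 2 * N) n) * cap (p + N)"
    using Suc.prems by (subst C_cap_shift) (auto simp: mult.assoc)
  finally show ?case using Suc by (simp add: mult.assoc)
qed simp

text \<open>A cup spans a copy of the trivial representation, so a block containing both its ends
  acts like the block without them. The coproduct splits off the strands on the left; those on the
  right are shifted by two.\<close>

lemma block_cup:
  assumes "p \<le> q" "q \<le> p + N"
  shows "K p (N + 2) * cup q = cup q * K p N" "L p (N + 2) * cup q = cup q * L p N"
    "E p (N + 2) * cup q = cup q * E p N" "F p (N + 2) * cup q = cup q * F p N"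
proof -
  obtain M N' where MN: "q = p + M" "N = M + N'" using assms by (metis le_Suc_ex add_le_cancel_left)
  have e: "N + 2 = M + Suc (Suc N')" using MN by simp
  have lo: "x * cup q = cup q * x" if "x \<in> alg {p..<p + M}" for x
    unfolding cup_def using that by (rule alg_cup_low) (auto simp: MN)
  have hi: "K (Suc (Suc q)) N' * cup q = cup q * K q N'" "L (Suc (Suc q)) N' * cup q = cup q * L q N'"
    "E (Suc (Suc q)) N' * cup q = cup q * E q N'" "F (Suc (Suc q)) N' * cup q = cup q * F q N'"
    using block_cup_shift[of q q N'] by auto
  have z: "x * cup q + y * cup q = 0 \<Longrightarrow> x * (cup q * t) + y * (cup q * t) = 0" for x y t
    by (simp add: mult.assoc[symmetric] distrib_right[symmetric])
  have o: "x * (y * cup q) = cup q \<Longrightarrow> x * (y * (cup q * t)) = cup q * t" for x y t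
    by (simp add: mult.assoc[symmetric])
  have z': "x * (y * cup q) + x' * (y' * cup q) = 0 \<Longrightarrow> x * (y * (cup q * t)) + x' * (y' * (cup q * t)) = 0" for x y x' y' t
    using z[of "x * y" "x' * y'" t] by (simp add: mult.assoc)
  have K2: "K q (Suc (Suc N')) * cup q = cup q * K q N'" and L2: "L q (Suc (Suc N')) * cup q = cup q * L q N'"
    unfolding K_left L_left by (simp_all add: mult.assoc hi o[OF site_cup(1)] o[OF site_cup(2)])
  have "E q (Suc (Suc N')) * cup q = (ee q * (kp (Suc q) * (cup q * K q N')) + km q * (ee (Suc q) * (cup q * K q N'))) + km q * (km (Suc q) * (cup q * E q N'))"
    unfolding E_left K_left by (simp add: distrib_left distrib_right mult.assoc hi)
  then have E2: "E q (Suc (Suc N')) * cup q = cup q * E q N'"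
    unfolding z'[OF site_cup(3)] o[OF site_cup(2)] by simp
  have "F q (Suc (Suc N')) * cup q = (ff q * (kp (Suc q) * (cup q * K q N')) + km q * (ff (Suc q) * (cup q * K q N'))) + km q * (km (Suc q) * (cup q * F q N'))"
    unfolding F_left K_left by (simp add: distrib_left distrib_right mult.assoc hi)
  then have F2: "F q (Suc (Suc N')) * cup q = cup q * F q N'"
    unfolding z'[OF site_cup(4)] o[OF site_cup(2)] by simp
  have sp: "K p (N + 2) = K p M * K q (Suc (Suc N'))" "L p (N + 2) = L p M * L q (Suc (Suc N'))"
    "E p (N + 2) = E p M * K q (Suc (Suc N')) + L p M * E q (Suc (Suc N'))"
    "F p (N + 2) = F p M * K q (Suc (Suc N')) + L p M * F q (Suc (Suc N'))"
    unfolding e MN(1) by (rule K_split L_split E_split F_split)+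
  have sp': "K p N = K p M * K q N'" "L p N = L p M * L q N'"
    "E p N = E p M * K q N' + L p M * E q N'" "F p N = F p M * K q N' + L p M * F q N'"
    unfolding MN by (rule K_split L_split E_split F_split)+
  show "K p (N + 2) * cup q = cup q * K p N" "L p (N + 2) * cup q = cup q * L p N"
    "E p (N + 2) * cup q = cup q * E p N" "F p (N + 2) * cup q = cup q * F p N"
    unfolding sp sp' by (intro commute2 lo K_alg L_alg E_alg F_alg K2 L2 E2 F2)+
qed

lemma block_cap:
  assumes "p \<le> q" "q \<le> p + N"
  shows "cap q * K p (N + 2) = K p N * cap q" "cap q * L p (N + 2) = L p N * cap q"
    "cap q * E p (N + 2) = E p N * cap q" "cap q * F p (N + 2) = F p N * cap q"
proof -
  obtain M N' where MN: "q = p + M" "N = M + N'" using assms by (metis le_Suc_ex add_le_cancel_left)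
  have e: "N + 2 = M + Suc (Suc N')" using MN by simp
  have lo: "x * cap q = cap q * x" if "x \<in> alg {p..<p + M}" for x
    unfolding cap_def using that by (rule alg_cap_low) (auto simp: MN)
  have hi: "cap q * K (Suc (Suc q)) N' = K q N' * cap q" "cap q * L (Suc (Suc q)) N' = L q N' * cap q"
    "cap q * E (Suc (Suc q)) N' = E q N' * cap q" "cap q * F (Suc (Suc q)) N' = F q N' * cap q"
    using block_cap_shift[of q q N'] by auto
  have K2: "K q N' * cap q = cap q * K q (Suc (Suc N'))" and L2: "L q N' * cap q = cap q * L q (Suc (Suc N'))"
    unfolding K_left L_left by (simp_all only: mult.assoc[symmetric] hi[symmetric] site_cap(1,2)[unfolded mult.assoc[symmetric]])
  have "cap q * E q (Suc (Suc N')) = (cap q * (ee q * kp (Suc q)) + cap q * (km q * ee (Suc q))) * K (Suc (Suc q)) N' + cap q * (km q * km (Suc q)) * E (Suc (Suc q)) N'"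
    unfolding E_left K_left by (simp add: distrib_left distrib_right mult.assoc)
  then have E2: "E q N' * cap q = cap q * E q (Suc (Suc N'))"
    unfolding site_cap hi by simp
  have "cap q * F q (Suc (Suc N')) = (cap q * (ff q * kp (Suc q)) + cap q * (km q * ff (Suc q))) * K (Suc (Suc q)) N' + cap q * (km q * km (Suc q)) * F (Suc (Suc q)) N'"
    unfolding F_left K_left by (simp add: distrib_left distrib_right mult.assoc)
  then have F2: "F q N' * cap q = cap q * F q (Suc (Suc N'))"
    unfolding site_cap hi by simp
  have sp: "K p (N + 2) = K p M * K q (Suc (Suc N'))" "L p (N + 2) = L p M * L q (Suc (Suc N'))"
    "E p (N + 2) = E p M * K q (Suc (Suc N')) + L p M * E q (Suc (Suc N'))"
    "F p (N + 2) = F p M * K q (Suc (Suc N')) + L p M * F q (Suc (Suc N'))"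
    unfolding e MN(1) by (rule K_split L_split E_split F_split)+
  have sp': "K p N = K p M * K q N'" "L p N = L p M * L q N'"
    "E p N = E p M * K q N' + L p M * E q N'" "F p N = F p M * K q N' + L p M * F q N'"
    unfolding MN by (rule K_split L_split E_split F_split)+
  show "cap q * K p (N + 2) = K p N * cap q" "cap q * L p (N + 2) = L p N * cap q"
    "cap q * E p (N + 2) = E p N * cap q" "cap q * F p (N + 2) = F p N * cap q"
    unfolding sp sp' by (rule sym, intro commute2 lo K_alg L_alg E_alg F_alg K2 L2 E2 F2)+
qed

lemma CupN_invariant:
  "K p (2 * N) * CupN p N = CupN p N" "L p (2 * N) * CupN p N = CupN p N"
  "E p (2 * N) * CupN p N = 0" "F p (2 * N) * CupN p N = 0"
proof (induction N)
  case (Suc N)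
  have e: "2 * Suc N = 2 * N + 2" by simp
  note b = block_cup[of p "p + N" "2 * N"]
  have *: "x * CupN p (Suc N) = cup (p + N) * (y * CupN p N)" if "x * cup (p + N) = cup (p + N) * y" for x y
    using that by (simp add: mult.assoc[symmetric])
  { case 1 show ?case unfolding e by (subst *[OF b(1)]) (auto simp: Suc) }
  { case 2 show ?case unfolding e by (subst *[OF b(2)]) (auto simp: Suc) }
  { case 3 show ?case unfolding e by (subst *[OF b(3)]) (auto simp: Suc) }
  { case 4 show ?case unfolding e by (subst *[OF b(4)]) (auto simp: Suc) }
qed auto

lemma CapN_invariant:
  "CapN p N * K p (2 * N) = CapN p N" "CapN p N * L p (2 * N) = CapN p N"
  "CapN p N * E p (2 * N) = 0" "CapN p N * F p (2 * N) = 0"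
proof (induction N)
  case (Suc N)
  have e: "2 * Suc N = 2 * N + 2" by simp
  note b = block_cap[of p "p + N" "2 * N"]
  have *: "CapN p (Suc N) * x = (CapN p N * y) * cap (p + N)" if "cap (p + N) * x = y * cap (p + N)" for x y
    using that by (simp add: mult.assoc)
  { case 1 show ?case unfolding e by (subst *[OF b(1)]) (auto simp: Suc) }
  { case 2 show ?case unfolding e by (subst *[OF b(2)]) (auto simp: Suc) }
  { case 3 show ?case unfolding e by (subst *[OF b(3)]) (auto simp: Suc) }
  { case 4 show ?case unfolding e by (subst *[OF b(4)]) (auto simp: Suc) }
qed auto

lemma block_disjoint:
  assumes "x \<in> alg {p..<p + M}" "y \<in> alg {p + M..<p + M + N}" shows "x * y = y * x"
  using assms by (intro alg_commute) auto

text \<open>On an invariant vector the generators of the left half act as antipodes of those of the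
  right half. Under this exchange the form \<open>C_bb\<close> of the Casimir element becomes the
  form \<open>C_alt\<close>.\<close>

lemma CupN_C: "C p N * CupN p N = C (p + N) N * CupN p N"
proof -
  let ?c = "CupN p N" and ?q = "p + N"
  have d: "x * y = y * x" if "x \<in> alg {p..<p + N}" "y \<in> alg {?q..<?q + N}" for x y
    using that by (rule block_disjoint)
  note split = K_split[of p N N] L_split[of p N N] E_split[of p N N] F_split[of p N N]
  note inv = CupN_invariant[of p N, unfolded mult_2 split]
  have KK: "K ?q N * ?c = L p N * ?c"
  proof -
    have "L p N * ?c = L p N * (K p N * (K ?q N * ?c))" using inv(1) by (simp add: mult.assoc)
    then show ?thesis by (simp add: block_rel_left)
  qed
  have LL: "L ?q N * ?c = K p N * ?c"
  proof -
    have "K p N * ?c = K p N * (L p N * (L ?q N * ?c))" using inv(2) by (simp add: mult.assoc)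
    then show ?thesis by (simp add: block_rel_left)
  qed
  have EL: "E p N * (L p N * ?c) = - (L p N * (E ?q N * ?c))"
    using inv(3) KK by (simp add: distrib_right mult.assoc eq_neg_iff_add_eq_0)
  have FL: "F p N * (L p N * ?c) = - (L p N * (F ?q N * ?c))"
    using inv(4) KK by (simp add: distrib_right mult.assoc eq_neg_iff_add_eq_0)
  have "K p N * (E p N * (L p N * ?c)) = - (E ?q N * ?c)"
    unfolding EL by (simp add: block_rel_left)
  then have "(a^2) *\<^sub>R (E p N * ?c) = - (E ?q N * ?c)"
    by (simp add: block_rel_left)
  then have "bb *\<^sub>R ((a^2) *\<^sub>R (E p N * ?c)) = - (bb *\<^sub>R (E ?q N * ?c))"
    by simp
  then have E: "E p N * ?c = - (bb *\<^sub>R (E ?q N * ?c))"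
    by (simp add: bb_simps(1,2))
  have "K p N * (F p N * (L p N * ?c)) = - (F ?q N * ?c)"
    unfolding FL by (simp add: block_rel_left)
  then have F: "bb *\<^sub>R (F p N * ?c) = - (F ?q N * ?c)"
    by (simp add: block_rel_left)
  have "F p N * (E p N * ?c) = - (bb *\<^sub>R (E ?q N * (F p N * ?c)))"
    unfolding E using d[OF F_alg E_alg, THEN commute_left, of ?c] by simp
  also have "\<dots> = E ?q N * (F ?q N * ?c)"
    using F by (metis minus_minus mult_minus_right mult_scaleR_right)
  finally have FE: "F p N * (E p N * ?c) = E ?q N * (F ?q N * ?c)" .
  have "K p N * (K p N * ?c) = L ?q N * (L ?q N * ?c)"
    unfolding LL using d[OF K_alg L_alg, THEN commute_left, of ?c] LL by simp
  moreover have "L p N * (L p N * ?c) = K ?q N * (K ?q N * ?c)"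
    unfolding KK using d[OF L_alg K_alg, THEN commute_left, of ?c] KK by simp
  ultimately show ?thesis
    using FE unfolding C_bb[of p] C_alt[of ?q] by (simp add: distrib_right mult.assoc add.commute)
qed

lemma CapN_C: "CapN p N * C p N = CapN p N * C (p + N) N"
proof -
  let ?c = "CapN p N" and ?q = "p + N"
  have d: "x * y = y * x" if "x \<in> alg {p..<p + N}" "y \<in> alg {?q..<?q + N}" for x y
    using that by (rule block_disjoint)
  note split = K_split[of p N N] L_split[of p N N] E_split[of p N N] F_split[of p N N]
  note inv = CapN_invariant[of p N, unfolded mult_2 split]
  have r: "?c * x = ?c * y \<Longrightarrow> ?c * (x * t) = ?c * (y * t)" for x y t
    by (simp add: mult.assoc[symmetric])
  have KK: "?c * K p N = ?c * L ?q N"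
  proof -
    have "?c * L ?q N = (?c * (K p N * K ?q N)) * L ?q N" unfolding inv(1) ..
    then show ?thesis by (simp add: mult.assoc block_rel)
  qed
  have LL: "?c * L p N = ?c * K ?q N"
  proof -
    have "?c * K ?q N = (?c * (L p N * L ?q N)) * K ?q N" unfolding inv(2) ..
    then show ?thesis by (simp add: mult.assoc block_rel)
  qed
  have cancel: "x = 0" if "x * L p N = 0" for x
  proof -
    have "x = x * L p N * K p N" by (simp add: mult.assoc block_rel)
    then show ?thesis using that by simp
  qed
  have "bb *\<^sub>R (?c * E p N) + ?c * E ?q N = 0"
  proof (rule cancel)
    have "(bb *\<^sub>R (?c * E p N) + ?c * E ?q N) * L p N = ?c * (L p N * E p N) + ?c * (L p N * E ?q N)"
      using d[OF L_alg E_alg] by (simp add: distrib_right mult.assoc block_rel)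
    also have "\<dots> = ?c * (E p N * K ?q N + L p N * E ?q N)"
      using d[OF E_alg K_alg] r[OF LL, of "E p N"] by (simp add: distrib_left)
    finally show "(bb *\<^sub>R (?c * E p N) + ?c * E ?q N) * L p N = 0" using inv(3) by simp
  qed
  then have E: "?c * E ?q N = - (bb *\<^sub>R (?c * E p N))" by (simp add: eq_neg_iff_add_eq_0 add.commute)
  have "(a^2) *\<^sub>R (?c * F p N) + ?c * F ?q N = 0"
  proof (rule cancel)
    have "((a^2) *\<^sub>R (?c * F p N) + ?c * F ?q N) * L p N = ?c * (L p N * F p N) + ?c * (L p N * F ?q N)"
      using d[OF L_alg F_alg] by (simp add: distrib_right mult.assoc block_rel)
    also have "\<dots> = ?c * (F p N * K ?q N + L p N * F ?q N)"
      using d[OF F_alg K_alg] r[OF LL, of "F p N"] by (simp add: distrib_left)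
    finally show "((a^2) *\<^sub>R (?c * F p N) + ?c * F ?q N) * L p N = 0" using inv(4) by simp
  qed
  then have F: "?c * F ?q N = - ((a^2) *\<^sub>R (?c * F p N))" by (simp add: eq_neg_iff_add_eq_0 add.commute)
  have "?c * (E ?q N * F ?q N) = - (bb *\<^sub>R (?c * E p N)) * F ?q N"
    unfolding E[symmetric] by (simp add: mult.assoc)
  also have "\<dots> = - (bb *\<^sub>R (?c * F ?q N * E p N))"
    using d[OF E_alg F_alg] by (simp add: mult.assoc)
  also have "\<dots> = ?c * (F p N * E p N)"
    unfolding F by (simp add: mult.assoc bb_simps(1,2))
  finally have FE: "?c * (E ?q N * F ?q N) = ?c * (F p N * E p N)" .
  have "?c * (K p N * K p N) = ?c * (L ?q N * L ?q N)"
    using r[OF KK, of "K p N"] r[OF KK, of "L ?q N"] d[OF K_alg L_alg] by simp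
  moreover have "?c * (L p N * L p N) = ?c * (K ?q N * K ?q N)"
    using r[OF LL, of "L p N"] r[OF LL, of "K ?q N"] d[OF L_alg K_alg] by simp
  ultimately show ?thesis
    using FE unfolding C_bb[of p] C_alt[of ?q] by (simp add: distrib_left mult.assoc add.commute)
qed

end

subsection \<open>Polynomials in an operator\<close>

definition poly_op :: "real poly \<Rightarrow> endo \<Rightarrow> endo" where
  "poly_op q x = fold_coeffs (\<lambda>c y. c *\<^sub>R 1 + x * y) q 0"

lemma poly_op_0 [simp]: "poly_op 0 x = 0"
  by (simp add: poly_op_def)

lemma poly_op_pCons [simp]: "poly_op (pCons c q) x = c *\<^sub>R 1 + x * poly_op q x"
  by (cases "c = 0 \<and> q = 0") (auto simp: poly_op_def)

lemma poly_op_1 [simp]: "poly_op 1 x = 1"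
  by (simp add: one_pCons)

lemma poly_op_add: "poly_op (p + q) x = poly_op p x + poly_op q x"
  by (induction p q rule: poly_induct2) (simp_all add: algebra_simps)

lemma poly_op_smult: "poly_op (smult c q) x = c *\<^sub>R poly_op q x"
  by (induction q) (simp_all add: scaleR_right_distrib)

lemma poly_op_mult: "poly_op (p * q) x = poly_op p x * poly_op q x"
  by (induction p) (simp_all add: poly_op_add poly_op_smult distrib_right mult.assoc)

lemma poly_op_sum: "poly_op (sum f I) x = (\<Sum>i\<in>I. poly_op (f i) x)"
  by (induction I rule: infinite_finite_induct) (simp_all add: poly_op_add)

text \<open>Through this lemma everything that slides the Casimir elements also slides their
  spectral projections and the full twists.\<close>

lemma poly_op_intertwine: "y * x = x' * y \<Longrightarrow> y * poly_op q x = poly_op q x' * y"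
proof (induction q)
  case (pCons c q)
  have "y * (x * poly_op q x) = x' * (y * poly_op q x)" using pCons.prems by (simp add: mult.assoc[symmetric])
  then show ?case using pCons by (simp add: distrib_left distrib_right mult.assoc)
qed simp

lemma poly_op_alg: "x \<in> alg I \<Longrightarrow> poly_op q x \<in> alg I"
  by (induction q) (auto intro: alg.intros alg_zero)

subsection \<open>Inner products\<close>

text \<open>The first \<open>N\<close> strands vary and the rest is frozen to \<open>t\<close>,
  which makes the inner product a finite sum.\<close>

definition confs :: "nat \<Rightarrow> conf \<Rightarrow> conf set" where
  "confs N t = {s. \<forall>j\<ge>N. s j = t j}"

definition ip :: "nat \<Rightarrow> conf \<Rightarrow> vec \<Rightarrow> vec \<Rightarrow> real" where
  "ip N t f g = (\<Sum>s\<in>confs N t. f s * g s)"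

lemma confs_Suc: "confs (Suc N) t = (\<lambda>s. s(N := False)) ` confs N t \<union> (\<lambda>s. s(N := True)) ` confs N t"
proof -
  have "s \<in> (\<lambda>s. s(N := False)) ` confs N t \<union> (\<lambda>s. s(N := True)) ` confs N t" if "s \<in> confs (Suc N) t" for s
  proof -
    have in_confs: "s(N := t N) \<in> confs N t"
      using that by (auto simp: confs_def)
    have "(\<lambda>u. u(N := s N)) (s(N := t N)) \<in> (\<lambda>u. u(N := s N)) ` confs N t"
      using in_confs by (rule imageI)
    then have "s \<in> (\<lambda>u. u(N := s N)) ` confs N t" by (simp only: fun_upd_upd fun_upd_triv)
    then show ?thesis by (cases "s N") simp_all
  qed
  then show ?thesis by (auto simp: confs_def)
qed

lemma finite_confs [simp]: "finite (confs N t)"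
proof (induction N)
  case 0
  have "confs 0 t = {t}" by (auto simp: confs_def)
  then show ?case by simp
qed (simp add: confs_Suc)

lemma ip_commute: "ip N t f g = ip N t g f"
  by (simp add: ip_def mult.commute)

lemma ip_add: "ip N t (\<lambda>s. f s + f' s) g = ip N t f g + ip N t f' g" "ip N t f (\<lambda>s. g s + g' s) = ip N t f g + ip N t f g'"
  by (simp_all add: ip_def algebra_simps sum.distrib)

lemma ip_scale: "ip N t (\<lambda>s. c * f s) g = c * ip N t f g" "ip N t f (\<lambda>s. c * g s) = c * ip N t f g"
  by (simp_all add: ip_def sum_distrib_left mult.assoc mult.left_commute)

lemma ip_diff: "ip N t (\<lambda>s. f s - f' s) g = ip N t f g - ip N t f' g" "ip N t f (\<lambda>s. g s - g' s) = ip N t f g - ip N t f g'"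
  by (simp_all add: ip_def algebra_simps sum_subtractf)

lemma ip_self_nonneg [simp]: "ip N t f f \<ge> 0"
  by (simp add: ip_def sum_nonneg)

lemma ip_self_eq_0: "(\<And>t. ip N t f f = 0) \<Longrightarrow> f = (\<lambda>s. 0)"
proof
  fix s assume "\<And>t. ip N t f f = 0"
  then have "(\<Sum>u\<in>confs N s. f u * f u) = 0" by (simp add: ip_def)
  then have "\<forall>u\<in>confs N s. f u * f u = 0" by (subst (asm) sum_nonneg_eq_0_iff) auto
  then show "f s = 0" by (simp add: confs_def)
qed

text \<open>A relation rather than an operation, since adjoints exist only relative to the strands
  summed over.\<close>

definition adj :: "nat \<Rightarrow> endo \<Rightarrow> endo \<Rightarrow> bool" where
  "adj N x y \<longleftrightarrow> (\<forall>t f g. ip N t (app x f) g = ip N t f (app y g))"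

lemma adjD: "adj N x y \<Longrightarrow> ip N t (app x f) g = ip N t f (app y g)"
  by (simp add: adj_def)

lemma adj_sym: "adj N x y \<Longrightarrow> adj N y x"
  by (metis adj_def ip_commute)

lemma adj_one: "adj N 1 1" and adj_zero: "adj N 0 0"
  by (simp_all add: adj_def ip_def)

lemma app_fun: "app (x + y) f = (\<lambda>s. app x f s + app y f s)" "app (x - y) f = (\<lambda>s. app x f s - app y f s)"
  "app (c *\<^sub>R x) f = (\<lambda>s. c * app x f s)"
  by (simp_all add: fun_eq_iff)

lemma adj_add: "adj N x y \<Longrightarrow> adj N x' y' \<Longrightarrow> adj N (x + x') (y + y')"
  by (simp add: adj_def app_fun ip_add)

lemma adj_diff: "adj N x y \<Longrightarrow> adj N x' y' \<Longrightarrow> adj N (x - x') (y - y')"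
  by (simp add: adj_def app_fun ip_diff)

lemma adj_scale: "adj N x y \<Longrightarrow> adj N (c *\<^sub>R x) (c *\<^sub>R y)"
  by (simp add: adj_def app_fun ip_scale)

lemma adj_mult: "adj N x y \<Longrightarrow> adj N x' y' \<Longrightarrow> adj N (x * x') (y' * y)"
  by (simp add: adj_def)

lemma adj_mu: assumes "i < N" shows "adj N (mu i x y) (mu i y x)"
  unfolding adj_def
proof (intro allI)
  fix t and f g :: vec
  have *: "ip N t (app (mu i x y) f) g = (\<Sum>s\<in>{s\<in>confs N t. s i = x}. f (s(i := y)) * g s)" for x y and f g :: vec
    unfolding ip_def by (rule sum.mono_neutral_cong_right) (auto simp: app_mu)
  have "(\<Sum>s\<in>{s\<in>confs N t. s i = x}. f (s(i := y)) * g s) = (\<Sum>s\<in>{s\<in>confs N t. s i = y}. f s * g (s(i := x)))"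
    by (rule sum.reindex_bij_witness[of _ "\<lambda>s. s(i := x)" "\<lambda>s. s(i := y)"])
      (use assms in \<open>auto simp: confs_def fun_upd_idem\<close>)
  then show "ip N t (app (mu i x y) f) g = ip N t f (app (mu i y x) g)"
    unfolding * ip_commute[of N t f] by (simp add: mult.commute)
qed

lemma adj_poly_op: "adj N x x \<Longrightarrow> adj N (poly_op q x) (poly_op q x)"
proof (induction q)
  case (pCons c q)
  have "adj N (x * poly_op q x) (poly_op q x * x)" using pCons by (intro adj_mult) auto
  then show ?case using poly_op_intertwine[of x x x q] by (simp add: adj_add adj_scale adj_one)
qed (simp add: adj_zero)

context skein
begin

lemma adj_kp: "i < N \<Longrightarrow> adj N (kp i) (kp i)" and adj_km: "i < N \<Longrightarrow> adj N (km i) (km i)"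
  unfolding kp_def km_def by (intro adj_add adj_scale adj_mu; simp)+

lemma adj_rr: "Suc i < N \<Longrightarrow> adj N (rr x i) (rr x i)"
proof -
  assume i: "Suc i < N"
  have c: "mu i x y * mu (Suc i) z w = mu (Suc i) z w * mu i x y" for x y z w
    by (rule mu_commute) simp
  have m: "adj N (mu i x y * mu (Suc i) z w) (mu i y x * mu (Suc i) w z)" for x y z w
    unfolding c[of y x w z] using i by (intro adj_mult adj_mu) auto
  have "adj N (U i) (ff i * ee (Suc i) + ee i * ff (Suc i) - a^2 *\<^sub>R (n0 i * n1 (Suc i)) - (1/a^2) *\<^sub>R (n1 i * n0 (Suc i)))"
    unfolding U_mu by (intro adj_add adj_diff adj_scale m)
  then have "adj N (U i) (U i)" unfolding U_mu[of i] by (simp add: add.commute)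
  then show ?thesis unfolding rr_def by (intro adj_add adj_scale adj_one)
qed

lemma adj_block:
  assumes "p + N \<le> n"
  shows "adj n (K p N) (K p N)" "adj n (L p N) (L p N)" "adj n (E p N) (F p N)"
proof -
  have "adj n (K p N) (K p N) \<and> adj n (L p N) (L p N) \<and> adj n (E p N) (F p N)"
    using assms
  proof (induction N)
    case (Suc N)
    then have IH: "adj n (K p N) (K p N)" "adj n (L p N) (L p N)" "adj n (E p N) (F p N)" and l: "p + N < n" by auto
    note c = block_comm[OF refl, of p N]
    have "adj n (K p N * kp (p + N)) (kp (p + N) * K p N)" "adj n (L p N * km (p + N)) (km (p + N) * L p N)"
      "adj n (E p N * kp (p + N) + L p N * ee (p + N)) (kp (p + N) * F p N + ff (p + N) * L p N)"
      by (intro adj_add adj_mult IH adj_kp[OF l] adj_km[OF l] adj_mu[OF l])+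
    then show ?case unfolding c[symmetric] by simp
  qed (auto intro: adj_one adj_zero)
  then show "adj n (K p N) (K p N)" "adj n (L p N) (L p N)" "adj n (E p N) (F p N)" by auto
qed

lemma adj_C: "p + N \<le> n \<Longrightarrow> adj n (C p N) (C p N)"
  unfolding C_bb by (intro adj_add adj_scale adj_mult adj_block adj_sym[OF adj_block(3)]) auto

lemma adj_Rr: "p + N < n \<Longrightarrow> adj n (Rr x p N) (Rl x p N)"
  by (induction N) (auto intro: adj_one adj_mult adj_rr)

text \<open>Single crossings are symmetric, so taking the adjoint reverses their order, which
  exchanges the roles of the bundles. For \<open>M = N\<close> the cabled crossing is
  self-adjoint.\<close>

lemma adj_X: "p + M + N \<le> n \<Longrightarrow> adj n (X x p M N) (X x p N M)"
proof (induction M arbitrary: p)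
  case (Suc M)
  then have "adj n (Rr x p N * X x (Suc p) M N) (X x (Suc p) N M * Rl x p N)"
    by (intro adj_mult adj_Rr) auto
  then show ?case by (simp add: X_grid_bottom)
qed (simp add: adj_one)

text \<open>The right side is a sum of squares because \<open>E\<close> and \<open>F\<close> are
  adjoint and \<open>K\<close>, \<open>L\<close> symmetric. It shows that \<open>cas 0\<close> is
  the least possible eigenvalue and is attained only on invariant vectors.\<close>

lemma Casimir_sum: "(2::real) *\<^sub>R C p N - (2 * ((a^2 + bb) / (dd*dd))) *\<^sub>R 1
  = F p N * E p N + E p N * F p N + ((a^2 + bb) / (dd*dd)) *\<^sub>R ((K p N - L p N) * (K p N - L p N))"
proof -
  have s: "(2::real) *\<^sub>R C p N = C p N + C p N" by (simp add: scaleR_2)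
  have q: "(K p N - L p N) * (K p N - L p N) = K p N * K p N + L p N * L p N - (2::real) *\<^sub>R 1"
    by (simp add: algebra_simps K_L scaleR_2)
  show ?thesis
    unfolding s q by (subst C_bb, subst C_alt)
      (simp add: scaleR_right_distrib scaleR_right_diff_distrib scaleR_left_distrib add_divide_distrib algebra_simps)
qed

section \<open>Eigenvalues of the Casimir elements\<close>

definition wt where "wt j = a^(2*j+2)"
text \<open>The eigenvalue of the Casimir element on the irreducible representation of dimension $j + 1$.\<close>

definition cas where "cas j = (wt j + 1 / wt j) / (dd*dd)"

lemma wt_pos [simp]: "wt j > 0" by (simp add: wt_def)
lemma wt_neq [simp]: "wt j \<noteq> 0" by (simp add: wt_def)
lemma wt_Suc: "wt (Suc j) = a^2 * wt j" by (simp add: wt_def power_add power2_eq_square)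
lemma inv_wt_Suc: "1 / wt (Suc j) = bb * (1 / wt j)" by (simp add: wt_Suc bb_def)
lemma wt_gt1: "wt j > 1" unfolding wt_def using a_gt1(1) by (intro one_less_power) auto

lemma cas_0: "cas 0 = (a^2 + bb) / (dd*dd)"
  by (simp add: cas_def wt_def bb_def power2_eq_square)

lemma cas_less_Suc: "cas j < cas (Suc j)"
proof -
  have "1 / wt (Suc j) > 0" "1 / wt j < 1" using wt_gt1[of j] by auto
  moreover have "wt (Suc j) \<ge> 25 * wt j"
    unfolding wt_Suc using a_ge mult_mono[of 5 a 5 a] by (intro mult_right_mono) (auto simp: power2_eq_square less_imp_le)
  ultimately have "wt j + 1 / wt j < wt (Suc j) + 1 / wt (Suc j)" using wt_gt1[of j] by linarith
  then show ?thesis unfolding cas_def using dd_pos by (intro divide_strict_right_mono) auto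
qed

lemma cas_strict_mono: "strict_mono cas"
  using cas_less_Suc by (simp add: strict_mono_Suc_iff)

lemma cas_eq_iff [simp]: "cas i = cas j \<longleftrightarrow> i = j"
  using strict_mono_eq[OF cas_strict_mono] .

text \<open>By \<open>M_Casimir\<close> these are the eigenvalues of the monodromy when the added
  strand raises, respectively lowers, the label by one.\<close>

lemma cas_step: "al * (cas (Suc j) - bb * cas j) = bb * wt j" "al * (cas j - bb * cas (Suc j)) = bb * bb * (1 / wt j)"
proof -
  have d: "dd * dd = dd * (a^2 - bb)" using bb_simps(3) by simp
  have "cas (Suc j) - bb * cas j = ((a^2 * wt j + bb * (1 / wt j)) - bb * (wt j + 1 / wt j)) / (dd * dd)"
    unfolding cas_def inv_wt_Suc by (simp add: wt_Suc diff_divide_distrib)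
  also have "(a^2 * wt j + bb * (1 / wt j)) - bb * (wt j + 1 / wt j) = dd * wt j"
    unfolding bb_simps(3) by (simp add: algebra_simps)
  finally show "al * (cas (Suc j) - bb * cas j) = bb * wt j"
    using dd_pos by (simp add: bb_simps(4))
  have "cas j - bb * cas (Suc j) = ((wt j + 1 / wt j) - bb * (a^2 * wt j + bb * (1 / wt j))) / (dd * dd)"
    unfolding cas_def inv_wt_Suc by (simp add: wt_Suc diff_divide_distrib)
  also have "(wt j + 1 / wt j) - bb * (a^2 * wt j + bb * (1 / wt j)) = (1 - bb * bb) * (1 / wt j)"
    by (simp add: bb_simps_left bb_simps(1,2) algebra_simps)
  also have "1 - bb * bb = bb * dd" by (simp add: dd_bb)
  finally show "al * (cas j - bb * cas (Suc j)) = bb * bb * (1 / wt j)"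
    using dd_pos by (simp add: bb_simps(4))
qed

text \<open>The neighbours of \<open>cas (Suc i)\<close> are the two roots of the polynomial in
  \<open>Casimir_quadratic\<close> when \<open>C p N\<close> has the value
  \<open>cas (Suc i)\<close>.\<close>

lemma cas_vieta: "cas (Suc (Suc i)) + cas i = (a^2 + bb) * cas (Suc i)"
  "cas (Suc (Suc i)) * cas i = cas (Suc i) * cas (Suc i) + 1 / (dd*dd)"
proof -
  define w where "w = wt (Suc i)"
  define v where "v = 1 / w"
  have wv: "w * v = 1" by (simp add: v_def w_def)
  have w: "wt i = bb * w" unfolding w_def wt_Suc by (simp add: bb_simps_left)
  have v: "1 / wt i = a^2 * v" unfolding w v_def by (simp add: bb_def)
  have "1 / wt (Suc (Suc i)) = bb * v" "wt (Suc (Suc i)) = a^2 * w" "1 / wt (Suc i) = v" "wt (Suc i) = w"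
    unfolding v_def w_def by (rule inv_wt_Suc wt_Suc refl)+
  then have c: "cas (Suc (Suc i)) = (a^2 * w + bb * v) / (dd*dd)" "cas i = (bb * w + a^2 * v) / (dd*dd)" "cas (Suc i) = (w + v) / (dd*dd)"
    unfolding cas_def v by (simp_all add: w)
  show "cas (Suc (Suc i)) + cas i = (a^2 + bb) * cas (Suc i)"
    unfolding c by (simp add: add_divide_distrib algebra_simps)
  have "(a^2 * w + bb * v) * (bb * w + a^2 * v) = w * w * (a^2 * bb) + v * v * (a^2 * bb) + (a^2 * a^2 + bb * bb) * (w * v)"
    by (simp add: algebra_simps)
  also have "\<dots> = w * w + v * v + (a^2 * a^2 + bb * bb)"
    unfolding wv bb_simps(1) by simp
  also have "\<dots> = (w + v) * (w + v) + dd * dd"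
  proof -
    have "(w + v) * (w + v) = w * w + v * v + 2 * (w * v)" by (simp add: algebra_simps)
    moreover have "dd * dd = a^2 * a^2 + bb * bb - 2 * (a^2 * bb)" unfolding bb_simps(3) by (simp add: algebra_simps)
    ultimately show ?thesis unfolding wv bb_simps(1) by simp
  qed
  finally show "cas (Suc (Suc i)) * cas i = cas (Suc i) * cas (Suc i) + 1 / (dd*dd)"
    unfolding c times_divide_times_eq using dd_pos by (simp add: add_divide_distrib)
qed

subsection \<open>Spectral projections of the Casimir elements\<close>

text \<open>All labels up to \<open>N\<close> serve as interpolation nodes, also those of the wrong
  parity; their projections are zero.\<close>

definition lagrange where "lagrange N j = (\<Prod>i\<in>{..N}-{j}. smult (1 / (cas j - cas i)) [:- cas i, 1:])"
definition spectral_poly where "spectral_poly N = (\<Prod>i\<le>N. [:- cas i, 1:])"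
definition P where "P p N j = poly_op (lagrange N j) (C p N)"

lemma poly_lagrange: "i \<le> N \<Longrightarrow> poly (lagrange N j) (cas i) = (if i = j then 1 else 0)"
proof (cases "i = j")
  case True
  have "poly (smult (1 / (cas j - cas k)) [:- cas k, 1:]) (cas j) = 1" if "k \<noteq> j" for k
  proof -
    have "cas j - cas k \<noteq> 0" using that by simp
    then show ?thesis by (simp add: diff_divide_distrib[symmetric])
  qed
  then show ?thesis unfolding lagrange_def poly_prod True by (intro trans[OF prod.neutral]) auto
qed (auto simp: lagrange_def poly_prod)

lemma degree_lagrange: "j \<le> N \<Longrightarrow> degree (lagrange N j) \<le> N"
proof -
  assume "j \<le> N"
  have "degree (lagrange N j) \<le> sum (degree \<circ> (\<lambda>i. smult (1 / (cas j - cas i)) [:- cas i, 1:])) ({..N}-{j})"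
    unfolding lagrange_def by (rule degree_prod_sum_le) simp
  also have "\<dots> \<le> (\<Sum>i\<in>{..N}-{j}. 1)" by (rule sum_mono) simp
  finally show ?thesis using \<open>j \<le> N\<close> by simp
qed

lemma lagrange_sum: "(\<Sum>j\<le>N. lagrange N j) = 1"
proof (rule poly_eqI_degree)
  have "inj_on cas {..N}" by (simp add: inj_on_def)
  then have c: "card (cas ` {..N}) = Suc N" by (simp add: card_image)
  show "card (cas ` {..N}) > degree (1 :: real poly)" using c by simp
  have "degree (\<Sum>j\<le>N. lagrange N j) \<le> N" by (rule degree_sum_le) (auto intro: degree_lagrange)
  then show "card (cas ` {..N}) > degree (\<Sum>j\<le>N. lagrange N j)" using c by simp
  fix x assume "x \<in> cas ` {..N}"
  then obtain i where "i \<le> N" "x = cas i" by auto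
  then show "poly (\<Sum>j\<le>N. lagrange N j) x = poly 1 x"
    by (simp add: poly_sum poly_lagrange)
qed

lemma lagrange_spectral_poly: "j \<le> N \<Longrightarrow> \<exists>c. [:- cas j, 1:] * lagrange N j = smult c (spectral_poly N)"
proof -
  assume "j \<le> N"
  have "spectral_poly N = [:- cas j, 1:] * (\<Prod>i\<in>{..N}-{j}. [:- cas i, 1:])"
    unfolding spectral_poly_def using \<open>j \<le> N\<close> by (subst prod.remove[of _ j]) auto
  moreover have "lagrange N j = smult (\<Prod>i\<in>{..N}-{j}. 1 / (cas j - cas i)) (\<Prod>i\<in>{..N}-{j}. [:- cas i, 1:])"
    unfolding lagrange_def by (rule prod_smult)
  ultimately show ?thesis by (metis mult_smult_right)
qed

lemma spectral_poly_factor: "i \<le> N \<Longrightarrow> j \<le> N \<Longrightarrow> i \<noteq> j \<Longrightarrow> \<exists>q. spectral_poly N = q * ([:- cas i, 1:] * [:- cas j, 1:])"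
proof -
  assume "i \<le> N" "j \<le> N" "i \<noteq> j"
  then have "spectral_poly N = [:- cas i, 1:] * ([:- cas j, 1:] * (\<Prod>i\<in>{..N}-{i}-{j}. [:- cas i, 1:]))"
    unfolding spectral_poly_def by (subst prod.remove[of _ i], simp, simp, subst prod.remove[of _ j]) auto
  then have "spectral_poly N = (\<Prod>i\<in>{..N}-{i}-{j}. [:- cas i, 1:]) * ([:- cas i, 1:] * [:- cas j, 1:])"
    by (simp only: ac_simps)
  then show ?thesis ..
qed

lemma spectral_poly_factor1: "i \<le> N \<Longrightarrow> \<exists>q. spectral_poly N = q * [:- cas i, 1:]"
proof -
  assume "i \<le> N"
  then have "spectral_poly N = (\<Prod>i\<in>{..N}-{i}. [:- cas i, 1:]) * [:- cas i, 1:]"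
    unfolding spectral_poly_def by (subst prod.remove[of _ i]) (auto simp only: mult.commute finite_atMost atMost_iff)
  then show ?thesis ..
qed

definition "has_spectrum p N \<longleftrightarrow> poly_op (spectral_poly N) (C p N) = 0"

lemma P_sum: "(\<Sum>j\<le>N. P p N j) = 1"
  unfolding P_def poly_op_sum[symmetric] lagrange_sum by simp

lemma P_alg: "P p N j \<in> alg {p..<p + N}"
  unfolding P_def by (rule poly_op_alg[OF C_alg])

lemma P_C_commute: "C p N * P p N j = P p N j * C p N"
  unfolding P_def by (rule poly_op_intertwine) simp

lemma poly_op_linear: "poly_op [:- c, 1:] x = x - c *\<^sub>R 1"
  by (simp add: algebra_simps)

lemma C_P_spec: assumes "has_spectrum p N" "j \<le> N" shows "C p N * P p N j = cas j *\<^sub>R P p N j"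
proof -
  obtain c where "[:- cas j, 1:] * lagrange N j = smult c (spectral_poly N)" using lagrange_spectral_poly assms(2) by blast
  then have "poly_op ([:- cas j, 1:] * lagrange N j) (C p N) = 0"
    using assms(1) by (simp add: poly_op_smult has_spectrum_def del: poly_op_pCons)
  then have "(C p N - cas j *\<^sub>R 1) * P p N j = 0"
    unfolding poly_op_mult poly_op_linear P_def .
  then show ?thesis by (simp add: left_diff_distrib)
qed

text \<open>Pairing a vector in the image of \<open>y\<close> with \<open>Casimir_sum\<close>
  applied to it gives a vanishing sum of squared norms, so every summand vanishes.\<close>

lemma Casimir_eigen_0:
  assumes "C p N * y = cas 0 *\<^sub>R y"
  shows "E p N * y = 0" "F p N * y = 0" "K p N * y = L p N * y"
proof -
  define kap where "kap = (a^2 + bb) / (dd*dd)"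
  have kap: "kap > 0" using dd_pos bb_simps(6) by (simp add: kap_def add_pos_pos)
  have "((2::real) *\<^sub>R C p N - (2 * kap) *\<^sub>R 1) * y = 0"
    using assms by (simp add: left_diff_distrib cas_0 kap_def)
  then have z: "(F p N * E p N + E p N * F p N + kap *\<^sub>R ((K p N - L p N) * (K p N - L p N))) * y = 0"
    unfolding kap_def Casimir_sum .
  have all: "app (E p N) v = (\<lambda>s. 0) \<and> app (F p N) v = (\<lambda>s. 0) \<and> app (K p N - L p N) v = (\<lambda>s. 0)" if v: "v = app y f" for v f
  proof -
    note ad = adj_block[of p N "p + N"]
    have "app (F p N * E p N + E p N * F p N + kap *\<^sub>R ((K p N - L p N) * (K p N - L p N))) v = (\<lambda>s. 0)"
      using arg_cong[OF z, of "\<lambda>x. app x f"] by (simp add: v fun_eq_iff del: app_simps(3,4,6))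
    then have "0 = ip (p+N) t v (app (F p N * E p N + E p N * F p N + kap *\<^sub>R ((K p N - L p N) * (K p N - L p N))) v)" for t
      by (simp add: ip_def)
    then have "0 = ip (p+N) t (app (E p N) v) (app (E p N) v) + ip (p+N) t (app (F p N) v) (app (F p N) v)
       + kap * ip (p+N) t (app (K p N - L p N) v) (app (K p N - L p N) v)" for t
      using adjD[OF ad(3), of t v "app (E p N) v"] adjD[OF adj_sym[OF ad(3)], of t v "app (F p N) v"]
        adjD[OF adj_diff[OF ad(1,2)], of t v "app (K p N - L p N) v"]
      by (simp add: app_fun ip_add ip_scale del: app_simps(3,4,6))
    then have "ip (p+N) t (app (E p N) v) (app (E p N) v) = 0 \<and> ip (p+N) t (app (F p N) v) (app (F p N) v) = 0
       \<and> ip (p+N) t (app (K p N - L p N) v) (app (K p N - L p N) v) = 0" for t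
      using kap ip_self_nonneg by (smt (verit) mult_nonneg_nonneg mult_pos_pos)
    then show ?thesis using ip_self_eq_0 by auto
  qed
  show "E p N * y = 0" "F p N * y = 0" by (rule endo_eqI; use all in simp)+
  have "(K p N - L p N) * y = 0" by (rule endo_eqI) (use all in simp)
  then show "K p N * y = L p N * y" by (simp add: left_diff_distrib)
qed

lemma a_nonneg [simp]: "a \<ge> 0"
  using a_pos by linarith

lemma C_empty_block: "C p 0 = cas 0 *\<^sub>R 1"
  by (simp add: C_bb cas_0 scaleR_left_distrib[symmetric])

text \<open>The quadratic relation would also admit 2 / dd^2, the formal value of \<open>cas\<close>
  at -1. On invariant vectors, however, \<open>M_formula\<close> shows that the monodromy is the
  identity, and this selects \<open>cas (Suc 0)\<close>.\<close>

lemma Casimir_Suc_0: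
  assumes "C p N * y = cas 0 *\<^sub>R y"
  shows "C p (Suc N) * y = cas (Suc 0) *\<^sub>R y"
proof -
  note e = Casimir_eigen_0[OF assms]
  have "L p N * (L p N * y) = L p N * (K p N * y)" "K p N * (K p N * y) = K p N * (L p N * y)"
    by (simp_all only: e(3))
  then have ll: "L p N * (L p N * y) = y" "K p N * (K p N * y) = y"
    by (simp_all only: block_rel_left)
  have fl: "F p N * (L p N * y) = 0"
  proof -
    have "(a^2) *\<^sub>R (F p N * (L p N * y)) = L p N * (F p N * y)" by (simp add: block_rel_left)
    then show ?thesis using e(2) by simp
  qed
  have "Rr a p N * Rl a p N * y = n0 (p+N) * y + n1 (p+N) * y"
    unfolding M_formula by (simp add: distrib_right mult.assoc ll fl e(1))
  also have "\<dots> = y" by (simp add: distrib_right[symmetric] mu_complete)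
  finally have "al *\<^sub>R (C p (Suc N) * y - (bb * cas 0) *\<^sub>R y) = y"
    unfolding M_Casimir using assms by (simp add: left_diff_distrib)
  then have "(1/al) *\<^sub>R (al *\<^sub>R (C p (Suc N) * y - (bb * cas 0) *\<^sub>R y)) = (1/al) *\<^sub>R y"
    by (simp only:)
  then have "C p (Suc N) * y - (bb * cas 0) *\<^sub>R y = (1/al) *\<^sub>R y"
    using al_pos by simp
  moreover have "cas (Suc 0) = 1/al + bb * cas 0"
    proof -
    have "al * (cas (Suc 0) - bb * cas 0) = 1"
      unfolding cas_step by (simp add: wt_def bb_simps(2) numeral_2_eq_2[symmetric] del: power_Suc)
    then show ?thesis using al_pos by (simp add: field_simps)
  qed
  ultimately show ?thesis by (simp add: scaleR_left_distrib algebra_simps)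
qed

lemma Casimir_Suc_quadratic:
  assumes "C p N * y = cas (Suc i) *\<^sub>R y"
  shows "(C p (Suc N) - cas (Suc (Suc i)) *\<^sub>R 1) * ((C p (Suc N) - cas i *\<^sub>R 1) * y) = 0"
proof -
  let ?x = "C p (Suc N)" and ?c = "cas (Suc i)"
  have cx: "C p N * (?x * t) = ?x * (C p N * t)" for t
    using Casimir_commute[THEN commute_left] .
  have "(?x - bb *\<^sub>R C p N) * (?x - (a^2) *\<^sub>R C p N) * y = - ((1/(dd*dd)) *\<^sub>R y)"
    unfolding Casimir_quadratic by simp
  then have "?x * (?x * y) = ((a^2 + bb) * ?c) *\<^sub>R (?x * y) - (?c * ?c + 1 / (dd*dd)) *\<^sub>R y"
    using assms by (simp add: left_diff_distrib right_diff_distrib mult.assoc cx bb_simps(1,2) bb_simps_left scaleR_left_distrib algebra_simps)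
  moreover have "(?x - cas (Suc (Suc i)) *\<^sub>R 1) * ((?x - cas i *\<^sub>R 1) * y)
    = ?x * (?x * y) - (cas (Suc (Suc i)) + cas i) *\<^sub>R (?x * y) + (cas (Suc (Suc i)) * cas i) *\<^sub>R y"
    by (simp add: left_diff_distrib right_diff_distrib scaleR_left_distrib scaleR_right_diff_distrib algebra_simps)
  ultimately show ?thesis unfolding cas_vieta by simp
qed

text \<open>The projections of \<open>N\<close> strands sum to 1. On the image of each of them the
  next Casimir element is annihilated by one or two linear factors of the next polynomial.\<close>

lemma has_spectrum: "has_spectrum p N"
proof (induction N)
  case 0
  have "poly_op (spectral_poly 0) (C p 0) = C p 0 - cas 0 *\<^sub>R 1" by (simp add: spectral_poly_def)
  then show ?case unfolding has_spectrum_def C_empty_block by simp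
next
  case (Suc N)
  let ?x = "C p (Suc N)"
  have "poly_op (spectral_poly (Suc N)) ?x * P p N i = 0" if i: "i \<le> N" for i
  proof (cases i)
    case 0
    obtain q where q: "spectral_poly (Suc N) = q * [:- cas (Suc 0), 1:]" using spectral_poly_factor1[of "Suc 0" "Suc N"] by auto
    have "(?x - cas (Suc 0) *\<^sub>R 1) * P p N 0 = 0"
      using Casimir_Suc_0[OF C_P_spec[OF Suc, of 0]] by (simp add: left_diff_distrib)
    then show ?thesis unfolding q poly_op_mult poly_op_linear 0 by (simp add: mult.assoc)
  next
    case (Suc i')
    obtain q where q: "spectral_poly (Suc N) = q * ([:- cas (Suc (Suc i')), 1:] * [:- cas i', 1:])"
      using spectral_poly_factor[of "Suc (Suc i')" "Suc N" i'] i Suc by auto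
    have "(?x - cas (Suc (Suc i')) *\<^sub>R 1) * ((?x - cas i' *\<^sub>R 1) * P p N i) = 0"
      using Casimir_Suc_quadratic C_P_spec[OF \<open>has_spectrum p N\<close> i] unfolding Suc by blast
    then show ?thesis unfolding q poly_op_mult poly_op_linear by (simp add: mult.assoc)
  qed
  then have "poly_op (spectral_poly (Suc N)) ?x * (\<Sum>i\<le>N. P p N i) = 0"
    by (simp add: sum_distrib_left)
  then show ?case unfolding P_sum has_spectrum_def by simp
qed

lemmas C_P = C_P_spec[OF has_spectrum]

lemma P_P: "i \<le> N \<Longrightarrow> j \<le> N \<Longrightarrow> i \<noteq> j \<Longrightarrow> P p N i * P p N j = 0"
proof -
  assume ij: "i \<le> N" "j \<le> N" "i \<noteq> j"
  have "cas i *\<^sub>R (P p N i * P p N j) = C p N * P p N i * P p N j" using C_P[OF ij(1)] by simp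
  also have "\<dots> = P p N i * (C p N * P p N j)" unfolding P_C_commute[of p N i] by (simp only: mult.assoc)
  also have "\<dots> = cas j *\<^sub>R (P p N i * P p N j)" using C_P[OF ij(2)] by simp
  finally have "(cas i - cas j) *\<^sub>R (P p N i * P p N j) = 0" by (simp add: scaleR_left_diff_distrib)
  then show ?thesis using ij by simp
qed

lemma P_idem: "j \<le> N \<Longrightarrow> P p N j * P p N j = P p N j"
proof -
  assume j: "j \<le> N"
  have "P p N j = P p N j * (\<Sum>i\<le>N. P p N i)" unfolding P_sum by simp
  also have "\<dots> = (\<Sum>i\<le>N. if i = j then P p N j * P p N j else 0)"
    unfolding sum_distrib_left using j by (intro sum.cong) (auto simp: P_P)
  finally show ?thesis using j by simp
qed

lemma adj_P: "p + N \<le> n \<Longrightarrow> adj n (P p N j) (P p N j)"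
  unfolding P_def by (intro adj_poly_op adj_C)

lemma P_intertwine: "y * C p N = C q N * y \<Longrightarrow> y * P p N j = P q N j * y"
  unfolding P_def by (rule poly_op_intertwine)

text \<open>The branching rule. Both Casimir elements act on the product by scalars, and
  \<open>Casimir_Suc_quadratic\<close>, or \<open>Casimir_Suc_0\<close> for label 0, admits only
  neighbouring labels.\<close>

lemma P_P_Suc:
  assumes "i \<le> N" "j \<le> Suc N" "j \<noteq> Suc i" "i \<noteq> Suc j"
  shows "P p N i * P p (Suc N) j = 0"
proof -
  let ?x = "C p (Suc N)" and ?Q = "P p N i * P p (Suc N) j"
  have cQ: "C p N * ?Q = cas i *\<^sub>R ?Q" using C_P[OF assms(1)] by (simp add: mult.assoc[symmetric])
  have "?x * P p N i = P p N i * ?x" by (rule P_intertwine) (rule Casimir_commute[symmetric])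
  then have xQ: "?x * ?Q = cas j *\<^sub>R ?Q"
    using commute_left[of ?x "P p N i" "P p (Suc N) j"] C_P[OF assms(2), of p] by simp
  show ?thesis
  proof (cases i)
    case 0
    then have "(cas j - cas (Suc 0)) *\<^sub>R ?Q = 0"
      using Casimir_Suc_0[OF cQ[unfolded 0]] xQ by (auto simp: scaleR_left_diff_distrib)
    moreover have "cas j \<noteq> cas (Suc 0)" using assms(3) 0 by simp
    ultimately show ?thesis by simp
  next
    case (Suc i')
    have "((cas j - cas (Suc (Suc i'))) * (cas j - cas i')) *\<^sub>R ?Q = 0"
    proof -
      have d: "(?x - c *\<^sub>R 1) * ?Q = (cas j - c) *\<^sub>R ?Q" for c
        using xQ by (simp add: left_diff_distrib scaleR_left_diff_distrib)
      have "(?x - cas (Suc (Suc i')) *\<^sub>R 1) * ((?x - cas i' *\<^sub>R 1) * ?Q) = 0"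
        by (rule Casimir_Suc_quadratic) (use cQ Suc in simp)
      then show ?thesis unfolding d by (simp only: mult_scaleR_right d scaleR_scaleR mult.commute)
    qed
    moreover have "cas j \<noteq> cas (Suc (Suc i'))" "cas j \<noteq> cas i'" using assms Suc by auto
    ultimately show ?thesis by simp
  qed
qed

subsection \<open>Full twists\<close>

text \<open>The eigenvalue of the full twist $T$ of $N$ strands on the isotypic component $j$.\<close>

definition tau where "tau N j = a^(j*j+2*j) / a^(3*N)"

lemma tau_pos [simp]: "tau N j > 0" "tau N j \<noteq> 0" by (simp_all add: tau_def)

definition tpoly where "tpoly N = (\<Sum>j\<le>N. smult (tau N j) (lagrange N j))"

lemma poly_op_tpoly: "poly_op (tpoly N) (C p N) = (\<Sum>j\<le>N. tau N j *\<^sub>R P p N j)"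
  by (simp add: tpoly_def poly_op_sum poly_op_smult P_def)

text \<open>Between labels \<open>i\<close> and \<open>Suc i\<close> the exponent
  \<open>i*i + 2*i\<close> changes by \<open>2*i + 3\<close>. The monodromy eigenvalue accounts for
  this up to a factor \<open>a^3\<close>, which is absorbed by the denominator for one more
  strand.\<close>

lemma tau_step:
  "tau N i * (al * (cas (Suc i) - bb * cas i)) = tau (Suc N) (Suc i)"
  "tau N (Suc j) * (al * (cas j - bb * cas (Suc j))) = tau (Suc N) j"
proof -
  have "a^(i*i+2*i) * (bb * wt i) * a^3 = a^(Suc i * Suc i + 2 * Suc i)"
    by (simp add: bb_def wt_def power_add[symmetric] divide_simps) (simp add: eval_nat_numeral algebra_simps power_add[symmetric])
  then show "tau N i * (al * (cas (Suc i) - bb * cas i)) = tau (Suc N) (Suc i)"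
    unfolding cas_step tau_def by (simp add: power_add field_simps)
  have "a^(Suc j * Suc j + 2 * Suc j) * (bb * bb) * a^3 = a^(j*j+2*j) * wt j"
    by (simp add: bb_def wt_def power_add[symmetric] divide_simps) (simp add: eval_nat_numeral algebra_simps power_add[symmetric])
  then show "tau N (Suc j) * (al * (cas j - bb * cas (Suc j))) = tau (Suc N) j"
    unfolding cas_step tau_def by (simp add: power_add field_simps)
qed

lemma tau_P_P:
  assumes "i \<le> N" "j \<le> Suc N"
  shows "(tau N i * (al * (cas j - bb * cas i))) *\<^sub>R (P p N i * P p (Suc N) j) = tau (Suc N) j *\<^sub>R (P p N i * P p (Suc N) j)"
proof -
  consider "j = Suc i" | "i = Suc j" | "j \<noteq> Suc i" "i \<noteq> Suc j" by auto
  then show ?thesis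
  proof cases
    case 3 then show ?thesis using P_P_Suc[OF assms] by simp
  qed (simp_all add: tau_step)
qed

text \<open>Sliding the twist of \<open>N\<close> strands through \<open>Rr\<close> gives that twist
  times the monodromy. On the image of a projection of \<open>N + 1\<close> strands only
  neighbouring labels survive, and \<open>tau_step\<close> gives the same scalar for both.\<close>

lemma T_eq: "T a p N = poly_op (tpoly N) (C p N)"
proof (induction N arbitrary: p)
  case 0
  have "tpoly 0 = 1" by (simp add: tpoly_def tau_def lagrange_def)
  then show ?case by simp
next
  case (Suc N)
  let ?x = "C p (Suc N)"
  have t: "av True = a" by (simp add: av_def)
  have "T a p (Suc N) = (Rr a p N * poly_op (tpoly N) (C (Suc p) N)) * Rl a p N"
    by (simp add: Suc)
  also have "\<dots> = poly_op (tpoly N) (C p N) * (Rr a p N * Rl a p N)"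
    using poly_op_intertwine[OF Rr_C[of True p N, unfolded t]] by (simp add: mult.assoc)
  also have "\<dots> = (\<Sum>i\<le>N. tau N i *\<^sub>R (P p N i * (al *\<^sub>R (?x - bb *\<^sub>R C p N))))"
    unfolding poly_op_tpoly M_Casimir by (simp add: sum_distrib_right scaleR_sum_right mult.commute)
  finally have TS: "T a p (Suc N) = (\<Sum>i\<le>N. tau N i *\<^sub>R (P p N i * (al *\<^sub>R (?x - bb *\<^sub>R C p N))))" .
  have "T a p (Suc N) * P p (Suc N) j = tau (Suc N) j *\<^sub>R P p (Suc N) j" if j: "j \<le> Suc N" for j
  proof -
    have "P p N i * (al *\<^sub>R (?x - bb *\<^sub>R C p N)) * P p (Suc N) j = (al * (cas j - bb * cas i)) *\<^sub>R (P p N i * P p (Suc N) j)" if "i \<le> N" for i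
    proof -
      have "P p N i * (C p N * t) = cas i *\<^sub>R (P p N i * t)" for t
        by (simp only: mult.assoc[symmetric] P_C_commute[of p N i, symmetric] C_P[OF that] mult_scaleR_left)
      then show ?thesis
        using C_P[OF j, of p] by (simp add: mult.assoc left_diff_distrib right_diff_distrib scaleR_left_diff_distrib scaleR_right_diff_distrib)
    qed
    then have "T a p (Suc N) * P p (Suc N) j = (\<Sum>i\<le>N. (tau N i * (al * (cas j - bb * cas i))) *\<^sub>R (P p N i * P p (Suc N) j))"
      unfolding TS sum_distrib_right
      by (intro sum.cong refl) (simp only: mult_scaleR_left scaleR_scaleR atMost_iff)
    also have "\<dots> = (\<Sum>i\<le>N. tau (Suc N) j *\<^sub>R (P p N i * P p (Suc N) j))"
      by (intro sum.cong refl tau_P_P j) simp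
    also have "\<dots> = tau (Suc N) j *\<^sub>R ((\<Sum>i\<le>N. P p N i) * P p (Suc N) j)"
      by (simp add: sum_distrib_right scaleR_sum_right)
    finally show ?thesis unfolding P_sum by simp
  qed
  then have "T a p (Suc N) * (\<Sum>j\<le>Suc N. P p (Suc N) j) = (\<Sum>j\<le>Suc N. tau (Suc N) j *\<^sub>R P p (Suc N) j)"
    unfolding sum_distrib_left by (intro sum.cong) auto
  then show ?case unfolding P_sum poly_op_tpoly by simp
qed

lemma T_P: "j \<le> N \<Longrightarrow> T a p N * P p N j = tau N j *\<^sub>R P p N j"
proof -
  assume j: "j \<le> N"
  have "T a p N * P p N j = (\<Sum>i\<le>N. if i = j then tau N j *\<^sub>R P p N j else 0)"
    unfolding T_eq poly_op_tpoly sum_distrib_right using j by (intro sum.cong) (auto simp: P_P P_idem)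
  then show ?thesis using j by simp
qed

lemma T_inverse: "T (av False) p N * T a p N = 1"
proof (induction N arbitrary: p)
  case (Suc N)
  have t: "av True = a" by (simp add: av_def)
  note inv = Rr_Rl_inverse[of False, simplified t not_False_eq_True]
  have "T (av False) p (Suc N) * T a p (Suc N)
    = Rr (av False) p N * T (av False) (Suc p) N * (Rl (av False) p N * Rr a p N) * T a (Suc p) N * Rl a p N"
    by (simp add: mult.assoc)
  also have "\<dots> = Rr (av False) p N * (T (av False) (Suc p) N * T a (Suc p) N) * Rl a p N"
    using inv by (simp add: mult.assoc)
  finally show ?case using Suc inv by simp
qed simp

definition curl_factor where
  "curl_factor b N j = (- (av b ^ 3)) ^ N * (if b then tau N j else 1 / tau N j)"

lemma cable_curl_P:
  assumes "j \<le> N"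
  shows "CapN (p + N) N * X (av b) p N N * CupN (p + N) N * P p N j = curl_factor b N j *\<^sub>R P p N j"
proof -
  have "T (av b) p N * P p N j = (if b then tau N j else 1 / tau N j) *\<^sub>R P p N j"
  proof (cases b)
    case True then show ?thesis using T_P[OF assms, of p] by (simp add: av_def)
  next
    case False
    have "P p N j = T (av False) p N * (T a p N * P p N j)"
      using T_inverse[of p N] by (simp add: mult.assoc[symmetric])
    then have "P p N j = tau N j *\<^sub>R (T (av False) p N * P p N j)" using T_P[OF assms, of p] by simp
    then have "(1 / tau N j) *\<^sub>R P p N j = (1 / tau N j) *\<^sub>R (tau N j *\<^sub>R (T (av False) p N * P p N j))" by (simp only:)
    then show ?thesis using False by simp
  qed
  then show ?thesis unfolding cable_curl curl_factor_def by simp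
qed

text \<open>The denominator in \<open>tau\<close> cancels the \<open>N\<close> kinks of
  \<open>cable_curl\<close>, so the modulus depends on the label and the sign only.\<close>

lemma abs_curl_factor: "\<bar>curl_factor b N j\<bar> = (if b then a^(j*j+2*j) else 1 / a^(j*j+2*j))"
proof (cases b)
  case True
  have "\<bar>(- (a^3))^N\<bar> = a^(3*N)" by (simp add: power_abs power_mult abs_of_pos[OF a_pos])
  then show ?thesis using True by (simp add: curl_factor_def abs_mult av_def tau_def power_abs abs_of_pos[OF a_pos])
next
  case False
  have "\<bar>(- ((1/a)^3))^N\<bar> = 1 / a^(3*N)" by (simp add: power_abs power_mult power_divide abs_of_pos[OF a_pos])
  then show ?thesis using False by (simp add: curl_factor_def abs_mult av_def tau_def power_abs abs_of_pos[OF a_pos])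
qed

lemma T_alg: "T a p N \<in> alg {p..<p + N}"
  unfolding T_eq by (rule poly_op_alg[OF C_alg])

lemma T_intertwine: "y * C p N = C q N * y \<Longrightarrow> y * T a p N = T a q N * y"
  unfolding T_eq by (rule poly_op_intertwine)

lemma av_True: "av True = a" by (simp add: av_def)

lemma Rl_T: "Rl a p N * T a p N = T a (Suc p) N * Rl a p N"
  using T_intertwine[OF Rl_C[of True p N]] by (simp add: av_True)

text \<open>The twist is a polynomial in a Casimir element and hence commutes with the crossings
  inside its block. Conjugation by \<open>Rl\<close> therefore moves the monodromy from the last
  strand to the first.\<close>

lemma T_left: "T a p (Suc N) = T a (Suc p) N * (Rl a p N * Rr a p N)"
proof -
  have inv: "Rl a p N * Rr (av False) p N = 1"
    using Rr_Rl_inverse(2)[of True p N] by (simp add: av_True)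
  have "T a p (Suc N) * Rl a p N = Rl a p N * T a p (Suc N)"
    by (rule T_intertwine[symmetric]) (rule Rr_C_outer; simp)
  also have "\<dots> = (Rl a p N * Rr a p N) * T a (Suc p) N * Rl a p N"
    by (simp add: mult.assoc)
  finally have "T a p (Suc N) * Rl a p N * Rr (av False) p N = (Rl a p N * Rr a p N) * T a (Suc p) N * Rl a p N * Rr (av False) p N"
    by simp
  then have 1: "T a p (Suc N) = (Rl a p N * Rr a p N) * T a (Suc p) N"
    unfolding mult.assoc inv by simp
  have "Rl a p N * Rr a p N * T a (Suc p) N = Rl a p N * (T a p N * Rr a p N)"
    using T_intertwine[OF Rr_C[of True p N]] by (simp add: av_True mult.assoc)
  also have "\<dots> = T a (Suc p) N * (Rl a p N * Rr a p N)"
    using Rl_T[of p N] by (simp add: mult.assoc[symmetric])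
  finally show ?thesis using 1 by simp
qed

lemma Rr_split: "Rr x p (M + N) = Rr x (p + M) N * Rr x p M" and Rl_split: "Rl x p (M + N) = Rl x p M * Rl x (p + M) N"
  by (induction N) (simp_all add: mult.assoc add.assoc)

text \<open>Strands of the first bundle are peeled off by \<open>T_left\<close>; the monodromy of a
  peeled strand passes the bundle crossing because both Casimir elements in
  \<open>M'_Casimir\<close> do. For \<open>M = N\<close> this determines the square of a cabled
  crossing.\<close>

lemma full_twist:
  "X a p N M * X a p M N * T a p M * T a (p + M) N = T a p (M + N)"
proof (induction M arbitrary: p)
  case (Suc M)
  let ?q = "Suc p" and ?m = "\<lambda>p. Rl a p N * Rr a p N" and ?t = "T a (Suc (p + M)) N"
  have c1: "?t * Rl a p M = Rl a p M * ?t" "?t * Rr a p M = Rr a p M * ?t"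
    by (intro alg_commute[OF Rl_alg T_alg] alg_commute[OF Rr_alg T_alg]; auto)+
  have m_alg: "?m (p + M) \<in> alg {p + M..<p + M + Suc N}"
    by (intro alg.mult Rr_alg Rl_alg)
  have c2: "T a p M * ?m (p + M) = ?m (p + M) * T a p M"
    by (rule alg_commute[OF m_alg T_alg]) auto
  have c3: "?t * ?m (p + M) = ?m (p + M) * ?t"
    using Rl_T[of "p + M" N] T_intertwine[OF Rr_C[of True "p + M" N]]
    by (simp add: av_True mult.assoc) (simp add: mult.assoc[symmetric])
  let ?Y = "X a p M (Suc N)"
  have c4: "?m p * ?Y = ?Y * ?m (p + M)"
  proof -
    have 1: "C p (Suc N) * ?Y = ?Y * C (p + M) (Suc N)"
      using X_C_right[of True p M "Suc N"] by (simp add: av_True)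
    have "C ?q N * ?Y = X a ?q M N * (C (?q + M) N * Rl a p M)"
      using X_C_right[of True ?q M N] unfolding X_grid_bottom by (simp add: av_True mult.assoc[symmetric])
    also have "C (?q + M) N * Rl a p M = Rl a p M * C (?q + M) N"
      by (rule alg_commute[OF Rl_alg C_alg]) auto
    finally have 2: "C ?q N * ?Y = ?Y * C (Suc (p + M)) N"
      unfolding X_grid_bottom by (simp add: mult.assoc)
    show ?thesis
      unfolding M'_Casimir by (simp add: 1 2 left_diff_distrib right_diff_distrib)
  qed
  have "X a p N (Suc M) * X a p (Suc M) N * T a p (Suc M) * T a (p + Suc M) N
    = X a ?q N M * (?m p * X a ?q M N) * (T a ?q M * Rl a p M) * (Rr a p M * ?t)"
    unfolding T_left X_grid_bottom[of a p N] by (simp add: mult.assoc)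
  also have "\<dots> = X a ?q N M * (?m p * ?Y) * T a p M * (?t * Rr a p M)"
    unfolding Rl_T[symmetric] c1 X_grid_bottom by (simp add: mult.assoc)
  also have "\<dots> = X a ?q N M * ?Y * (?m (p + M) * T a p M) * (?t * Rr a p M)"
    unfolding c4 by (simp add: mult.assoc)
  also have "\<dots> = X a ?q N M * ?Y * T a p M * (?m (p + M) * ?t) * Rr a p M"
    unfolding c2[symmetric] by (simp add: mult.assoc)
  also have "\<dots> = X a ?q N M * X a ?q M N * (Rl a p M * T a p M) * ?t * ?m (p + M) * Rr a p M"
    unfolding c3[symmetric] X_grid_bottom by (simp add: mult.assoc)
  also have "\<dots> = X a ?q N M * X a ?q M N * T a ?q M * (?t * Rl a p M) * ?m (p + M) * Rr a p M"
    unfolding Rl_T c1 by (simp add: mult.assoc)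
  also have "\<dots> = (X a ?q N M * X a ?q M N * T a ?q M * T a (?q + M) N) * (Rl a p (M + N) * Rr a p (M + N))"
    unfolding Rr_split Rl_split by (simp add: mult.assoc)
  also have "\<dots> = T a p (Suc M + N)"
    unfolding add_Suc T_left using Suc.IH[of ?q] by simp
  finally show ?case .
qed simp

subsection \<open>Norm bounds\<close>

abbreviation nsq where "nsq n t f \<equiv> ip n t f f"

text \<open>Pairing the eigenvalue equation with \<open>u\<close> turns each form of the Casimir
  element into squared norms, by adjointness of the generators.\<close>

lemma Casimir_energy:
  assumes "q + N \<le> n" "app (C q N) u = (\<lambda>s. c * u s)"
  shows "c * nsq n t u = nsq n t (app (E q N) u) + (1/(dd*dd)) * (a^2 * nsq n t (app (K q N) u) + bb * nsq n t (app (L q N) u))"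
    and "c * nsq n t u = nsq n t (app (F q N) u) + (1/(dd*dd)) * (bb * nsq n t (app (K q N) u) + a^2 * nsq n t (app (L q N) u))"
proof -
  note ad = adj_block[OF assms(1)]
  have "c * nsq n t u = ip n t u (app (C q N) u)" unfolding assms(2) ip_scale ..
  also have "\<dots> = nsq n t (app (E q N) u) + (1/(dd*dd)) * (a^2 * nsq n t (app (K q N) u) + bb * nsq n t (app (L q N) u))"
    using adjD[OF ad(1), of t u "app (K q N) u"] adjD[OF ad(2), of t u "app (L q N) u"] adjD[OF ad(3), of t u "app (E q N) u"]
    unfolding C_bb app_fun ip_add ip_scale app_simps(7) by simp
  finally show "c * nsq n t u = nsq n t (app (E q N) u) + (1/(dd*dd)) * (a^2 * nsq n t (app (K q N) u) + bb * nsq n t (app (L q N) u))" .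
  have "c * nsq n t u = ip n t u (app (C q N) u)" unfolding assms(2) ip_scale ..
  also have "\<dots> = nsq n t (app (F q N) u) + (1/(dd*dd)) * (bb * nsq n t (app (K q N) u) + a^2 * nsq n t (app (L q N) u))"
    using adjD[OF ad(1), of t u "app (K q N) u"] adjD[OF ad(2), of t u "app (L q N) u"] adjD[OF adj_sym[OF ad(3)], of t u "app (F q N) u"]
    unfolding C_alt app_fun ip_add ip_scale app_simps(7) by simp
  finally show "c * nsq n t u = nsq n t (app (F q N) u) + (1/(dd*dd)) * (bb * nsq n t (app (K q N) u) + a^2 * nsq n t (app (L q N) u))" .
qed

lemma block_bounds:
  assumes "q + N \<le> n" "app (C q N) u = (\<lambda>s. c * u s)"
  shows "nsq n t (app (E q N) u) \<le> c * nsq n t u"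
    "nsq n t (app (K q N) u) \<le> (dd * dd * bb * c) * nsq n t u"
    "nsq n t (app (L q N) u) \<le> (dd * dd * bb * c) * nsq n t u"
proof -
  note e = Casimir_energy[OF assms, of t]
  have p: "bb > 0" "dd * dd > 0" "1/(dd*dd) > 0" using bb_simps(6) dd_pos by auto
  have nn: "nsq n t (app (K q N) u) \<ge> 0" "nsq n t (app (L q N) u) \<ge> 0" "nsq n t (app (E q N) u) \<ge> 0" "nsq n t (app (F q N) u) \<ge> 0" by auto
  show "nsq n t (app (E q N) u) \<le> c * nsq n t u"
    unfolding e(1) using nn p by (simp add: add_nonneg_nonneg)
  have dv: "x \<le> (dd * dd * bb * c) * nsq n t u" if "(1/(dd*dd)) * (a^2 * x) \<le> c * nsq n t u" for x
  proof -
    have "(dd * dd * bb) * ((1/(dd*dd)) * (a^2 * x)) \<le> (dd * dd * bb) * (c * nsq n t u)"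
      using that p by (intro mult_left_mono) (auto simp: less_imp_le)
    moreover have "(dd * dd * bb) * ((1/(dd*dd)) * (a^2 * x)) = x"
      using dd_pos bb_simps(2) by (simp add: bb_simps_left)
    ultimately show ?thesis by (simp add: mult.assoc)
  qed
  show "nsq n t (app (K q N) u) \<le> (dd * dd * bb * c) * nsq n t u"
  proof (rule dv)
    show "(1/(dd*dd)) * (a^2 * nsq n t (app (K q N) u)) \<le> c * nsq n t u"
      unfolding e(1) using nn p by (simp add: distrib_left divide_nonneg_pos)
  qed
  show "nsq n t (app (L q N) u) \<le> (dd * dd * bb * c) * nsq n t u"
  proof (rule dv)
    show "(1/(dd*dd)) * (a^2 * nsq n t (app (L q N) u)) \<le> c * nsq n t u"
      unfolding e(2) using nn p by (simp add: distrib_left divide_nonneg_pos)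
  qed
qed

lemma nsq_add: "nsq n t (\<lambda>s. f s + g s) \<le> 2 * nsq n t f + 2 * nsq n t g"
proof -
  have "nsq n t (\<lambda>s. f s + g s) + nsq n t (\<lambda>s. f s - g s) = 2 * nsq n t f + 2 * nsq n t g"
    by (simp add: ip_add ip_diff)
  then show ?thesis using ip_self_nonneg[of n t "\<lambda>s. f s - g s"] by linarith
qed

lemma cas_nonneg: "cas r \<ge> 0"
  unfolding cas_def using dd_pos by (intro divide_nonneg_nonneg add_nonneg_nonneg) (auto simp: less_imp_le)

text \<open>The coproduct expresses the generators of \<open>2 * N\<close> strands by those of the
  halves, which \<open>block_bounds\<close> controls. The 6 consists of 4 from the two summands of
  \<open>E\<close> and 2 from \<open>K\<close> and \<open>L\<close>.\<close>

lemma Casimir_sum_bound: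
  assumes n: "p + 2 * N \<le> n"
    and u: "app (C p N) u = (\<lambda>s. cas r * u s)" "app (C (p + N) N) u = (\<lambda>s. cas r * u s)"
      "app (C p (2 * N)) u = (\<lambda>s. cas j * u s)"
  shows "cas j * nsq n t u \<le> 6 * (dd * dd * bb * cas r * cas r) * nsq n t u"
proof -
  let ?q = "p + N" and ?S = "nsq n t u" and ?c = "cas r"
  define h where "h = dd * dd * bb * ?c"
  have h: "h \<ge> 0" using dd_pos bb_simps(6) cas_nonneg by (simp add: h_def)
  have n1: "p + N \<le> n" and n2: "?q + N \<le> n" and n3: "p + 2 * N \<le> n" using n by auto
  have S: "?S \<ge> 0" by simp
  have cc1: "app (C p N) (app y u) = (\<lambda>s. ?c * app y u s)" if "C p N * y = y * C p N" for y
    using arg_cong[OF that, of "\<lambda>x. app x u"] u(1) by (simp add: fun_eq_iff app_cmult)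
  have d: "C p N * y = y * C p N" if "y \<in> alg {?q..<?q + N}" for y
    using C_alg that by (rule block_disjoint)
  note b1 = block_bounds[OF n1, where t = t] and b2 = block_bounds[OF n2 u(2), of t]
  note cK = cc1[OF d[OF K_alg]] and cL = cc1[OF d[OF L_alg]] and cE = cc1[OF d[OF E_alg]]
  have "nsq n t (app (E p N) (app (K ?q N) u)) \<le> ?c * nsq n t (app (K ?q N) u)" by (rule b1(1)[OF cK])
  also have "\<dots> \<le> ?c * (h * ?S)" using b2(2) cas_nonneg by (intro mult_left_mono) (simp_all add: h_def)
  finally have e1: "nsq n t (app (E p N) (app (K ?q N) u)) \<le> ?c * (h * ?S)" .
  have "nsq n t (app (L p N) (app (E ?q N) u)) \<le> h * nsq n t (app (E ?q N) u)" using b1(3)[OF cE] by (simp add: h_def)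
  also have "\<dots> \<le> h * (?c * ?S)" using b2(1) h by (intro mult_left_mono)
  finally have e2: "nsq n t (app (L p N) (app (E ?q N) u)) \<le> h * (?c * ?S)" .
  have "app (E p (2 * N)) u = (\<lambda>s. app (E p N) (app (K ?q N) u) s + app (L p N) (app (E ?q N) u) s)"
    unfolding mult_2 E_split by (simp add: fun_eq_iff)
  then have eE: "nsq n t (app (E p (2 * N)) u) \<le> 4 * (h * ?c * ?S)"
    using nsq_add[of n t "app (E p N) (app (K ?q N) u)" "app (L p N) (app (E ?q N) u)"] e1 e2 by (simp add: ac_simps)
  have "nsq n t (app (K p (2 * N)) u) \<le> h * nsq n t (app (K ?q N) u)"
    unfolding mult_2 K_split using b1(2)[OF cK] by (simp add: h_def)
  also have "\<dots> \<le> h * (h * ?S)" using b2(2) h by (intro mult_left_mono) (simp_all add: h_def)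
  finally have eK: "nsq n t (app (K p (2 * N)) u) \<le> h * (h * ?S)" .
  have "nsq n t (app (L p (2 * N)) u) \<le> h * nsq n t (app (L ?q N) u)"
    unfolding mult_2 L_split using b1(3)[OF cL] by (simp add: h_def)
  also have "\<dots> \<le> h * (h * ?S)" using b2(3) h by (intro mult_left_mono) (simp_all add: h_def)
  finally have eL: "nsq n t (app (L p (2 * N)) u) \<le> h * (h * ?S)" .
  have bba: "bb \<le> a^2" using bb_simps(3) dd_pos by simp
  have le2: "a^2 * nsq n t (app (K p (2 * N)) u) + bb * nsq n t (app (L p (2 * N)) u) \<le> a^2 * (h * (h * ?S)) + a^2 * (h * (h * ?S))"
    using eK eL bba bb_simps(6) h S by (intro add_mono mult_mono) auto
  have "(1/(dd*dd)) * (a^2 * nsq n t (app (K p (2 * N)) u) + bb * nsq n t (app (L p (2 * N)) u)) \<le> (1/(dd*dd)) * (2 * (a^2 * (h * (h * ?S))))"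
  proof (rule mult_left_mono)
    show "a^2 * nsq n t (app (K p (2 * N)) u) + bb * nsq n t (app (L p (2 * N)) u) \<le> 2 * (a^2 * (h * (h * ?S)))"
      using le2 by linarith
    show "0 \<le> 1 / (dd * dd)" using dd_pos by simp
  qed
  also have "\<dots> = 2 * (h * ?c * ?S)"
  proof -
    have "a^2 * h = dd * dd * ?c" unfolding h_def using bb_simps(1) by (simp add: bb_simps_left ac_simps)
    then have "a^2 * (h * (h * ?S)) = dd * dd * (h * ?c * ?S)" by (simp add: mult.assoc[symmetric])
    then have "(1/(dd*dd)) * (2 * (a^2 * (h * (h * ?S)))) = (1/(dd*dd)) * (2 * (dd * dd * (h * ?c * ?S)))"
      by (simp only:)
    then show ?thesis using dd_pos by (simp only:) simp
  qed
  finally have "cas j * ?S \<le> 6 * (h * ?c * ?S)"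
    using Casimir_energy(1)[OF n3 u(3), of t] eE by linarith
  then show ?thesis by (simp add: h_def ac_simps)
qed

text \<open>The Clebsch--Gordan restriction, obtained from sizes: \<open>Casimir_sum_bound\<close>
  forces \<open>wt j\<close> to be at most 24 a^(4r+2), while \<open>j > 2 * r\<close> makes it at
  least a^(4r+4).\<close>

lemma P_triangle:
  assumes n: "p + 2 * N \<le> n" and j: "2 * r < j"
    and u: "app (C p N) u = (\<lambda>s. cas r * u s)" "app (C (p + N) N) u = (\<lambda>s. cas r * u s)"
      "app (C p (2 * N)) u = (\<lambda>s. cas j * u s)"
  shows "nsq n t u = 0"
proof (rule ccontr)
  assume "nsq n t u \<noteq> 0"
  then have "nsq n t u > 0" using ip_self_nonneg[of n t u] by linarith
  then have c: "cas j \<le> 6 * (dd * dd * bb * cas r * cas r)"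
    using Casimir_sum_bound[OF n u, of t] by simp
  have d: "dd * dd > 0" using dd_pos by simp
  have "cas r \<le> 2 * wt r / (dd*dd)"
    unfolding cas_def using wt_gt1[of r] d by (intro divide_right_mono) (auto simp: field_simps, smt (verit) mult_less_cancel_left2 wt_pos)
  then have r: "dd * dd * cas r \<le> 2 * wt r" using d by (simp add: field_simps)
  have "dd * dd * cas j = wt j + 1 / wt j" using dd_pos by (simp add: cas_def)
  then have "wt j \<le> dd * dd * cas j" by (simp add: less_imp_le)
  also have "\<dots> \<le> 6 * bb * ((dd * dd * cas r) * (dd * dd * cas r))"
    using mult_left_mono[OF c, of "dd * dd"] d by (simp add: ac_simps)
  also have "\<dots> \<le> 6 * bb * ((2 * wt r) * (2 * wt r))"
    using r d cas_nonneg[of r] bb_simps(6) by (intro mult_left_mono mult_mono[OF r r]) (auto simp: less_imp_le)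
  finally have "wt j \<le> 24 * (bb * (wt r * wt r))" by simp
  then have "a^2 * wt j \<le> a^2 * (24 * (bb * (wt r * wt r)))" by (intro mult_left_mono) auto
  moreover have "a^2 * (24 * (bb * (wt r * wt r))) = (a^2 * bb) * (24 * (wt r * wt r))" by (simp only: ac_simps)
  ultimately have "a^2 * wt j \<le> 24 * (wt r * wt r)" unfolding bb_simps(1) by simp
  also have "24 * (wt r * wt r) < a^2 * (wt r * wt r)"
  proof -
    have "a^2 \<ge> 25" using mult_mono[of 5 a 5 a] a_ge by (simp add: power2_eq_square)
    then show ?thesis by (intro mult_strict_right_mono) auto
  qed
  also have "\<dots> = a^2 * wt (2 * r + 1)" by (simp add: wt_def power_add[symmetric])
  also have "\<dots> \<le> a^2 * wt j" using j a_gt1(1) unfolding wt_def by (intro mult_left_mono power_increasing) auto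
  finally show False by simp
qed

lemma app_cmult_fun: "app x (\<lambda>s. c * f s) = (\<lambda>s. c * app x f s)"
  by (rule ext) (rule app_cmult)

lemma block_Casimir_commute:
  "C p N * C p (2 * N) = C p (2 * N) * C p N" "C (p + N) N * C p (2 * N) = C p (2 * N) * C (p + N) N"
proof -
  have s: "x * C p (2 * N) = C p (2 * N) * x"
    if "x * K p N = K p N * x" "x * L p N = L p N * x" "x * E p N = E p N * x" "x * F p N = F p N * x"
      "x * K (p+N) N = K (p+N) N * x" "x * L (p+N) N = L (p+N) N * x" "x * E (p+N) N = E (p+N) N * x" "x * F (p+N) N = F (p+N) N * x"
    for x
  proof -
    have m: "x * (y * z) = y * z * x" if "x * y = y * x" "x * z = z * x" for y z using that by (rule commute_mult)
    have ad: "x * (y + z) = (y + z) * x" if "x * y = y * x" "x * z = z * x" for y z using that by (simp add: distrib_left distrib_right)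
    have sc: "x * (c *\<^sub>R y) = (c *\<^sub>R y) * x" if "x * y = y * x" for y c using that by simp
    show ?thesis unfolding C_bb mult_2 K_split L_split E_split F_split by (intro m ad sc that)
  qed
  note o = block_disjoint[of _ p N _ N]
  show "C p N * C p (2 * N) = C p (2 * N) * C p N"
    by (rule s) (rule C_K C_L C_E C_F o[OF C_alg K_alg] o[OF C_alg L_alg] o[OF C_alg E_alg] o[OF C_alg F_alg])+
  show "C (p + N) N * C p (2 * N) = C p (2 * N) * C (p + N) N"
    by (rule s) (rule C_K C_L C_E C_F o[OF K_alg C_alg, symmetric] o[OF L_alg C_alg, symmetric] o[OF E_alg C_alg, symmetric] o[OF F_alg C_alg, symmetric])+
qed

text \<open>Since \<open>X\<close> is self-adjoint, the squared norm of its value at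
  \<open>v\<close> is a pairing of \<open>v\<close> with the square of \<open>X\<close>. By
  \<open>full_twist\<close> that square is, on \<open>v\<close>, the twist of \<open>2 * N\<close>
  strands divided by \<open>tr\<close>; its extreme eigenvalues on labels up to \<open>2 * r\<close>
  give both bounds.\<close>

lemma crossing_form:
  assumes n: "p + 2 * N \<le> n" and r: "r \<le> N"
    and v: "app (P p N r) v = v" "app (P (p + N) N r) v = v"
  shows "nsq n t (app (X a p N N) v) \<le> a^(2*r*r+4*r) * nsq n t v"
    and "nsq n t v \<le> a^(2*r*r+4*r) * nsq n t (app (X a p N N) v)"
proof -
  let ?T = "T a p N" and ?T' = "T a (p + N) N" and ?P = "P p (2*N)"
  define tr where "tr = tau N r * tau N r"
  have tr: "tr > 0" by (simp add: tr_def)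
  have Tv: "app ?T v = (\<lambda>s. tau N r * v s)" "app ?T' v = (\<lambda>s. tau N r * v s)"
    using arg_cong[OF T_P[OF r, of p], of "\<lambda>x. app x v"] arg_cong[OF T_P[OF r, of "p+N"], of "\<lambda>x. app x v"]
    unfolding app_simps(7) app_fun(3) v by simp_all
  have Cv: "app (C p N) v = (\<lambda>s. cas r * v s)" "app (C (p+N) N) v = (\<lambda>s. cas r * v s)"
    using arg_cong[OF C_P[OF r, of p], of "\<lambda>x. app x v"] arg_cong[OF C_P[OF r, of "p+N"], of "\<lambda>x. app x v"]
    unfolding app_simps(7) app_fun(3) v by simp_all
  define w where "w j = nsq n t (app (?P j) v)" for j
  have ipw: "ip n t v (app (?P j) v) = w j" if "j \<le> 2*N" for j
    using adjD[OF adj_P[of p "2*N" n j], of t v "app (?P j) v"] arg_cong[OF P_idem[OF that, of p], of "\<lambda>x. app x v"] n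
    by (simp add: w_def)
  have w0: "w j = 0" if j: "j \<le> 2*N" "2 * r < j" for j
    unfolding w_def
  proof (rule P_triangle[OF n j(2)])
    note c1 = block_Casimir_commute[of p N]
    have i: "C p N * ?P j = ?P j * C p N" "C (p+N) N * ?P j = ?P j * C (p+N) N"
      by (rule P_intertwine; fact c1)+
    show "app (C p N) (app (?P j) v) = (\<lambda>s. cas r * app (?P j) v s)" "app (C (p+N) N) (app (?P j) v) = (\<lambda>s. cas r * app (?P j) v s)"
      using arg_cong[OF i(1), of "\<lambda>x. app x v"] arg_cong[OF i(2), of "\<lambda>x. app x v"] Cv by (simp_all add: fun_eq_iff app_cmult)
    show "app (C p (2*N)) (app (?P j) v) = (\<lambda>s. cas j * app (?P j) v s)"
      using arg_cong[OF C_P[OF j(1), of p], of "\<lambda>x. app x v"] by (simp add: fun_eq_iff)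
  qed
  have sumw: "(\<Sum>j\<le>2*N. w j) = nsq n t v"
  proof -
    have "nsq n t v = ip n t v (app (\<Sum>j\<le>2*N. ?P j) v)" by (simp add: P_sum)
    also have "\<dots> = (\<Sum>j\<le>2*N. ip n t v (app (?P j) v))"
      by (simp add: ip_def app_sum sum_distrib_left sum.swap[of _ _ "confs n t"])
    finally show ?thesis by (simp add: ipw)
  qed
  have "X a p N N * X a p N N * ?T * ?T' = T a p (2*N)"
    using full_twist[of p N N] by (simp add: mult_2)
  then have "app (X a p N N) (app (X a p N N) (app ?T (app ?T' v))) = app (T a p (2*N)) v"
    by (simp only: app_simps(7)[symmetric] mult.assoc)
  moreover have "app ?T (app ?T' v) = (\<lambda>s. tr * v s)"
    unfolding Tv app_cmult_fun by (simp add: tr_def mult.assoc)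
  ultimately have "app (T a p (2*N)) v = app (X a p N N) (app (X a p N N) (\<lambda>s. tr * v s))"
    by simp
  then have XX: "(\<lambda>s. tr * app (X a p N N) (app (X a p N N) v) s) = app (T a p (2*N)) v"
    by (simp add: app_cmult_fun)
  have "tr * nsq n t (app (X a p N N) v) = ip n t v (\<lambda>s. tr * app (X a p N N) (app (X a p N N) v) s)"
    using adjD[OF adj_X[of p N N n a], of t v "app (X a p N N) v"] n by (simp add: ip_scale)
  also have "\<dots> = ip n t v (app (\<Sum>j\<le>2*N. tau (2*N) j *\<^sub>R ?P j) v)"
    unfolding XX T_eq poly_op_tpoly ..
  also have "\<dots> = (\<Sum>j\<le>2*N. tau (2*N) j * ip n t v (app (?P j) v))"
    by (simp add: ip_def app_sum sum_distrib_left sum.swap[of _ _ "confs n t"] mult.left_commute)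
  also have "\<dots> = (\<Sum>j\<le>2*N. tau (2*N) j * w j)" by (simp add: ipw)
  finally have key: "tr * nsq n t (app (X a p N N) v) = (\<Sum>j\<le>2*N. tau (2*N) j * w j)" .
  have wnn: "w j \<ge> 0" for j by (simp add: w_def)
  have trv: "tr = a^(2*r*r+4*r) / a^(6*N)"
    by (simp add: tr_def tau_def power_add[symmetric] mult_2[symmetric] mult.assoc)
  \<comment> \<open>The largest eigenvalue occurs at \<open>j = 2 * r\<close>. After division by
    \<open>tr\<close> the factor \<open>a^(2*r*r)\<close> is left; it is weakened below so that both
    signs of the crossing share one bound.\<close>
  have "(\<Sum>j\<le>2*N. tau (2*N) j * w j) \<le> (\<Sum>j\<le>2*N. (a^(4*r*r+4*r) / a^(6*N)) * w j)"
  proof (rule sum_mono)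
    fix j assume j: "j \<in> {..2*N}"
    show "tau (2*N) j * w j \<le> (a^(4*r*r+4*r) / a^(6*N)) * w j"
    proof (cases "2 * r < j")
      case False
      then have "j \<le> 2 * r" by simp
      then have "j * j + 2 * j \<le> 4 * r * r + 4 * r"
        using mult_le_mono[of j "2*r" j "2*r"] by simp
      then have "a^(j*j+2*j) \<le> a^(4*r*r+4*r)" using a_gt1(1) by (intro power_increasing) auto
      then have "a^(j*j+2*j) / a^(6*N) \<le> a^(4*r*r+4*r) / a^(6*N)" by (intro divide_right_mono) auto
      then have "tau (2*N) j \<le> a^(4*r*r+4*r) / a^(6*N)" by (simp add: tau_def)
      then show ?thesis using wnn[of j] by (rule mult_right_mono)
    qed (use w0[of j] j in auto)
  qed
  also have "\<dots> = tr * (a^(2*r*r) * nsq n t v)"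
    unfolding sum_distrib_left[symmetric] sumw trv by (simp add: power_add[symmetric] mult.assoc)
  finally have "nsq n t (app (X a p N N) v) \<le> a^(2*r*r) * nsq n t v" unfolding key[symmetric] using tr by simp
  also have "\<dots> \<le> a^(2*r*r+4*r) * nsq n t v" using a_gt1(1) by (intro mult_right_mono power_increasing) auto
  finally show "nsq n t (app (X a p N N) v) \<le> a^(2*r*r+4*r) * nsq n t v" .
  \<comment> \<open>The smallest possible twist eigenvalue, at \<open>j = 0\<close>, gives the bound
    for the inverse crossing.\<close>
  have "(1 / a^(6*N)) * nsq n t v = (\<Sum>j\<le>2*N. (1 / a^(6*N)) * w j)"
    unfolding sum_distrib_left[symmetric] sumw ..
  also have "\<dots> \<le> (\<Sum>j\<le>2*N. tau (2*N) j * w j)"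
  proof (intro sum_mono mult_right_mono wnn)
    fix j
    have "1 \<le> a^(j*j+2*j)" using a_gt1(1) by (intro one_le_power) simp
    then have "1 / a^(6*N) \<le> a^(j*j+2*j) / a^(6*N)" by (intro divide_right_mono) auto
    then show "1 / a^(6*N) \<le> tau (2*N) j" by (simp add: tau_def)
  qed
  also have "\<dots> = (1 / a^(6*N)) * (a^(2*r*r+4*r) * nsq n t (app (X a p N N) v))"
    unfolding key[symmetric] trv by simp
  finally show "nsq n t v \<le> a^(2*r*r+4*r) * nsq n t (app (X a p N N) v)"
    by (rule mult_left_le_imp_le) simp
qed

text \<open>A negative crossing is the inverse of a positive one and preserves the condition on
  labels, so the lower bound is applied to its image.\<close>

lemma crossing_bound:
  assumes n: "p + 2 * N \<le> n" and r: "r \<le> N"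
    and v: "app (P p N r) v = v" "app (P (p + N) N r) v = v"
  shows "nsq n t (app (X (av b) p N N) v) \<le> a^(2*r*r+4*r) * nsq n t v"
proof (cases b)
  case True
  then show ?thesis using crossing_form(1)[OF assms] by (simp add: av_True)
next
  case False
  let ?X = "X (av False) p N N"
  define u where "u = app ?X v"
  have "app (P p N r) u = app ?X (app (P (p + N) N r) v)" "app (P (p + N) N r) u = app ?X (app (P p N r) v)"
    using arg_cong[OF P_intertwine[OF X_C_right[of False p N N], of r], of "\<lambda>x. app x v"]
      arg_cong[OF P_intertwine[OF X_C_left[of False p N N], of r], of "\<lambda>x. app x v"]
    by (simp_all add: u_def)
  then have u: "app (P p N r) u = u" "app (P (p + N) N r) u = u" using v by (simp_all add: u_def)
  have "app (X a p N N) u = v"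
    using arg_cong[OF X_inverse[of True p N N], of "\<lambda>x. app x v"] by (simp add: u_def av_True)
  then show ?thesis
    using crossing_form(2)[OF n r u, of t] False by (simp add: u_def)
qed

end

subsection \<open>Closed diagrams without crossings\<close>

primrec diagram_op :: "(piece \<Rightarrow> endo) \<Rightarrow> diagram \<Rightarrow> endo" where
  "diagram_op h [] = 1"
| "diagram_op h (p # D) = diagram_op h D * h p"

lemma diagram_op_append: "diagram_op h (D @ E) = diagram_op h E * diagram_op h D"
  by (induction D) (simp_all add: mult.assoc)

text \<open>Loop removal, zigzags and exchange of distant turns, for arbitrary \<open>h\<close> and
  \<open>d\<close>: one reduction of planar diagrams will serve two representations.\<close>

definition tl_rep :: "(piece \<Rightarrow> endo) \<Rightarrow> real \<Rightarrow> bool" where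
  "tl_rep h d \<longleftrightarrow> (\<forall>i. h (Cap i) * h (Cup i) = d *\<^sub>R 1 \<and> h (Cap (Suc i)) * h (Cup i) = 1 \<and> h (Cap i) * h (Cup (Suc i)) = 1)
     \<and> (\<forall>i j. i \<le> j \<longrightarrow> h (Cap (Suc (Suc j))) * h (Cup i) = h (Cup i) * h (Cap j)
          \<and> h (Cap i) * h (Cup (Suc (Suc j))) = h (Cup j) * h (Cap i))"

primrec cup_word :: "(piece \<Rightarrow> endo) \<Rightarrow> nat list \<Rightarrow> endo" where
  "cup_word h [] = 1"
| "cup_word h (j # W) = h (Cup j) * cup_word h W"

primrec valid_word :: "nat list \<Rightarrow> bool" where
  "valid_word [] \<longleftrightarrow> True"
| "valid_word (j # W) \<longleftrightarrow> j \<le> 2 * length W \<and> valid_word W"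

text \<open>The cap closes a loop with the latest cup, straightens a zigzag with it, or passes it.
  The exponent and the new word are chosen before \<open>h\<close> and \<open>d\<close>, hence are
  the same for all representations.\<close>

lemma cap_cup_word:
  assumes "valid_word W" "i + 2 \<le> 2 * length W"
  shows "\<exists>n W'. valid_word W' \<and> Suc (length W') = length W \<and>
    (\<forall>h d. tl_rep h d \<longrightarrow> h (Cap i) * cup_word h W = d ^ n *\<^sub>R cup_word h W')"
  using assms
proof (induction W arbitrary: i)
  case (Cons j W)
  consider "i = j" | "i = Suc j" | "j = Suc i" | m where "i = Suc (Suc m)" "j \<le> m" | m where "j = Suc (Suc m)" "i \<le> m"
  proof -
    have "i = j \<or> i = Suc j \<or> j = Suc i \<or> (\<exists>m\<ge>j. i = Suc (Suc m)) \<or> (\<exists>m\<ge>i. j = Suc (Suc m))" by presburger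
    then show thesis using that by blast
  qed
  then show ?case
  proof cases
    case 1
    then show ?thesis using Cons.prems
      by (intro exI[of _ 1] exI[of _ W]) (auto simp: tl_rep_def mult.assoc[symmetric])
  next
    case 2
    then show ?thesis using Cons.prems
      by (intro exI[of _ 0] exI[of _ W]) (auto simp: tl_rep_def mult.assoc[symmetric])
  next
    case 3
    then show ?thesis using Cons.prems
      by (intro exI[of _ 0] exI[of _ W]) (auto simp: tl_rep_def mult.assoc[symmetric])
  next
    case (4 m)
    obtain n W' where W': "valid_word W'" "Suc (length W') = length W"
      "\<And>h d. tl_rep h d \<Longrightarrow> h (Cap m) * cup_word h W = d ^ n *\<^sub>R cup_word h W'"
      using Cons.IH[of m] Cons.prems 4 by auto
    have "h (Cap i) * cup_word h (j # W) = d ^ n *\<^sub>R cup_word h (j # W')" if "tl_rep h d" for h d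
    proof -
      have "h (Cap i) * cup_word h (j # W) = h (Cup j) * (h (Cap m) * cup_word h W)"
        using that 4 by (simp add: tl_rep_def mult.assoc[symmetric])
      then show ?thesis using W'(3)[OF that] by simp
    qed
    moreover have "valid_word (j # W')" using W' 4 Cons.prems by auto
    ultimately show ?thesis using W'(2) by (intro exI[of _ n] exI[of _ "j # W'"]) auto
  next
    case (5 m)
    obtain n W' where W': "valid_word W'" "Suc (length W') = length W"
      "\<And>h d. tl_rep h d \<Longrightarrow> h (Cap i) * cup_word h W = d ^ n *\<^sub>R cup_word h W'"
      using Cons.IH[of i] Cons.prems 5 by auto
    have "h (Cap i) * cup_word h (j # W) = d ^ n *\<^sub>R cup_word h (m # W')" if "tl_rep h d" for h d
    proof -
      have "h (Cap i) * cup_word h (j # W) = h (Cup m) * (h (Cap i) * cup_word h W)"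
        using that 5 by (simp add: tl_rep_def mult.assoc[symmetric])
      then show ?thesis using W'(3)[OF that] by simp
    qed
    moreover have "valid_word (m # W')" using W' 5 Cons.prems by auto
    ultimately show ?thesis using W'(2) by (intro exI[of _ n] exI[of _ "m # W'"]) auto
  qed
qed simp

fun crossless :: "piece \<Rightarrow> bool" where
  "crossless (Cross b i) \<longleftrightarrow> False"
| "crossless _ \<longleftrightarrow> True"

primrec valid_from :: "nat \<Rightarrow> diagram \<Rightarrow> bool" where
  "valid_from w [] \<longleftrightarrow> True"
| "valid_from w (p # D) \<longleftrightarrow> fits p w \<and> valid_from (width_above p w) D"

definition top_width :: "nat \<Rightarrow> diagram \<Rightarrow> nat" where
  "top_width w D = fold width_above D w"

lemma closes_from_iff: "closes_from w D \<longleftrightarrow> valid_from w D \<and> top_width w D = 0"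
  by (induction D arbitrary: w) (auto simp: top_width_def)

lemma valid_from_append: "valid_from w (D @ E) \<longleftrightarrow> valid_from w D \<and> valid_from (top_width w D) E"
  by (induction D arbitrary: w) (auto simp: top_width_def)

lemma top_width_append: "top_width w (D @ E) = top_width (top_width w D) E"
  by (simp add: top_width_def)

lemma top_width_simps [simp]: "top_width w [] = w" "top_width w (p # D) = top_width (width_above p w) D"
  by (simp_all add: top_width_def)

lemma crossless_reduction:
  assumes "valid_from 0 E" "\<forall>p\<in>set E. crossless p"
  shows "\<exists>n W. valid_word W \<and> 2 * length W = top_width 0 E \<and> (\<forall>h d. tl_rep h d \<longrightarrow> diagram_op h E = d ^ n *\<^sub>R cup_word h W)"
  using assms
proof (induction E rule: rev_induct)
  case Nil
  show ?case by (intro exI[of _ 0] exI[of _ "[]"]) simp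
next
  case (snoc p E)
  obtain n W where W: "valid_word W" "2 * length W = top_width 0 E" "\<And>h d. tl_rep h d \<Longrightarrow> diagram_op h E = d ^ n *\<^sub>R cup_word h W"
    using snoc by (auto simp: valid_from_append)
  have f: "fits p (2 * length W)" using snoc.prems W by (simp add: valid_from_append)
  show ?case
  proof (cases p)
    case (Cup i)
    then show ?thesis using W f
      by (intro exI[of _ n] exI[of _ "i # W"]) (auto simp: diagram_op_append top_width_append)
  next
    case (Cap i)
    then obtain m W' where W': "valid_word W'" "Suc (length W') = length W"
      "\<And>h d. tl_rep h d \<Longrightarrow> h (Cap i) * cup_word h W = d ^ m *\<^sub>R cup_word h W'"
      using cap_cup_word[OF W(1), of i] f by auto
    have "2 * length W' = top_width 0 (E @ [p])" using W(2) W'(2) Cap by (simp add: top_width_append)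
    moreover have "diagram_op h (E @ [p]) = d ^ (n + m) *\<^sub>R cup_word h W'" if "tl_rep h d" for h d
      using W(3)[OF that] W'(3)[OF that] Cap by (simp add: diagram_op_append power_add)
    ultimately show ?thesis using W'(1) by blast
  next
    case (Cross b i)
    then show ?thesis using snoc.prems by simp
  qed
qed

text \<open>The representation with loop value 2 in which cups and caps join equal labels; it counts
  the colourings of the components by two colours.\<close>

lift_definition cup2 :: "nat \<Rightarrow> endo" is "\<lambda>i f s. if s i = s (Suc i) then f (del2 i s) else 0"
  by (simp add: fun_eq_iff)

lift_definition cap2 :: "nat \<Rightarrow> endo" is "\<lambda>i f s. f (ins2 i True True s) + f (ins2 i False False s)"
  by (simp add: fun_eq_iff algebra_simps)

lemma app_cup2: "app (cup2 i) f s = (if s i = s (Suc i) then f (del2 i s) else 0)"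
  by transfer simp

lemma app_cap2: "app (cap2 i) f s = f (ins2 i True True s) + f (ins2 i False False s)"
  by transfer simp

fun colour_op :: "piece \<Rightarrow> endo" where
  "colour_op (Cup i) = cup2 i"
| "colour_op (Cap i) = cap2 i"
| "colour_op (Cross b i) = 0"

lemma zigzag_conf:
  "y = s i \<Longrightarrow> del2 i (ins2 (Suc i) x y s) = s" "x = s i \<Longrightarrow> del2 (Suc i) (ins2 i x y s) = s"
proof -
  show "del2 i (ins2 (Suc i) x y s) = s" if "y = s i"
  proof
    fix j show "del2 i (ins2 (Suc i) x y s) j = s j"
      using that by (cases "j < i"; cases "j = i") (auto simp: del2_def ins2_def)
  qed
  show "del2 (Suc i) (ins2 i x y s) = s" if "x = s i"
  proof
    fix j show "del2 (Suc i) (ins2 i x y s) j = s j"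
      using that by (cases "j < i"; cases "j = i") (auto simp: del2_def ins2_def)
  qed
qed

lemma far_conf:
  assumes "i \<le> j"
  shows "del2 i (ins2 (Suc (Suc j)) x y s) = ins2 j x y (del2 i s)"
    "del2 (Suc (Suc j)) (ins2 i x y s) = ins2 i x y (del2 j s)"
    "ins2 (Suc (Suc j)) x y s i = s i" "ins2 (Suc (Suc j)) x y s (Suc i) = s (Suc i)"
    "ins2 i x y s (Suc (Suc j)) = s j" "ins2 i x y s (Suc (Suc (Suc j))) = s (Suc j)"
proof -
  show "del2 i (ins2 (Suc (Suc j)) x y s) = ins2 j x y (del2 i s)"
  proof
    fix l show "del2 i (ins2 (Suc (Suc j)) x y s) l = ins2 j x y (del2 i s) l"
      using assms by (rule_tac position_cases[of l j]) (auto simp: del2_def ins2_def)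
  qed
  show "del2 (Suc (Suc j)) (ins2 i x y s) = ins2 i x y (del2 j s)"
  proof
    fix l show "del2 (Suc (Suc j)) (ins2 i x y s) l = ins2 i x y (del2 j s) l"
      using assms by (rule_tac position_cases[of l i]) (auto simp: del2_def ins2_def)
  qed
qed (use assms in \<open>auto simp: ins2_def\<close>)

lemma tl_rep_colour_op: "tl_rep colour_op 2"
  unfolding tl_rep_def
proof (intro conjI allI impI)
  fix i
  have z: "ins2 (Suc i) x x s i = s i" "ins2 (Suc i) x x s (Suc i) = x" "ins2 i x x s (Suc i) = x" "ins2 i x x s (Suc (Suc i)) = s i" for x s
    by (auto simp: ins2_def)
  show "colour_op (Cap i) * colour_op (Cup i) = (2::real) *\<^sub>R 1"
    by (rule endo_eqI) (simp add: app_cup2 app_cap2)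
  show "colour_op (Cap (Suc i)) * colour_op (Cup i) = 1"
    by (rule endo_eqI) (auto simp: app_cup2 app_cap2 z zigzag_conf)
  show "colour_op (Cap i) * colour_op (Cup (Suc i)) = 1"
    by (rule endo_eqI) (auto simp: app_cup2 app_cap2 z zigzag_conf)
next
  fix i j :: nat assume "i \<le> j"
  note f = far_conf[OF this]
  show "colour_op (Cap (Suc (Suc j))) * colour_op (Cup i) = colour_op (Cup i) * colour_op (Cap j)"
    by (rule endo_eqI) (simp add: app_cup2 app_cap2 f)
  show "colour_op (Cap i) * colour_op (Cup (Suc (Suc j))) = colour_op (Cup j) * colour_op (Cap i)"
    by (rule endo_eqI) (simp add: app_cup2 app_cap2 f)
qed

context skein
begin

fun piece_op :: "piece \<Rightarrow> endo" where
  "piece_op (Cup i) = cup i"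
| "piece_op (Cap i) = cap i"
| "piece_op (Cross b i) = crossing_op b i"

lemma tl_rep_piece_op: "tl_rep piece_op (- (a^2) - 1 / a^2)"
  unfolding tl_rep_def
proof (intro conjI allI impI)
  fix i
  show "piece_op (Cap i) * piece_op (Cup i) = (- (a^2) - 1 / a^2) *\<^sub>R 1" "piece_op (Cap (Suc i)) * piece_op (Cup i) = 1" "piece_op (Cap i) * piece_op (Cup (Suc i)) = 1"
    by (simp_all add: cap_cup cap_Suc_cup cap_cup_Suc)
next
  fix i j :: nat assume "i \<le> j"
  note f = far_conf[OF this]
  show "piece_op (Cap (Suc (Suc j))) * piece_op (Cup i) = piece_op (Cup i) * piece_op (Cap j)"
    by (rule endo_eqI) (simp add: cup_def cap_def app_cupw app_capw f algebra_simps)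
  show "piece_op (Cap i) * piece_op (Cup (Suc (Suc j))) = piece_op (Cup j) * piece_op (Cap i)"
    by (rule endo_eqI) (simp add: cup_def cap_def app_cupw app_capw f algebra_simps)
qed

end

subsection \<open>Counting components by colourings\<close>

lemma width_eq: "t \<le> length D \<Longrightarrow> width D t = top_width 0 (take t D)"
  by (simp add: width_def top_width_def)

lemma width_append: "t \<le> length D \<Longrightarrow> width (D @ E) t = width D t"
  by (simp add: width_def)

lemma width_length: "width D (length D) = top_width 0 D"
  by (simp add: width_def top_width_def)

lemma points_snoc: "points (D @ [p]) = points D \<union> {(Suc (length D), k) | k. k < width_above p (top_width 0 D)}"
proof -
  have 1: "width (D @ [p]) (Suc (length D)) = width_above p (top_width 0 D)"
    by (simp add: width_def top_width_def)
  have "x \<in> points (D @ [p]) \<longleftrightarrow> x \<in> points D \<union> {(Suc (length D), k) | k. k < width_above p (top_width 0 D)}" for x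
  proof (cases x)
    case (Pair t j)
    show ?thesis
    proof (cases "t = Suc (length D)")
      case True then show ?thesis unfolding Pair by (simp add: points_def 1)
    next
      case False
      then have "t \<le> Suc (length D) \<longleftrightarrow> t \<le> length D" by auto
      then show ?thesis unfolding Pair using False width_append[of t D "[p]"] by (auto simp: points_def)
    qed
  qed
  then show ?thesis by blast
qed

lemma finite_points: "finite (points D)"
proof -
  have "points D = (SIGMA t:{..length D}. {..<width D t})" by (auto simp: points_def)
  then show ?thesis by simp
qed

definition arcs :: "diagram \<Rightarrow> ((nat \<times> nat) \<times> (nat \<times> nat)) set" where
  "arcs D = through_arcs D \<union> turn_arcs D"

lemma valid_layer:
  assumes "valid_from 0 D" "t < length D"
  shows "fits (D ! t) (width D t)" "width D (Suc t) = width_above (D ! t) (width D t)"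
proof -
  have "D = take t D @ D ! t # drop (Suc t) D" using assms(2) by (rule id_take_nth_drop)
  then have "valid_from 0 (take t D @ D ! t # drop (Suc t) D)" using assms(1) by simp
  then show "fits (D ! t) (width D t)"
    using assms(2) by (simp add: valid_from_append width_eq less_imp_le)
  show "width D (Suc t) = width_above (D ! t) (width D t)"
    using assms(2) by (simp add: width_def take_Suc_conv_app_nth)
qed

lemma arcs_points:
  assumes "valid_from 0 D" "(x, y) \<in> arcs D"
  shows "x \<in> points D" "y \<in> points D"
proof -
  have "x \<in> points D \<and> y \<in> points D"
  proof (cases "(x, y) \<in> through_arcs D")
    case True then show ?thesis by (auto simp: through_arcs_def)
  next
    case False
    then consider t i where "x = (t + 1, i)" "y = (t + 1, i + 1)" "t < length D" "D ! t = Cup i"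
      | t i where "x = (t, i)" "y = (t, i + 1)" "t < length D" "D ! t = Cap i"
      using assms(2) by (auto simp: arcs_def turn_arcs_def)
    then show ?thesis
    proof cases
      case 1 then show ?thesis using valid_layer[OF assms(1) 1(3)] by (auto simp: points_def)
    next
      case 2 then show ?thesis using valid_layer[OF assms(1) 2(3)] by (auto simp: points_def)
    qed
  qed
  then show "x \<in> points D" "y \<in> points D" by auto
qed

text \<open>Fixing the value outside the diagram makes colourings determined by the points, so that
  they can be counted.\<close>

definition cols :: "diagram \<Rightarrow> (nat \<times> nat \<Rightarrow> bool) set" where
  "cols D = {c. (\<forall>x. x \<notin> points D \<longrightarrow> \<not> c x) \<and> (\<forall>(x, y)\<in>arcs D. c x = c y)}"

text \<open>Colourings constant along arcs are exactly the unions of components; \<open>G\<close> is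
  the bijection from sets of components.\<close>

lemma card_cols:
  assumes "valid_from 0 D"
  shows "card (cols D) = 2 ^ card (components D)"
proof -
  define R where "R = (arcs D \<union> (arcs D)\<inverse>)\<^sup>*"
  have comp: "components D = points D // R"
    by (simp add: components_def R_def arcs_def Let_def)
  have "sym R" unfolding R_def by (intro sym_rtrancl sym_Un_converse)
  have R_sym: "(y, x) \<in> R" if "(x, y) \<in> R" for x y using \<open>sym R\<close> that by (rule symD)
  have R_trans: "(x, z) \<in> R" if "(x, y) \<in> R" "(y, z) \<in> R" for x y z using that unfolding R_def by (rule rtrancl_trans)
  have R_refl: "(x, x) \<in> R" for x by (simp add: R_def)
  have R_points: "y \<in> points D" if "(x, y) \<in> R" "x \<in> points D" for x y
    using that unfolding R_def by (induction rule: rtrancl_induct) (auto dest: arcs_points[OF assms])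
  have R_cols: "c x = c y" if "(x, y) \<in> R" "c \<in> cols D" for x y c
    using that unfolding R_def by (induction rule: rtrancl_induct) (auto simp: cols_def)
  define G where "G S = (\<lambda>x. x \<in> \<Union>S)" for S :: "(nat \<times> nat) set set"
  have cls: "K = R `` {x}" if K: "K \<in> components D" and x: "x \<in> K" for K x
  proof -
    obtain z where z: "K = R `` {z}" using K by (auto simp only: comp elim: quotientE)
    then have zx: "(z, x) \<in> R" using x by simp
    have "(z, y) \<in> R \<longleftrightarrow> (x, y) \<in> R" for y
      using R_trans[OF zx] R_trans[OF R_sym[OF zx]] by blast
    then show ?thesis unfolding z by blast
  qed
  have "inj_on G (Pow (components D))"
  proof (rule inj_onI)
    have sub: "S \<subseteq> S'" if "S \<in> Pow (components D)" "S' \<in> Pow (components D)" "G S = G S'" for S S'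
    proof
      fix K assume K: "K \<in> S"
      then have Kc: "K \<in> components D" using that by auto
      then obtain x where x: "x \<in> K" using R_refl by (auto simp: comp quotient_def)
      then have "G S' x" using K that(3)[symmetric] by (auto simp: G_def)
      then obtain K' where "K' \<in> S'" "x \<in> K'" by (auto simp: G_def)
      then show "K \<in> S'" using cls[OF Kc x] cls[of K' x] that(2) by auto
    qed
    show "S = S'" if "S \<in> Pow (components D)" "S' \<in> Pow (components D)" "G S = G S'" for S S'
      using sub[OF that] sub[OF that(2,1) that(3)[symmetric]] by auto
  qed
  moreover have "G ` Pow (components D) = cols D"
  proof
    show "G ` Pow (components D) \<subseteq> cols D"
    proof
      fix c assume "c \<in> G ` Pow (components D)"
      then obtain S where S: "S \<subseteq> components D" "c = G S" by auto
      have "x \<in> points D" if cx: "c x" for x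
      proof -
        obtain K where "K \<in> S" "x \<in> K" using cx by (auto simp: S G_def)
        then have "K \<in> points D // R" using S(1) comp by auto
        then obtain z where "z \<in> points D" "K = R `` {z}" by (auto simp: quotient_def)
        then show ?thesis using R_points[of z x] \<open>x \<in> K\<close> by simp
      qed
      moreover have "c x = c y" if xy: "(x, y) \<in> arcs D" for x y
      proof -
        have r: "(x, y) \<in> R" using xy by (auto simp: R_def)
        have "x \<in> K \<longleftrightarrow> y \<in> K" if K: "K \<in> components D" for K
          using cls[OF K, of x] cls[OF K, of y] r R_sym[OF r] by blast
        then show ?thesis using S by (auto simp: G_def)
      qed
      ultimately show "c \<in> cols D" by (auto simp: cols_def)
    qed
    show "cols D \<subseteq> G ` Pow (components D)"
    proof
      fix c assume c: "c \<in> cols D"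
      define S where "S = {R `` {x} | x. c x}"
      have "S \<subseteq> components D" using c by (auto simp: S_def comp quotient_def cols_def)
      moreover have "c = G S"
      proof
        fix x
        have "G S x \<longleftrightarrow> (\<exists>z. c z \<and> (z, x) \<in> R)" unfolding G_def S_def by blast
        also have "\<dots> \<longleftrightarrow> c x" using R_refl[of x] R_cols[of _ x, OF _ c] by blast
        finally show "c x = G S x" by simp
      qed
      ultimately show "c \<in> G ` Pow (components D)" by auto
    qed
  qed
  ultimately have "card (cols D) = card (Pow (components D))" using card_image by force
  moreover have "finite (components D)" unfolding comp using finite_points by (auto simp: quotient_def)
  ultimately show ?thesis by (simp add: card_Pow)
qed

text \<open>The constraint from the turn in a new top layer: a cup restricts the new colours
  \<open>s\<close>, a cap the old colours \<open>c\<close> at level \<open>n\<close>.\<close>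

fun turn_ok :: "piece \<Rightarrow> nat \<Rightarrow> (nat \<times> nat \<Rightarrow> bool) \<Rightarrow> conf \<Rightarrow> bool" where
  "turn_ok (Cup i) n c s \<longleftrightarrow> s i = s (Suc i)"
| "turn_ok (Cap i) n c s \<longleftrightarrow> c (n, i) = c (n, Suc i)"
| "turn_ok (Cross b i) n c s \<longleftrightarrow> True"

fun last_turns :: "piece \<Rightarrow> nat \<Rightarrow> ((nat \<times> nat) \<times> (nat \<times> nat)) set" where
  "last_turns (Cup i) n = {((Suc n, i), (Suc n, Suc i))}"
| "last_turns (Cap i) n = {((n, i), (n, Suc i))}"
| "last_turns (Cross b i) n = {}"

lemma arcs_snoc:
  "arcs (D @ [p]) = arcs D \<union> {((length D, j), (Suc (length D), k)) | j k. j < top_width 0 D \<and> k < width_above p (top_width 0 D) \<and> through p j k}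
    \<union> last_turns p (length D)"
proof -
  have thr: "through_arcs (D @ [p]) = through_arcs D \<union> {((length D, j), (Suc (length D), k)) | j k. j < top_width 0 D \<and> k < width_above p (top_width 0 D) \<and> through p j k}" (is "?A = ?B")
  proof -
    have pD: "(t, j) \<in> points (D @ [p]) \<longleftrightarrow> (t, j) \<in> points D" if "t \<le> length D" for t j
      using that by (auto simp: points_snoc)
    have pS: "(Suc (length D), k) \<in> points (D @ [p]) \<longleftrightarrow> k < width_above p (top_width 0 D)" for k
      by (simp add: points_def width_def top_width_def)
    have pn: "(length D, j) \<in> points D \<longleftrightarrow> j < top_width 0 D" for j
      by (simp add: points_def width_length)
    have "((t, j), (u, k)) \<in> ?A \<longleftrightarrow> ((t, j), (u, k)) \<in> ?B" for t j u k
    proof (cases "t = length D")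
      case True
      have "((t, j), (u, k)) \<notin> through_arcs D" using True by (auto simp: through_arcs_def)
      then show ?thesis using True pD pS pn by (auto simp: through_arcs_def)
    next
      case False
      then show ?thesis using pD by (auto simp: through_arcs_def nth_append)
    qed
    then show ?thesis by auto
  qed
  have trn: "turn_arcs (D @ [p]) = turn_arcs D \<union> last_turns p (length D)"
  proof (cases p)
    case (Cup i)
    then show ?thesis by (fastforce simp: turn_arcs_def nth_append less_Suc_eq)
  next
    case (Cap i)
    then show ?thesis by (fastforce simp: turn_arcs_def nth_append less_Suc_eq)
  next
    case (Cross b i)
    then show ?thesis by (fastforce simp: turn_arcs_def nth_append less_Suc_eq)
  qed
  show ?thesis unfolding arcs_def thr trn by auto
qed

lemma card_cols_snoc:
  assumes "valid_from 0 (D @ [p])"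
  defines "n \<equiv> length D" and "w \<equiv> top_width 0 D"
  shows "card {c \<in> cols (D @ [p]). \<forall>k<width_above p w. c (Suc n, k) = s k}
    = card {c \<in> cols D. (\<forall>j<w. \<forall>k<width_above p w. through p j k \<longrightarrow> c (n, j) = s k) \<and> turn_ok p n c s}"
    (is "card ?A = card ?B")
proof -
  have vD: "valid_from 0 D" and fit: "fits p w" using assms(1) by (simp_all add: valid_from_append w_def)
  define res where "res c = (\<lambda>x. x \<in> points D \<and> c x)" for c :: "nat \<times> nat \<Rightarrow> bool"
  define ext where "ext c = (\<lambda>(t, k). if t = Suc n then k < width_above p w \<and> s k else c (t, k))" for c :: "nat \<times> nat \<Rightarrow> bool"
  have pts: "(Suc n, k) \<notin> points D" "(n, j) \<in> points D \<longleftrightarrow> j < w"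
    "x \<in> points (D @ [p]) \<longleftrightarrow> x \<in> points D \<or> (\<exists>k<width_above p w. x = (Suc n, k))" for k j x
  proof -
    show "(Suc n, k) \<notin> points D" "(n, j) \<in> points D \<longleftrightarrow> j < w"
      by (auto simp: points_def n_def w_def width_length)
    show "x \<in> points (D @ [p]) \<longleftrightarrow> x \<in> points D \<or> (\<exists>k<width_above p w. x = (Suc n, k))"
      unfolding points_snoc n_def w_def by blast
  qed
  have ext_D: "ext c x = c x" if "x \<in> points D" for c x using that pts(1) by (cases x) (auto simp: ext_def)
  note arcsD = arcs_points[OF vD]
  have turnA: "turn_ok p n c s" if "\<forall>k<width_above p w. c (Suc n, k) = s k" "\<forall>(x, y)\<in>last_turns p n. c x = c y" for c
    using that fit by (cases p) auto
  have turnB: "\<forall>(x, y)\<in>last_turns p n. ext c x = ext c y" if "turn_ok p n c s" for c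
    using that fit by (cases p) (auto simp: ext_def)
  \<comment> \<open>Restriction forgets the top level, whose colours \<open>ext\<close> restores
    from \<open>s\<close>.\<close>
  have "bij_betw res ?A ?B"
  proof (rule bij_betw_byWitness[where f' = ext])
    show "\<forall>c\<in>?A. ext (res c) = c"
    proof
      fix c assume c: "c \<in> ?A"
      show "ext (res c) = c"
      proof
        fix x show "ext (res c) x = c x"
          using c pts(3)[of x] pts(3)[of "(Suc n, snd x)"] pts(1) by (cases x) (auto simp: ext_def res_def cols_def)
      qed
    qed
    show "\<forall>c\<in>?B. res (ext c) = c"
    proof
      fix c assume c: "c \<in> ?B"
      show "res (ext c) = c"
      proof
        fix x
        have "x \<in> points D" if "c x" using c that unfolding cols_def by blast
        then show "res (ext c) x = c x" using ext_D[of x c] unfolding res_def by blast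
      qed
    qed
    show "res ` ?A \<subseteq> ?B"
    proof (rule image_subsetI)
      fix c assume c: "c \<in> ?A"
      have ar: "c x = c y" if "(x, y) \<in> arcs (D @ [p])" for x y using c that by (auto simp: cols_def)
      have "c (n, j) = s k" if "j < w" "k < width_above p w" "through p j k" for j k
        using ar[of "(n, j)" "(Suc n, k)"] c that by (auto simp: arcs_snoc n_def w_def)
      moreover have "turn_ok p n c s"
      proof -
        have "last_turns p n \<subseteq> arcs (D @ [p])" unfolding arcs_snoc n_def by blast
        then have "\<forall>(x, y)\<in>last_turns p n. c x = c y" using ar by blast
        then show ?thesis using turnA[of c] c by blast
      qed
      moreover have "turn_ok p n (res c) s = turn_ok p n c s"
        using fit pts(2) by (cases p) (auto simp: res_def)
      moreover have "res c \<in> cols D"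
      proof -
        have "res c x = res c y" if xy: "(x, y) \<in> arcs D" for x y
          using ar[of x y] arcsD[OF xy] xy unfolding arcs_snoc res_def by blast
        then show ?thesis unfolding cols_def res_def by blast
      qed
      ultimately show "res c \<in> ?B" using pts(2) by (auto simp: res_def)
    qed
    show "ext ` ?B \<subseteq> ?A"
    proof (rule image_subsetI)
      fix c assume c: "c \<in> ?B"
      have "ext c x = ext c y" if xy: "(x, y) \<in> arcs (D @ [p])" for x y
      proof -
        consider "(x, y) \<in> arcs D" | j k where "x = (n, j)" "y = (Suc n, k)" "j < w" "k < width_above p w" "through p j k"
          | "(x, y) \<in> last_turns p n"
          using xy unfolding arcs_snoc n_def w_def by blast
        then show ?thesis
        proof cases
          case 1
          then have "c x = c y" using c unfolding cols_def by blast
          then show ?thesis using arcsD[OF 1] ext_D[of x c] ext_D[of y c] by simp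
        next
          case 2 then show ?thesis using c by (auto simp: ext_def)
        next
          case 3 then show ?thesis using turnB[of c] c by blast
        qed
      qed
      moreover have "\<not> ext c x" if "x \<notin> points (D @ [p])" for x
        using that c pts(3)[of x] by (cases x) (auto simp: ext_def cols_def)
      ultimately have "ext c \<in> cols (D @ [p])" unfolding cols_def by blast
      then show "ext c \<in> ?A" by (simp add: ext_def)
    qed
  qed
  then show ?thesis by (rule bij_betw_same_card)
qed

lemma finite_cols: "finite (cols D)"
proof -
  have "cols D \<subseteq> (\<lambda>S x. x \<in> S) ` Pow (points D)"
  proof
    fix c assume "c \<in> cols D"
    then have "{x. c x} \<in> Pow (points D)" "c = (\<lambda>x. x \<in> {x. c x})" by (auto simp: cols_def)
    then show "c \<in> (\<lambda>S x. x \<in> S) ` Pow (points D)" by blast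
  qed
  then show ?thesis using finite_points finite_subset by blast
qed

text \<open>A transfer-matrix count: \<open>cup2\<close> requires equal colours at its ends,
  \<open>cap2\<close> sums over their common colour, and \<open>card_cols_snoc\<close> is the
  matching step for colourings.\<close>

lemma count_cols:
  assumes "valid_from 0 D" "\<forall>p\<in>set D. crossless p"
  shows "app (diagram_op colour_op D) (\<lambda>s. 1) s = card {c \<in> cols D. \<forall>j<top_width 0 D. c (length D, j) = s j}"
  using assms
proof (induction D arbitrary: s rule: rev_induct)
  case Nil
  have "cols [] = {\<lambda>x. False}" by (auto simp: cols_def points_def width_def arcs_def through_arcs_def turn_arcs_def)
  then have "{c \<in> cols []. \<forall>j<top_width 0 []. c (length [], j) = s j} = {\<lambda>x. False}" by auto
  then show ?case by simp
next
  case (snoc p D)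
  define n where "n = length D"
  define w where "w = top_width 0 D"
  have v: "valid_from 0 D" "fits p w" using snoc.prems by (auto simp: valid_from_append w_def)
  have IH: "app (diagram_op colour_op D) (\<lambda>s. 1) s = card {c \<in> cols D. \<forall>j<w. c (n, j) = s j}" for s
    using snoc.IH[of s] snoc.prems v by (simp add: n_def w_def)
  have "app (colour_op p) (app (diagram_op colour_op D) (\<lambda>s. 1)) s = card {c \<in> cols D. (\<forall>j<w. \<forall>k<width_above p w. through p j k \<longrightarrow> c (n, j) = s k) \<and> turn_ok p n c s}"
  proof (cases p)
    case (Cup i)
    have "{c \<in> cols D. (\<forall>j<w. \<forall>k<width_above p w. through p j k \<longrightarrow> c (n, j) = s k) \<and> turn_ok p n c s}
      = (if s i = s (Suc i) then {c \<in> cols D. \<forall>j<w. c (n, j) = del2 i s j} else {})"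
      using v(2) Cup by (auto simp: del2_def)
    then show ?thesis using Cup by (simp add: app_cup2 IH)
  next
    case (Cap i)
    let ?B = "\<lambda>x. {c \<in> cols D. \<forall>j<w. c (n, j) = ins2 i x x s j}"
    \<comment> \<open>The two sets are separated by the colour that \<open>c\<close> gives to both
      ends of the cap.\<close>
    have "{c \<in> cols D. (\<forall>j<w. \<forall>k<width_above p w. through p j k \<longrightarrow> c (n, j) = s k) \<and> turn_ok p n c s} = ?B True \<union> ?B False"
      (is "?L = _")
    proof -
      have "c \<in> ?L \<longleftrightarrow> c \<in> ?B (c (n, i))" for c
      proof
        assume c: "c \<in> ?L"
        have cc: "c (n, j) = s k" if "j < w" "k < width_above p w" "through p j k" for j k
          using c that by blast
        have "c (n, j) = ins2 i (c (n, i)) (c (n, i)) s j" if "j < w" for j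
        proof (rule position_cases[of j i])
          assume j: "j < i"
          then have "through p j j" "j < width_above p w" using Cap v(2) by auto
          then show ?thesis using cc[OF that] j by auto
        next
          assume "j = i" then show ?thesis by simp
        next
          assume "j = Suc i" then show ?thesis using c Cap by simp
        next
          fix m assume m: "j = Suc (Suc m)" "i \<le> m"
          then have "through p j m" "m < width_above p w" using Cap that by auto
          then show ?thesis using cc[OF that] m by auto
        qed
        then show "c \<in> ?B (c (n, i))" using c by simp
      next
        assume c: "c \<in> ?B (c (n, i))"
        define x where "x = c (n, i)"
        have bc: "c (n, j) = ins2 i x x s j" if "j < w" for j using c that unfolding x_def by blast
        have "c (n, Suc i) = x" using bc[of "Suc i"] v(2) Cap by simp
        then have "turn_ok p n c s" using Cap by (simp add: x_def)
        moreover have "c (n, j) = s k" if "j < w" "through p j k" for j k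
          using bc[OF that(1)] that(2) Cap by (cases "k < i") auto
        moreover have "c \<in> cols D" using c by blast
        ultimately show "c \<in> ?L" by blast
      qed
      moreover have "c \<in> ?B x \<Longrightarrow> x = c (n, i)" for c x using v(2) Cap by auto
      ultimately have *: "\<And>c. c \<in> ?L \<longleftrightarrow> c \<in> B (c (n, i))" "\<And>c x. c \<in> B x \<Longrightarrow> x = c (n, i)" if "B = ?B" for B
        unfolding that by blast+
      have "?L = B True \<union> B False" if "B = ?B" for B
      proof (rule set_eqI)
        fix c
        show "c \<in> ?L \<longleftrightarrow> c \<in> B True \<union> B False"
          unfolding *(1)[OF that] using *(2)[OF that, of c True] *(2)[OF that, of c False]
          by (cases "c (n, i)") auto
      qed
      then show ?thesis by simp
    qed
    moreover have "?B True \<inter> ?B False = {}"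
    proof -
      have "c (n, i) = x" if "c \<in> ?B x" for c x using that v(2) Cap by auto
      then show ?thesis by blast
    qed
    moreover have "finite (?B x)" for x using finite_cols by simp
    ultimately show ?thesis using Cap by (simp add: app_cap2 IH card_Un_disjoint)
  next
    case (Cross b i) then show ?thesis using snoc.prems by simp
  qed
  also have "\<dots> = card {c \<in> cols (D @ [p]). \<forall>k<width_above p w. c (Suc n, k) = s k}"
    using card_cols_snoc[OF snoc.prems(1), of s] by (simp add: n_def w_def)
  finally show ?case by (simp add: diagram_op_append top_width_append n_def w_def)
qed

section \<open>The bracket as a value of the operator representation\<close>

context skein
begin

text \<open>The exponent from \<open>crossless_reduction\<close> is the same for both
  representations. In the colouring representation its power of 2 counts colourings, which
  identifies it with the number of components.\<close>

lemma crossless_eval: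
  assumes "closes_from 0 G" "\<forall>p\<in>set G. crossless p"
  shows "diagram_op piece_op G = ((- (a^2) - 1 / a^2) ^ card (components G)) *\<^sub>R 1"
proof -
  have v: "valid_from 0 G" "top_width 0 G = 0" using assms(1) by (simp_all add: closes_from_iff)
  obtain n W where nW: "2 * length W = top_width 0 G" "\<And>h d. tl_rep h d \<Longrightarrow> diagram_op h G = d ^ n *\<^sub>R cup_word h W"
    using crossless_reduction[OF v(1) assms(2)] by auto
  then have W: "W = []" using v by simp
  have "(2::real) ^ n = 2 ^ card (components G)"
  proof -
    have "(2::real) ^ n = app (diagram_op colour_op G) (\<lambda>s. 1) (\<lambda>_. False)" using nW(2)[OF tl_rep_colour_op] W by simp
    also have "\<dots> = card (cols G)" using count_cols[OF v(1) assms(2)] v(2) by simp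
    finally show ?thesis using card_cols[OF v(1)] by simp
  qed
  then have "n = card (components G)" by simp
  then show ?thesis using nW(2)[OF tl_rep_piece_op] W by simp
qed

lemma states_valid:
  "(x, G) \<in> set (states D) \<Longrightarrow> closes_from w D \<Longrightarrow> closes_from w G \<and> (\<forall>p\<in>set G. crossless p)"
proof (induction D arbitrary: x G w)
  case (Cons p D)
  show ?case
  proof (cases p)
    case (Cross b i)
    then have "i + 2 \<le> w" using Cons.prems by simp
    then obtain v where "w = Suc (Suc v)" "i \<le> v" by (metis add_2_eq_Suc' le_Suc_ex add_Suc le_add1)
    then show ?thesis using Cons Cross by auto
  qed (use Cons in auto)
qed simp

text \<open>Each crossing operator is the weighted sum of the operators of its two smoothings, so
  the state sum factors layer by layer.\<close>

lemma sum_states: "(\<Sum>(x, G)\<leftarrow>states D. a powi x *\<^sub>R diagram_op piece_op G) = diagram_op piece_op D"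
proof (induction D)
  case (Cons p D)
  have lin: "(\<Sum>(x, G)\<leftarrow>L. (c * a powi x) *\<^sub>R (diagram_op piece_op G * y)) = c *\<^sub>R ((\<Sum>(x, G)\<leftarrow>L. a powi x *\<^sub>R diagram_op piece_op G) * y)" for L :: "(int \<times> diagram) list" and c and y :: endo
    by (induction L) (auto simp: distrib_right scaleR_right_distrib)
  show ?case
  proof (cases p)
    case (Cup i)
    then show ?thesis using lin[where c = 1 and L = "states D" and y = "cup i"] Cons
      by (simp add: case_prod_unfold comp_def)
  next
    case (Cap i)
    then show ?thesis using lin[where c = 1 and L = "states D" and y = "cap i"] Cons
      by (simp add: case_prod_unfold comp_def)
  next
    case (Cross b i)
    have 1: "a powi (x + (if b then 1 else - 1)) = av b * a powi x" "a powi (x + (if b then - 1 else 1)) = (1 / av b) * a powi x" for x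
      by (auto simp: av_def power_int_add power_int_minus field_simps)
    have "(\<Sum>(x, G)\<leftarrow>states (p # D). a powi x *\<^sub>R diagram_op piece_op G)
      = av b *\<^sub>R diagram_op piece_op D + (1 / av b) *\<^sub>R (diagram_op piece_op D * (cup i * cap i))"
      using lin[where c = "av b" and L = "states D" and y = 1] lin[where c = "1 / av b" and L = "states D" and y = "cup i * cap i"] Cons
      by (simp add: Cross case_prod_unfold comp_def 1 mult.assoc)
    then show ?thesis by (simp add: Cross rr_def U_def distrib_left)
  qed
qed simp

definition laurent_eval :: "laurent \<Rightarrow> real" where
  "laurent_eval f = (\<Sum>k\<in>Poly_Mapping.keys f. of_int (Poly_Mapping.lookup f k) * a powi k)"

lemma laurent_eval_superset: "finite S \<Longrightarrow> Poly_Mapping.keys f \<subseteq> S \<Longrightarrow> laurent_eval f = (\<Sum>k\<in>S. of_int (Poly_Mapping.lookup f k) * a powi k)"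
  unfolding laurent_eval_def by (rule sum.mono_neutral_left) (auto simp: in_keys_iff)

lemma laurent_eval_add: "laurent_eval (f + g) = laurent_eval f + laurent_eval g"
proof -
  let ?S = "Poly_Mapping.keys f \<union> Poly_Mapping.keys g"
  have "Poly_Mapping.keys (f + g) \<subseteq> ?S" by (rule keys_add)
  then show ?thesis
    by (simp add: laurent_eval_superset[of ?S] lookup_add distrib_right sum.distrib)
qed

lemma laurent_eval_0 [simp]: "laurent_eval 0 = 0" by (simp add: laurent_eval_def)

lemma laurent_eval_single: "laurent_eval (Poly_Mapping.single k c) = of_int c * a powi k"
  by (simp add: laurent_eval_def)

lemma laurent_eval_sum: "laurent_eval (sum f I) = (\<Sum>i\<in>I. laurent_eval (f i))"
  by (induction I rule: infinite_finite_induct) (simp_all add: laurent_eval_add)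

lemma laurent_eval_mult: "laurent_eval (f * g) = laurent_eval f * laurent_eval g"
proof -
  have "f * g = (\<Sum>i\<in>Poly_Mapping.keys f. Poly_Mapping.single i (Poly_Mapping.lookup f i)) *
      (\<Sum>j\<in>Poly_Mapping.keys g. Poly_Mapping.single j (Poly_Mapping.lookup g j))"
    by (simp only: sum_of_monomials)
  also have "\<dots> = (\<Sum>i\<in>Poly_Mapping.keys f. \<Sum>j\<in>Poly_Mapping.keys g. Poly_Mapping.single (i + j) (Poly_Mapping.lookup f i * Poly_Mapping.lookup g j))"
    by (simp add: sum_product mult_single)
  finally have "laurent_eval (f * g) = (\<Sum>i\<in>Poly_Mapping.keys f. \<Sum>j\<in>Poly_Mapping.keys g.
      of_int (Poly_Mapping.lookup f i * Poly_Mapping.lookup g j) * a powi (i + j))"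
    by (simp add: laurent_eval_sum laurent_eval_single)
  then show ?thesis
    unfolding laurent_eval_def sum_product by (simp add: power_int_add mult.assoc mult.left_commute)
qed

lemma laurent_eval_power: "laurent_eval (f ^ n) = laurent_eval f ^ n"
proof (induction n)
  case 0
  have "laurent_eval (Poly_Mapping.single 0 1) = 1" by (simp add: laurent_eval_single del: single_one)
  then show ?case by (simp only: single_one power_0)
qed (simp add: laurent_eval_mult)

lemma laurent_eval_bracket:
  assumes "link_diagram D"
  shows "diagram_op piece_op D = laurent_eval (bracket D) *\<^sub>R 1"
proof -
  have c: "closes_from 0 D" using assms by (simp add: link_diagram_def)
  have loop: "laurent_eval loop_value = - (a^2) - 1 / a^2"
  proof -
    have lv: "loop_value = Poly_Mapping.single 2 (-1) + Poly_Mapping.single (-2) (-1)"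
      by (simp add: loop_value_def single_uminus)
    show ?thesis
      unfolding lv by (simp add: laurent_eval_add laurent_eval_single power_int_minus divide_inverse del: single_uminus)
  qed
  have "laurent_eval (bracket D) *\<^sub>R 1 = (\<Sum>(x, G)\<leftarrow>states D. a powi x *\<^sub>R (((- (a^2) - 1 / a^2) ^ card (components G)) *\<^sub>R (1 :: endo)))"
  proof -
    have "laurent_eval (\<Sum>(x, G)\<leftarrow>L. A_pow x * loop_value ^ card (components G)) *\<^sub>R 1 =
      (\<Sum>(x, G)\<leftarrow>L. a powi x *\<^sub>R (((- (a^2) - 1 / a^2) ^ card (components G)) *\<^sub>R (1 :: endo)))" for L
      by (induction L) (auto simp: laurent_eval_add laurent_eval_mult laurent_eval_single laurent_eval_power loop scaleR_left_distrib)
    then show ?thesis by (simp add: bracket_def)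
  qed
  also have "\<dots> = (\<Sum>(x, G)\<leftarrow>states D. a powi x *\<^sub>R diagram_op piece_op G)"
    using states_valid[OF _ c] crossless_eval by (intro arg_cong[where f = sum_list] map_cong) auto
  finally show ?thesis unfolding sum_states by simp
qed

end

text \<open>Agreement on \<open>y\<close> alone passes to powers because the two operators commute.
  It is applied to the Casimir elements at the two ends of a cup.\<close>

lemma poly_op_absorb_right:
  assumes "x * y = x' * y" "x * x' = x' * x" shows "poly_op q x * y = poly_op q x' * y"
proof (induction q)
  case (pCons c q)
  have "x * poly_op q x * y = x * poly_op q x' * y" using pCons by (simp add: mult.assoc)
  also have "\<dots> = poly_op q x' * (x * y)" using poly_op_intertwine[OF assms(2), of q] by (simp add: mult.assoc)
  also have "\<dots> = x' * poly_op q x' * y" using poly_op_intertwine[of x' x' x' q] by (simp add: assms(1) mult.assoc)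
  finally show ?case by (simp add: distrib_right)
qed simp

lemma poly_op_absorb_left:
  assumes "y * x = y * x'" "x * x' = x' * x" shows "y * poly_op q x = y * poly_op q x'"
proof (induction q)
  case (pCons c q)
  have "y * (x * poly_op q x) = (y * poly_op q x) * x" using poly_op_intertwine[of x x x q] by (simp add: mult.assoc)
  also have "\<dots> = y * (x * poly_op q x')" using pCons poly_op_intertwine[OF assms(2), of q] by (simp add: mult.assoc)
  also have "\<dots> = y * (x' * poly_op q x')" using assms(1) by (simp add: mult.assoc[symmetric])
  finally show ?case by (simp add: distrib_left)
qed simp

definition crossings :: "diagram \<Rightarrow> nat" where
  "crossings D = length (filter (\<lambda>p. \<not> crossless p) D)"

section \<open>Cabled pieces and the sliding of projections\<close>

context skein
begin

fun cable_op :: "nat \<Rightarrow> piece \<Rightarrow> endo" where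
  "cable_op k (Cup i) = CupN (k * i) k"
| "cable_op k (Cap i) = CapN (k * i) k"
| "cable_op k (Cross b i) = X (av b) (k * i) k k"

lemma oplg_cable_piece: "diagram_op piece_op (cable_piece k p) = cable_op k p"
proof (cases p)
  case (Cup i)
  have "diagram_op piece_op (map (\<lambda>m. Cup (q + m)) [0..<n]) = CupN q n" for q n
    by (induction n) (simp_all add: diagram_op_append)
  then show ?thesis by (simp add: Cup)
next
  case (Cap i)
  have "diagram_op piece_op (map (\<lambda>m. Cap (q + m)) (rev [0..<n])) = CapN q n" for q n
    by (induction n) simp_all
  then show ?thesis by (simp add: Cap)
next
  case (Cross b i)
  have row: "diagram_op piece_op (map (\<lambda>s. Cross b (q + s)) [0..<n]) = Rr (av b) q n" for q n
    by (induction n) (simp_all add: diagram_op_append)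
  have "diagram_op piece_op (concat (map (\<lambda>r. map (\<lambda>s. Cross b (q + r + s)) [0..<n]) (rev [0..<m]))) = X (av b) q m n" for q m n
    by (induction m) (simp_all add: diagram_op_append row X_snoc del: X.simps(2))
  then show ?thesis by (simp add: Cross)
qed

lemma oplg_cable: "diagram_op piece_op (cable k D) = diagram_op (cable_op k) D"
  by (induction D) (simp_all add: cable_def diagram_op_append oplg_cable_piece)

text \<open>Strands left of the piece commute by locality, strands right of a turn are shifted by
  two bundles, and at a crossing the Casimir element follows its bundle.\<close>

lemma P_slide_through:
  assumes "fits p w" "j < w" "through p j l"
  shows "cable_op k p * P (k * j) k r = P (k * l) k r * cable_op k p"
proof -
  have dis: "k * j + k \<le> k * i" if "j < i" for i j :: nat
    using mult_le_mono2[of "Suc j" i k] that by simp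
  have ivl: "{k * j..<k * j + k} \<subseteq> {..<k * i}" if "j < i" for i j :: nat
    using dis[OF that] by auto
  show ?thesis
  proof (cases p)
    case (Cup i)
    show ?thesis
    proof (cases "j < i")
      case True
      then show ?thesis using assms Cup CupN_low[OF P_alg ivl[OF True]] by auto
    next
      case False
      have "C (k * j + 2 * k) k * CupN (k * i) k = CupN (k * i) k * C (k * j) k"
        by (rule CupN_shift) (use False in simp)
      then have "CupN (k * i) k * P (k * j) k r = P (k * j + 2 * k) k r * CupN (k * i) k"
        by (intro P_intertwine) simp
      moreover have "l = Suc (Suc j)" using assms Cup False by simp
      moreover have "k * Suc (Suc j) = k * j + 2 * k" by simp
      ultimately show ?thesis unfolding Cup cable_op.simps by (simp only:)
    qed
  next
    case (Cap i)
    show ?thesis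
    proof (cases "l < i")
      case True
      then show ?thesis using assms Cap CapN_low[OF P_alg ivl[OF True]] by auto
    next
      case False
      have "CapN (k * i) k * C (k * l + 2 * k) k = C (k * l) k * CapN (k * i) k"
        by (rule CapN_shift) (use False in simp)
      then have "CapN (k * i) k * P (k * l + 2 * k) k r = P (k * l) k r * CapN (k * i) k"
        by (rule P_intertwine)
      moreover have "j = Suc (Suc l)" using assms Cap False by simp
      moreover have "k * Suc (Suc l) = k * l + 2 * k" by simp
      ultimately show ?thesis unfolding Cap cable_op.simps by (simp only:)
    qed
  next
    case (Cross b i)
    consider "j = i" "l = Suc i" | "j = Suc i" "l = i" | "j < i" "l = j" | "Suc i < j" "l = j"
    proof -
      have "j = i \<or> j = Suc i \<or> j < i \<or> Suc i < j" by linarith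
      moreover have "l = (if j = i then Suc i else if j = Suc i then i else j)" using assms(3) Cross by simp
      ultimately show thesis using that by auto
    qed
    then show ?thesis
    proof cases
      case 1
      then show ?thesis using P_intertwine[OF X_C_left[of b "k * i" k k]] Cross by (simp add: add.commute)
    next
      case 2
      then show ?thesis using P_intertwine[OF X_C_right[of b "k * i" k k]] Cross by (simp add: add.commute)
    next
      case 3
      show ?thesis unfolding Cross cable_op.simps 3(2)
        by (rule alg_commute[OF P_alg X_alg]) (use dis[OF 3(1)] in auto)
    next
      case 4
      show ?thesis unfolding Cross cable_op.simps 4(2)
        by (rule alg_commute[OF P_alg X_alg]) (use dis[OF 4(1)] in auto)
    qed
  qed
qed

lemma P_slide_cup: "P (k * i) k r * cable_op k (Cup i) = P (k * Suc i) k r * cable_op k (Cup i)"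
proof -
  have "C (k * i) k * C (k * i + k) k = C (k * i + k) k * C (k * i) k"
    by (rule block_disjoint[OF C_alg C_alg])
  then show ?thesis
    using poly_op_absorb_right[OF CupN_C] unfolding P_def by (simp add: add.commute)
qed

lemma P_slide_cap: "cable_op k (Cap i) * P (k * i) k r = cable_op k (Cap i) * P (k * Suc i) k r"
proof -
  have "C (k * i) k * C (k * i + k) k = C (k * i + k) k * C (k * i) k"
    by (rule block_disjoint[OF C_alg C_alg])
  then show ?thesis
    using poly_op_absorb_left[OF CapN_C] unfolding P_def by (simp add: add.commute)
qed

subsection \<open>Inserting projections into a cabled diagram\<close>

primrec insert_P :: "nat \<Rightarrow> nat \<Rightarrow> (nat \<times> nat) set \<Rightarrow> nat \<Rightarrow> nat \<Rightarrow> endo" where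
  "insert_P k r S t 0 = 1"
| "insert_P k r S t (Suc w) = insert_P k r S t w * (if (t, w) \<in> S then P (k * w) k r else 1)"

text \<open>The $k$-cable of a diagram with the projection onto component $r$ inserted on the strands
  of the $j$-th arc at level $t$ for all $(t, j) \in S$.\<close>

primrec eval_P :: "nat \<Rightarrow> nat \<Rightarrow> (nat \<times> nat) set \<Rightarrow> nat \<Rightarrow> nat \<Rightarrow> diagram \<Rightarrow> endo" where
  "eval_P k r S t w [] = insert_P k r S t w"
| "eval_P k r S t w (p # D) = eval_P k r S (Suc t) (width_above p w) D * cable_op k p * insert_P k r S t w"

lemma P_P_groups: "i \<noteq> j \<Longrightarrow> P (k * i) k r * P (k * j) k r = P (k * j) k r * P (k * i) k r"
proof (rule alg_commute[OF P_alg P_alg])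
  assume "i \<noteq> j"
  then consider "Suc i \<le> j" | "Suc j \<le> i" by linarith
  then show "{k * i..<k * i + k} \<inter> {k * j..<k * j + k} = {}"
  proof cases
    case 1
    then have "k * i + k \<le> k * j" using mult_le_mono2[of "Suc i" j k] by simp
    then show ?thesis by auto
  next
    case 2
    then have "k * j + k \<le> k * i" using mult_le_mono2[of "Suc j" i k] by simp
    then show ?thesis by auto
  qed
qed

lemma insert_P_commute: "insert_P k r S t w * P (k * j) k r = P (k * j) k r * insert_P k r S t w"
proof (induction w)
  case (Suc w)
  have "P (k * w) k r * P (k * j) k r = P (k * j) k r * P (k * w) k r"
    by (cases "w = j") (auto intro: P_P_groups)
  then show ?case using Suc by (auto intro: mult_commute)
qed simp

text \<open>Valid also if the point already belongs to \<open>S\<close>, as projections are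
  idempotent and commute; \<open>r \<le> k\<close> enters through idempotence.\<close>

lemma insert_P_insert:
  assumes "r \<le> k" "j < w"
  shows "insert_P k r (insert (t, j) S) t w = insert_P k r S t w * P (k * j) k r"
  using assms(2)
proof (induction w)
  case (Suc w)
  have eq: "insert_P k r (insert (t, j) S) t v = insert_P k r S t v" if "v \<le> j" for v
    using that by (induction v) auto
  show ?case
  proof (cases "j = w")
    case True
    then show ?thesis using eq[of w] P_idem[OF assms(1)] by (auto simp: mult.assoc)
  next
    case False
    then show ?thesis using Suc P_P_groups[of j w k r] by (auto simp: mult.assoc)
  qed
qed simp

lemma insert_P_cong: "(\<And>j. j < w \<Longrightarrow> (t, j) \<in> S \<longleftrightarrow> (t, j) \<in> S') \<Longrightarrow> insert_P k r S t w = insert_P k r S' t w"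
  by (induction w) auto

lemma eval_P_cong: "(\<And>u j. t \<le> u \<Longrightarrow> u \<le> t + length D \<Longrightarrow> (u, j) \<in> S \<longleftrightarrow> (u, j) \<in> S') \<Longrightarrow> eval_P k r S t w D = eval_P k r S' t w D"
proof (induction D arbitrary: t w)
  case (Cons p D)
  have "eval_P k r S (Suc t) (width_above p w) D = eval_P k r S' (Suc t) (width_above p w) D"
    by (rule Cons.IH) (use Cons.prems in auto)
  moreover have "insert_P k r S t w = insert_P k r S' t w" by (rule insert_P_cong) (use Cons.prems in auto)
  ultimately show ?case by simp
qed (auto intro: insert_P_cong)

lemma eval_P_empty: "eval_P k r {} t w D = diagram_op (cable_op k) D"
proof -
  have "insert_P k r {} t w = 1" for t w by (induction w) auto
  then show ?thesis by (induction D arbitrary: t w) auto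
qed

lemma eval_P_split: "eval_P k r S t w (D1 @ p # D2)
  = eval_P k r S (Suc (t + length D1)) (top_width w (D1 @ [p])) D2 * cable_op k p * eval_P k r S t w D1"
  by (induction D1 arbitrary: t w) (simp_all add: mult.assoc)

lemma eval_P_insert_bottom:
  assumes "r \<le> k" "j < w"
  shows "eval_P k r (insert (t, j) S) t w D = eval_P k r S t w D * P (k * j) k r"
proof (cases D)
  case Nil then show ?thesis using insert_P_insert[OF assms] by simp
next
  case (Cons p D')
  have "eval_P k r (insert (t, j) S) (Suc t) w' D' = eval_P k r S (Suc t) w' D'" for w' by (rule eval_P_cong) auto
  then show ?thesis using Cons insert_P_insert[OF assms] by (simp add: mult.assoc)
qed

lemma eval_P_insert_top:
  assumes "r \<le> k" "j < top_width w D"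
  shows "eval_P k r (insert (t + length D, j) S) t w D = P (k * j) k r * eval_P k r S t w D"
  using assms(2)
proof (induction D arbitrary: t w)
  case Nil
  then show ?case using insert_P_insert[OF assms(1), of j w t S] insert_P_commute by simp
next
  case (Cons p D)
  have "insert_P k r (insert (t + length (p # D), j) S) t w = insert_P k r S t w" by (rule insert_P_cong) auto
  then show ?case using Cons.IH[of "width_above p w" "Suc t"] Cons.prems by (simp add: mult.assoc)
qed

text \<open>A through arc is handled by \<open>P_slide_through\<close>; the two ends of a turn carry
  interchangeable projections by \<open>P_slide_cup\<close> and \<open>P_slide_cap\<close>. All
  other insertions stay in place.\<close>

lemma eval_P_slide:
  assumes r: "r \<le> k" and v: "valid_from 0 D" and arc: "(x, y) \<in> arcs D"
  shows "eval_P k r (insert x S) 0 0 D = eval_P k r (insert y S) 0 0 D"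
proof -
  have layer: "\<exists>D1 D2. D = D1 @ D ! t # D2 \<and> length D1 = t \<and> fits (D ! t) (top_width 0 D1)
      \<and> width D t = top_width 0 D1 \<and> width D (Suc t) = top_width 0 (D1 @ [D ! t])" if "t < length D" for t
    using id_take_nth_drop[OF that] valid_layer[OF v that] that
    by (intro exI[of _ "take t D"] exI[of _ "drop (Suc t) D"]) (auto simp: width_eq top_width_append)
  have lo: "eval_P k r (insert (t, j) S) 0 0 (D1 @ p # D2) =
      eval_P k r S (Suc (length D1)) (top_width 0 (D1 @ [p])) D2 * (cable_op k p * P (k * j) k r) * eval_P k r S 0 0 D1"
    if "t = length D1" "j < top_width 0 D1" for t j D1 p D2
  proof -
    have "eval_P k r (insert (t, j) S) (Suc (length D1)) w' D2 = eval_P k r S (Suc (length D1)) w' D2" for w'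
      by (rule eval_P_cong) (use that in auto)
    then show ?thesis using eval_P_insert_top[OF r that(2), of 0 S] that(1) by (simp add: eval_P_split mult.assoc)
  qed
  have hi: "eval_P k r (insert (t, j) S) 0 0 (D1 @ p # D2) =
      eval_P k r S (Suc (length D1)) (top_width 0 (D1 @ [p])) D2 * (P (k * j) k r * cable_op k p) * eval_P k r S 0 0 D1"
    if "t = Suc (length D1)" "j < top_width 0 (D1 @ [p])" for t j D1 p D2
  proof -
    have "eval_P k r (insert (t, j) S) 0 0 D1 = eval_P k r S 0 0 D1" by (rule eval_P_cong) (use that in auto)
    then show ?thesis using eval_P_insert_bottom[OF r that(2), of "Suc (length D1)" S D2] that(1) by (simp add: eval_P_split mult.assoc)
  qed
  consider t j l where "x = (t, j)" "y = (Suc t, l)" "t < length D" "j < width D t" "l < width D (Suc t)" "through (D ! t) j l"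
    | t i where "x = (Suc t, i)" "y = (Suc t, Suc i)" "t < length D" "D ! t = Cup i"
    | t i where "x = (t, i)" "y = (t, Suc i)" "t < length D" "D ! t = Cap i"
    using arc by (auto simp: arcs_def through_arcs_def turn_arcs_def points_def)
  then show ?thesis
  proof cases
    case 1
    obtain D1 D2 where D: "D = D1 @ D ! t # D2" "length D1 = t" "fits (D ! t) (top_width 0 D1)"
      "width D t = top_width 0 D1" "width D (Suc t) = top_width 0 (D1 @ [D ! t])" using layer[OF 1(3)] by blast
    define p where "p = D ! t"
    have "cable_op k p * P (k * j) k r = P (k * l) k r * cable_op k p"
      by (rule P_slide_through[of p "top_width 0 D1"]) (use 1 D in \<open>auto simp: p_def\<close>)
    then have "eval_P k r (insert x S) 0 0 (D1 @ p # D2) = eval_P k r (insert y S) 0 0 (D1 @ p # D2)"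
      using lo[of t D1 j p D2] hi[of "Suc t" D1 l p D2] 1 D by (simp add: p_def)
    then show ?thesis using D(1) by (simp add: p_def)
  next
    case 2
    obtain D1 D2 where D: "D = D1 @ D ! t # D2" "length D1 = t" "fits (D ! t) (top_width 0 D1)" using layer[OF 2(3)] by blast
    have "i < top_width 0 (D1 @ [Cup i])" "Suc i < top_width 0 (D1 @ [Cup i])" using D(3) 2 by (auto simp: top_width_append)
    then have "eval_P k r (insert x S) 0 0 (D1 @ Cup i # D2) = eval_P k r (insert y S) 0 0 (D1 @ Cup i # D2)"
      using hi[of "Suc t" D1 i "Cup i" D2] hi[of "Suc t" D1 "Suc i" "Cup i" D2] 2 D(2) P_slide_cup[of k i r] by simp
    then show ?thesis using D(1) 2(4) by simp
  next
    case 3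
    obtain D1 D2 where D: "D = D1 @ D ! t # D2" "length D1 = t" "fits (D ! t) (top_width 0 D1)" using layer[OF 3(3)] by blast
    have "i < top_width 0 D1" "Suc i < top_width 0 D1" using D(3) 3 by auto
    then have "eval_P k r (insert x S) 0 0 (D1 @ Cap i # D2) = eval_P k r (insert y S) 0 0 (D1 @ Cap i # D2)"
      using lo[of t D1 i "Cap i" D2] lo[of t D1 "Suc i" "Cap i" D2] 3 D(2) P_slide_cap[of k i r] by simp
    then show ?thesis using D(1) 3(4) by simp
  qed
qed

text \<open>Having a single component means that every point is reached from \<open>x\<close> along
  arcs, so that the points can be added to the set one at a time.\<close>

lemma eval_P_connected:
  assumes r: "r \<le> k" and v: "valid_from 0 D" and knot: "card (components D) = 1" and x: "x \<in> points D"
  shows "eval_P k r {x} 0 0 D = eval_P k r (points D) 0 0 D"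
proof -
  define R where "R = (arcs D \<union> (arcs D)\<inverse>)\<^sup>*"
  have comp: "components D = points D // R"
    by (simp add: components_def R_def arcs_def Let_def)
  have slide: "eval_P k r (insert y S) 0 0 D = eval_P k r (insert z S) 0 0 D" if "(y, z) \<in> R" for y z S
    using that unfolding R_def
  proof (induction rule: rtrancl_induct)
    case (step u z)
    then show ?case using eval_P_slide[OF r v, of u z S] eval_P_slide[OF r v, of z u S] by auto
  qed simp
  obtain K where K: "points D // R = {K}" using knot unfolding comp by (rule card_1_singletonE)
  have rel: "(x, y) \<in> R" if "y \<in> points D" for y
  proof -
    have "R `` {x} = K" "R `` {y} = K" using K x that quotientI[of x "points D" R] quotientI[of y "points D" R] by auto
    moreover have "(y, y) \<in> R" by (simp add: R_def)
    ultimately show ?thesis by blast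
  qed
  have "eval_P k r (insert x S) 0 0 D = eval_P k r {x} 0 0 D" if "finite S" "S \<subseteq> points D" for S
    using that
  proof (induction S)
    case (insert y S)
    have "(x, y) \<in> R" using rel insert.prems by auto
    \<comment> \<open>A second copy of \<open>x\<close> is free; sliding that copy to
      \<open>y\<close> leaves the first one in place.\<close>
    from slide[OF this, of "insert x S"]
    have "eval_P k r (insert x (insert y S)) 0 0 D = eval_P k r (insert x S) 0 0 D"
      by (simp only: insert_commute[of x y] insert_absorb2)
    then show ?case using insert by (simp only: insert_subset)
  qed simp
  from this[OF finite_points order_refl] x show ?thesis by (simp add: insert_absorb)
qed

subsection \<open>Bounding the evaluation\<close>

abbreviation "zero_conf \<equiv> (\<lambda>_. False) :: conf"

lemma confs_ins2:
  assumes "i \<le> n"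
  shows "(\<Sum>s\<in>confs (n + 2) zero_conf. g s) = (\<Sum>s\<in>confs n zero_conf. \<Sum>(x, y)\<in>UNIV. g (ins2 i x y s) :: real)"
proof -
  have "(\<Sum>s\<in>confs n zero_conf. \<Sum>(x, y)\<in>UNIV. g (ins2 i x y s)) = (\<Sum>(s, x, y)\<in>confs n zero_conf \<times> UNIV. g (ins2 i x y s))"
    by (simp add: sum.cartesian_product case_prod_unfold)
  also have "\<dots> = (\<Sum>s\<in>confs (n + 2) zero_conf. g s)"
  proof (rule sum.reindex_bij_witness[of _ "\<lambda>s. (del2 i s, s i, s (Suc i))" "\<lambda>(s, x, y). ins2 i x y s"])
    fix s assume "s \<in> confs (n + 2) zero_conf"
    then show "(\<lambda>(s, x, y). ins2 i x y s) (del2 i s, s i, s (Suc i)) = s"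
      by (simp add: ins2_del2)
    show "(del2 i s, s i, s (Suc i)) \<in> confs n zero_conf \<times> UNIV"
      using \<open>s \<in> confs (n + 2) zero_conf\<close> assms by (auto simp: confs_def del2_def)
  next
    fix u assume "u \<in> confs n zero_conf \<times> (UNIV :: (bool \<times> bool) set)"
    then show "(\<lambda>s. (del2 i s, s i, s (Suc i))) ((\<lambda>(s, x, y). ins2 i x y s) u) = u"
      by (auto simp: case_prod_unfold)
    show "(\<lambda>(s, x, y). ins2 i x y s) u \<in> confs (n + 2) zero_conf"
      using \<open>u \<in> confs n zero_conf \<times> UNIV\<close> assms by (auto simp: confs_def ins2_def)
  qed (auto simp: case_prod_unfold)
  finally show ?thesis ..
qed

lemma sum_bool_pair: "(\<Sum>(x, y)\<in>(UNIV :: (bool \<times> bool) set). g x y) = g True True + g True False + g False True + (g False False :: real)"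
  by (simp add: UNIV_Times_UNIV[symmetric] sum.cartesian_product[symmetric] UNIV_bool)

lemma loop_bound: "a^2 + 1 / a^2 \<le> 2 * a^2"
proof -
  have "1 / a^2 \<le> 1" using a_gt1(2) by simp
  then show ?thesis using a_gt1(2) by linarith
qed

lemma nsq_cup: "i \<le> n \<Longrightarrow> nsq (n + 2) zero_conf (app (cup i) f) \<le> (2 * a^2) * nsq n zero_conf f"
proof -
  assume i: "i \<le> n"
  have "nsq (n + 2) zero_conf (app (cup i) f) = (a^2 + 1 / a^2) * nsq n zero_conf f"
    unfolding ip_def confs_ins2[OF i] sum_bool_pair
    by (simp add: cup_def app_cupw sum_distrib_left power2_eq_square algebra_simps)
  also have "\<dots> \<le> (2 * a^2) * nsq n zero_conf f" using loop_bound by (intro mult_right_mono) auto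
  finally show ?thesis .
qed

lemma nsq_cap: "i \<le> n \<Longrightarrow> nsq n zero_conf (app (cap i) f) \<le> (2 * a^2) * nsq (n + 2) zero_conf f"
proof -
  assume i: "i \<le> n"
  \<comment> \<open>The Cauchy--Schwarz inequality for the two states that the cap sees.\<close>
  have cs: "(x * u - y * v) * (x * u - y * v) \<le> (x * x + y * y) * (u * u + v * v)" for x y u v :: real
  proof -
    have "(x * x + y * y) * (u * u + v * v) - (x * u - y * v) * (x * u - y * v) = (x * v + y * u) * (x * v + y * u)"
      by (simp add: algebra_simps)
    then show ?thesis using zero_le_square[of "x * v + y * u"] by linarith
  qed
  have "nsq n zero_conf (app (cap i) f) \<le> (\<Sum>s\<in>confs n zero_conf. (a^2 + 1 / a^2) * (f (ins2 i True False s) * f (ins2 i True False s) + f (ins2 i False True s) * f (ins2 i False True s)))"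
    unfolding ip_def
  proof (rule sum_mono)
    fix s
    show "app (cap i) f s * app (cap i) f s \<le> (a^2 + 1 / a^2) * (f (ins2 i True False s) * f (ins2 i True False s) + f (ins2 i False True s) * f (ins2 i False True s))"
      using cs[of "1/a" "f (ins2 i True False s)" a "f (ins2 i False True s)"]
      by (simp add: cap_def app_capw power2_eq_square add.commute)
  qed
  also have "\<dots> \<le> (a^2 + 1 / a^2) * nsq (n + 2) zero_conf f"
    unfolding ip_def confs_ins2[OF i] sum_bool_pair sum_distrib_left[symmetric]
    by (intro mult_left_mono sum_mono) auto
  also have "\<dots> \<le> (2 * a^2) * nsq (n + 2) zero_conf f" using loop_bound by (intro mult_right_mono) auto
  finally show ?thesis .
qed

lemma nsq_CupN: "p \<le> n \<Longrightarrow> nsq (n + 2 * N) zero_conf (app (CupN p N) f) \<le> (2 * a^2)^N * nsq n zero_conf f"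
proof (induction N)
  case (Suc N)
  have "nsq (n + 2 * Suc N) zero_conf (app (CupN p (Suc N)) f) \<le> (2 * a^2) * nsq (n + 2 * N) zero_conf (app (CupN p N) f)"
    using nsq_cup[of "p + N" "n + 2 * N" "app (CupN p N) f"] Suc.prems by simp
  also have "\<dots> \<le> (2 * a^2) * ((2 * a^2)^N * nsq n zero_conf f)"
    using Suc by (intro mult_left_mono) auto
  finally show ?case by (simp add: mult.assoc)
qed simp

lemma nsq_CapN: "p \<le> n \<Longrightarrow> nsq n zero_conf (app (CapN p N) f) \<le> (2 * a^2)^N * nsq (n + 2 * N) zero_conf f"
proof (induction N arbitrary: f)
  case (Suc N)
  have "nsq n zero_conf (app (CapN p N) (app (cap (p + N)) f)) \<le> (2 * a^2)^N * nsq (n + 2 * N) zero_conf (app (cap (p + N)) f)"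
    using Suc by simp
  also have "\<dots> \<le> (2 * a^2)^N * ((2 * a^2) * nsq (n + 2 * N + 2) zero_conf f)"
    using Suc.prems by (intro mult_left_mono nsq_cap) auto
  finally show ?case by (simp add: mult.assoc mult.left_commute)
qed simp

lemma nsq_P: "r \<le> k \<Longrightarrow> q + k \<le> n \<Longrightarrow> nsq n t (app (P q k r) f) \<le> nsq n t f"
proof -
  assume r: "r \<le> k" and n: "q + k \<le> n"
  let ?g = "app (P q k r) f"
  have "ip n t f ?g = nsq n t ?g"
    using adjD[OF adj_P[OF n, of r], of t f ?g] arg_cong[OF P_idem[OF r, of q], of "\<lambda>x. app x f"] by simp
  then have "nsq n t (\<lambda>s. f s - ?g s) = nsq n t f - nsq n t ?g"
    using ip_commute[of n t ?g f] by (simp add: ip_diff)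
  then show ?thesis using ip_self_nonneg[of n t "\<lambda>s. f s - ?g s"] by linarith
qed

lemma nsq_ins: "r \<le> k \<Longrightarrow> k * w \<le> n \<Longrightarrow> nsq n z (app (insert_P k r S t w) f) \<le> nsq n z f"
proof (induction w arbitrary: f)
  case (Suc w)
  have IH: "nsq n z (app (insert_P k r S t w) g) \<le> nsq n z g" for g using Suc by simp
  show ?case
  proof (cases "(t, w) \<in> S")
    case True
    have "nsq n z (app (insert_P k r S t w) (app (P (k * w) k r) f)) \<le> nsq n z (app (P (k * w) k r) f)" by (rule IH)
    also have "\<dots> \<le> nsq n z f" using Suc.prems by (intro nsq_P) auto
    finally show ?thesis using True by simp
  qed (simp add: IH)
qed simp

text \<open>Bounds for squared norms, hence the doubled exponent for a crossing.\<close>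

fun piece_bound :: "nat \<Rightarrow> nat \<Rightarrow> piece \<Rightarrow> real" where
  "piece_bound k r (Cup i) = (2 * a^2)^k"
| "piece_bound k r (Cap i) = (2 * a^2)^k"
| "piece_bound k r (Cross b i) = a^(2*r*r+4*r)"

lemma piece_bound_pos [simp]: "piece_bound k r p > 0"
  by (cases p) simp_all

lemma nsq_layer:
  assumes r: "r \<le> k" and fit: "fits p w" and S: "\<And>j. j < w \<Longrightarrow> (t, j) \<in> S"
  shows "nsq (k * width_above p w) zero_conf (app (cable_op k p) (app (insert_P k r S t w) f)) \<le> piece_bound k r p * nsq (k * w) zero_conf f"
proof -
  let ?v = "app (insert_P k r S t w) f"
  have "nsq (k * width_above p w) zero_conf (app (cable_op k p) ?v) \<le> piece_bound k r p * nsq (k * w) zero_conf ?v"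
  proof (cases p)
    case (Cup i)
    have e: "k * (w + 2) = k * w + 2 * k" by (simp add: algebra_simps)
    have "k * i \<le> k * w" using fit Cup by simp
    then show ?thesis unfolding Cup cable_op.simps piece_bound.simps width_above.simps e by (rule nsq_CupN)
  next
    case (Cap i)
    define u where "u = w - 2"
    have u: "w = u + 2" "w - 2 = u" "i \<le> u" using fit Cap by (simp_all add: u_def)
    have e: "k * (u + 2) = k * u + 2 * k" by (simp add: algebra_simps)
    have "k * i \<le> k * u" using u by simp
    then have "nsq (k * u) zero_conf (app (CapN (k * i) k) ?v) \<le> (2 * a^2)^k * nsq (k * u + 2 * k) zero_conf ?v" by (rule nsq_CapN)
    then show ?thesis unfolding Cap cable_op.simps piece_bound.simps width_above.simps u(2) e[symmetric] u(1)[symmetric] .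
  next
    case (Cross b i)
    \<comment> \<open>Every bundle at this level already carries the projection, so repeating it
      changes nothing: the vector satisfies the hypotheses of \<open>crossing_bound\<close>.\<close>
    have abs: "app (P (k * j) k r) ?v = ?v" if "j < w" for j
    proof -
      have "insert_P k r S t w = insert_P k r (insert (t, j) S) t w" using S[OF that] by (simp add: insert_absorb)
      also have "\<dots> = P (k * j) k r * insert_P k r S t w" using insert_P_insert[OF r that] insert_P_commute by simp
      finally show ?thesis by (metis app_simps(7))
    qed
    have "k * i + 2 * k \<le> k * w" using mult_le_mono2[of "i + 2" w k] fit Cross by (simp add: algebra_simps)
    then show ?thesis
      using crossing_bound[of "k * i" k "k * w" r ?v zero_conf b] r abs[of i] abs[of "Suc i"] fit Cross by (simp add: add.commute)
  qed
  also have "\<dots> \<le> piece_bound k r p * nsq (k * w) zero_conf f"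
    using nsq_ins[OF r, of w "k * w"] by (intro mult_left_mono) (auto simp: less_imp_le)
  finally show ?thesis .
qed

lemma nsq_ev:
  assumes r: "r \<le> k" and v: "valid_from w D"
    and S: "\<And>u j. u \<le> length D \<Longrightarrow> j < top_width w (take u D) \<Longrightarrow> (t + u, j) \<in> S"
  shows "nsq (k * top_width w D) zero_conf (app (eval_P k r S t w D) f) \<le> prod_list (map (piece_bound k r) D) * nsq (k * w) zero_conf f"
  using v S
proof (induction D arbitrary: t w f)
  case Nil
  then show ?case using nsq_ins[OF r, of w "k * w"] by simp
next
  case (Cons p D)
  let ?g = "app (cable_op k p) (app (insert_P k r S t w) f)"
  have "nsq (k * top_width w (p # D)) zero_conf (app (eval_P k r S t w (p # D)) f)
     \<le> prod_list (map (piece_bound k r) D) * nsq (k * width_above p w) zero_conf ?g"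
    using Cons.IH[of "width_above p w" "Suc t" ?g] Cons.prems(1) Cons.prems(2)[of "Suc u" for u] by auto
  also have "\<dots> \<le> prod_list (map (piece_bound k r) D) * (piece_bound k r p * nsq (k * w) zero_conf f)"
    using Cons.prems(1) Cons.prems(2)[of 0]
    by (intro mult_left_mono nsq_layer r prod_list_nonneg) (auto simp: less_imp_le)
  finally show ?case by (simp add: ac_simps)
qed

lemma piece_bound_prod: "prod_list (map (piece_bound k r) D) \<le> (2 * a^2)^(k * length D) * a^(crossings D * (2*r*r+4*r))"
proof (induction D)
  case (Cons p D)
  have g: "1 \<le> (2 * a^2)^k" using a_gt1(2) by (intro one_le_power) linarith
  show ?case
  proof (cases p)
    case (Cross b i)
    have "prod_list (map (piece_bound k r) (p # D)) \<le> a^(2*r*r+4*r) * ((2 * a^2)^(k * length D) * a^(crossings D * (2*r*r+4*r)))"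
      using Cons Cross by (simp add: mult_left_mono)
    also have "\<dots> \<le> (2 * a^2)^k * (a^(2*r*r+4*r) * ((2 * a^2)^(k * length D) * a^(crossings D * (2*r*r+4*r))))"
      using mult_right_mono[OF g, of "a^(2*r*r+4*r) * ((2 * a^2)^(k * length D) * a^(crossings D * (2*r*r+4*r)))"] by simp
    finally show ?thesis by (simp add: crossings_def Cross power_add ac_simps)
  qed (use Cons in \<open>simp_all add: crossings_def power_add mult_left_mono ac_simps\<close>)
qed (simp add: crossings_def)

end

subsection \<open>Closed cables\<close>

lemma top_width_cup_run: "q \<le> w \<Longrightarrow> valid_from w (map (\<lambda>m. Cup (q + m)) [0..<n]) \<and> top_width w (map (\<lambda>m. Cup (q + m)) [0..<n]) = w + 2 * n"
  by (induction n) (auto simp: valid_from_append top_width_append)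

lemma top_width_cap_run: "q + 2 * n \<le> w \<Longrightarrow> valid_from w (map (\<lambda>m. Cap (q + m)) (rev [0..<n])) \<and> top_width w (map (\<lambda>m. Cap (q + m)) (rev [0..<n])) = w - 2 * n"
  by (induction n arbitrary: w) (auto simp: Suc_diff_le)

lemma top_width_cross_row: "q + n < w \<Longrightarrow> valid_from w (map (\<lambda>s. Cross b (q + s)) [0..<n]) \<and> top_width w (map (\<lambda>s. Cross b (q + s)) [0..<n]) = w"
  by (induction n) (auto simp: valid_from_append top_width_append)

lemma top_width_cross_grid:
  "q + m + n \<le> w \<Longrightarrow> valid_from w (concat (map (\<lambda>r. map (\<lambda>s. Cross b (q + r + s)) [0..<n]) (rev [0..<m]))) \<and>
    top_width w (concat (map (\<lambda>r. map (\<lambda>s. Cross b (q + r + s)) [0..<n]) (rev [0..<m]))) = w"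
proof (induction m)
  case (Suc m)
  then show ?case using top_width_cross_row[of "q + m" n w b] by (simp add: valid_from_append top_width_append)
qed simp

lemma valid_cable_piece:
  assumes "fits p w"
  shows "valid_from (k * w) (cable_piece k p) \<and> top_width (k * w) (cable_piece k p) = k * width_above p w"
proof (cases p)
  case (Cup i)
  then show ?thesis using assms top_width_cup_run[of "k * i" "k * w" k] by (simp add: algebra_simps)
next
  case (Cap i)
  then have "k * i + 2 * k \<le> k * w" using assms mult_le_mono2[of "i + 2" w k] by (simp add: algebra_simps)
  then show ?thesis using Cap top_width_cap_run[of "k * i" k "k * w"] by (simp add: diff_mult_distrib2 mult.commute)
next
  case (Cross b i)
  then have "k * i + k + k \<le> k * w" using assms mult_le_mono2[of "i + 2" w k] by (simp add: algebra_simps)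
  then show ?thesis using Cross top_width_cross_grid[of "k * i" k k "k * w" b] by simp
qed

lemma closes_cable: "closes_from w D \<Longrightarrow> closes_from (k * w) (cable k D)"
proof (induction D arbitrary: w)
  case (Cons p D)
  have c: "cable k (p # D) = cable_piece k p @ cable k D" by (simp add: cable_def)
  have v: "valid_from (k * w) (cable_piece k p)" "top_width (k * w) (cable_piece k p) = k * width_above p w"
    using valid_cable_piece[of p w k] Cons.prems by simp_all
  have "closes_from (k * width_above p w) (cable k D)" using Cons by simp
  then show ?case unfolding c closes_from_iff valid_from_append top_width_append using v by simp
qed (simp add: cable_def)

text \<open>Number and sign of the curls are made independent parameters, so that the construction
  is compatible with mirror images.\<close>

definition add_curls :: "nat \<Rightarrow> bool \<Rightarrow> diagram \<Rightarrow> diagram" where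
  "add_curls m b D = take 1 D @ concat (replicate m (curl b)) @ drop 1 D"

lemma zero_framed_add_curls: "zero_framed D up = add_curls (nat \<bar>writhe D up\<bar>) (writhe D up < 0) D"
  by (simp add: zero_framed_def add_curls_def)

lemma knot_first_cup:
  assumes "knot_diagram D" obtains D1 where "D = Cup 0 # D1"
proof (cases D)
  case Nil
  have "components [] = {}" by (simp add: components_def points_def width_def)
  then show ?thesis using assms Nil by (simp add: knot_diagram_def)
next
  case (Cons p D1)
  then have "fits p 0" using assms by (simp add: knot_diagram_def link_diagram_def)
  then have "p = Cup 0" by (cases p) auto
  then show ?thesis using that Cons by simp
qed

lemma link_add_curls:
  assumes "link_diagram (Cup 0 # D1)" shows "link_diagram (add_curls m b (Cup 0 # D1))"
proof -
  have "valid_from 2 (concat (replicate m (curl b))) \<and> top_width 2 (concat (replicate m (curl b))) = 2"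
  proof (induction m)
    case (Suc m)
    have "valid_from 2 (curl b) \<and> top_width 2 (curl b) = 2" by (simp add: curl_def)
    then show ?case using Suc by (simp add: valid_from_append top_width_append)
  qed simp
  then show ?thesis
    using assms unfolding link_diagram_def add_curls_def closes_from_iff
    by (simp add: valid_from_append top_width_append numeral_2_eq_2)
qed

context skein
begin

lemma curl_operator: "diagram_op (cable_op k) (curl b) * P 0 k r = curl_factor b k r *\<^sub>R P 0 k r" if "r \<le> k"
  using cable_curl_P[OF that, of 0 b] by (simp add: curl_def mult.assoc)

lemma curls_operator: "r \<le> k \<Longrightarrow> diagram_op (cable_op k) (concat (replicate m (curl b))) * P 0 k r = (curl_factor b k r ^ m) *\<^sub>R P 0 k r"
proof (induction m)
  case (Suc m)
  have "diagram_op (cable_op k) (concat (replicate (Suc m) (curl b))) * P 0 k r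
    = diagram_op (cable_op k) (concat (replicate m (curl b))) * (diagram_op (cable_op k) (curl b) * P 0 k r)"
    by (simp add: diagram_op_append mult.assoc)
  then show ?case using Suc curl_operator[of r k b] by simp
qed simp

text \<open>On label \<open>r\<close> a positive curl has modulus a^(r^2+2r) and a negative curl the
  inverse, while every crossing may cost a^(r^2+2r). So \<open>d\<close> is the number of crossings
  plus the positive or minus the negative curls.\<close>

lemma laurent_eval_knot_bound:
  assumes knot: "knot_diagram D" and d: "b \<Longrightarrow> d = crossings D + m" "\<not> b \<Longrightarrow> d + m = crossings D"
  shows "\<bar>laurent_eval (bracket (cable k (add_curls m b D)))\<bar> \<le> (real (Suc k) * 2^(k * length D)) * a^(d * (k*k+2*k) + 2 * k * length D)"
proof -
  obtain D1 where D: "D = Cup 0 # D1" using knot_first_cup[OF knot] .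
  have link: "link_diagram D" and card: "card (components D) = 1" using knot by (simp_all add: knot_diagram_def)
  have valid: "valid_from 0 D" and top: "top_width 0 D = 0" using link by (simp_all add: link_diagram_def closes_from_iff)
  let ?D' = "add_curls m b D" and ?one = "(\<lambda>_. 1) :: vec"
  define e where "e r = app (eval_P k r (points D) 0 0 D) ?one zero_conf" for r
  have link': "link_diagram (cable k ?D')"
    using link_add_curls[of D1 m b] link closes_cable[of 0 ?D' k] by (simp add: D link_diagram_def)
  have pt: "(1, 0) \<in> points D" using D by (simp add: points_def width_def)
  have op_r: "diagram_op (cable_op k) D1 * P 0 k r * CupN 0 k = eval_P k r (points D) 0 0 D" if r: "r \<le> k" for r
  proof -
    have "eval_P k r {(1, 0)} 0 0 D = eval_P k r {(1, 0)} 1 2 D1 * CupN 0 k"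
      by (simp add: D numeral_2_eq_2)
    also have "eval_P k r {(1, 0)} 1 2 D1 = diagram_op (cable_op k) D1 * P 0 k r"
      using eval_P_insert_bottom[OF r, of 0 2 1 "{}" D1] by (simp add: eval_P_empty)
    finally show ?thesis using eval_P_connected[OF r valid card pt] by simp
  qed
  \<comment> \<open>The identity is split into projections exactly where the curls are inserted;
    each curl then acts as a scalar, leaving the diagram without curls and with one
    projection.\<close>
  have "diagram_op (cable_op k) ?D' = diagram_op (cable_op k) D1 * diagram_op (cable_op k) (concat (replicate m (curl b))) * (\<Sum>r\<le>k. P 0 k r) * CupN 0 k"
    unfolding P_sum by (simp add: add_curls_def D diagram_op_append mult.assoc)
  also have "\<dots> = (\<Sum>r\<le>k. diagram_op (cable_op k) D1 * (diagram_op (cable_op k) (concat (replicate m (curl b))) * P 0 k r) * CupN 0 k)"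
    by (simp add: sum_distrib_left sum_distrib_right mult.assoc)
  also have "\<dots> = (\<Sum>r\<le>k. (curl_factor b k r ^ m) *\<^sub>R eval_P k r (points D) 0 0 D)"
    using op_r by (intro sum.cong refl) (simp add: curls_operator)
  finally have op: "diagram_op (cable_op k) ?D' = (\<Sum>r\<le>k. (curl_factor b k r ^ m) *\<^sub>R eval_P k r (points D) 0 0 D)" .
  have "laurent_eval (bracket (cable k ?D')) = app (diagram_op piece_op (cable k ?D')) ?one zero_conf"
    unfolding laurent_eval_bracket[OF link'] by simp
  also have "\<dots> = (\<Sum>r\<le>k. curl_factor b k r ^ m * e r)"
    unfolding oplg_cable op by (simp add: app_sum e_def)
  finally have lev: "laurent_eval (bracket (cable k ?D')) = (\<Sum>r\<le>k. curl_factor b k r ^ m * e r)" .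
  define Q where "Q = (2 * a^2)^(k * length D)"
  have Q1: "1 \<le> Q" unfolding Q_def using a_gt1(2) by (intro one_le_power) linarith
  have er: "\<bar>e r\<bar> \<le> Q * a^(crossings D * (r*r+2*r))" if r: "r \<le> k" for r
  proof -
    have c0: "confs 0 zero_conf = {zero_conf}" by (auto simp: confs_def)
    have "e r * e r = nsq (k * top_width 0 D) zero_conf (app (eval_P k r (points D) 0 0 D) ?one)"
      by (simp add: top ip_def c0 e_def)
    also have "\<dots> \<le> prod_list (map (piece_bound k r) D) * nsq (k * 0) zero_conf ?one"
      by (rule nsq_ev[OF r valid]) (auto simp: points_def width_eq)
    also have "\<dots> = prod_list (map (piece_bound k r) D)" by (simp add: ip_def c0)
    also have "\<dots> \<le> Q * a^(crossings D * (2*r*r+4*r))"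
      unfolding Q_def by (rule piece_bound_prod)
    \<comment> \<open>One factor \<open>Q\<close> is given away to obtain a perfect square; it only
      affects terms linear in \<open>k\<close>.\<close>
    also have "\<dots> \<le> Q * (Q * a^(crossings D * (2*r*r+4*r)))"
      using mult_right_mono[OF Q1, of "Q * a^(crossings D * (2*r*r+4*r))"] Q1 by simp
    also have "\<dots> = (Q * a^(crossings D * (r*r+2*r)))^2"
    proof -
      have "crossings D * (2*r*r+4*r) = 2 * (crossings D * (r*r+2*r))" by (simp add: algebra_simps)
      then show ?thesis by (simp add: power2_eq_square mult_2 power_add)
    qed
    finally have "(e r)^2 \<le> (Q * a^(crossings D * (r*r+2*r)))^2" by (simp add: power2_eq_square)
    then have "\<bar>e r\<bar> \<le> \<bar>Q * a^(crossings D * (r*r+2*r))\<bar>" by (simp only: abs_le_square_iff)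
    then show ?thesis using Q1 by simp
  qed
  have term_bound: "\<bar>curl_factor b k r ^ m * e r\<bar> \<le> Q * a^(d * (k*k+2*k))" if r: "r \<le> k" for r
  proof -
    have "\<bar>curl_factor b k r ^ m * e r\<bar> \<le> \<bar>curl_factor b k r\<bar> ^ m * (Q * a^(crossings D * (r*r+2*r)))"
      using er[OF r] by (simp add: abs_mult power_abs mult_left_mono)
    also have "\<dots> = Q * a^(d * (r*r+2*r))"
    proof (cases b)
      case True
      then show ?thesis using d(1) by (simp add: abs_curl_factor power_mult[symmetric] power_add[symmetric] algebra_simps)
    next
      case False
      then have "crossings D * (r*r+2*r) = d * (r*r+2*r) + (r*r+2*r) * m" using d(2)[symmetric] by (simp add: algebra_simps)
      moreover have "(1 / a^q)^m * (Q * a^(d * q + q * m)) = Q * a^(d * q)" for q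
        by (simp add: power_divide power_mult[symmetric] power_add)
      ultimately show ?thesis using False by (simp add: abs_curl_factor del: power_add power_divide)
    qed
    also have "\<dots> \<le> Q * a^(d * (k*k+2*k))"
      using r Q1 a_gt1(1) by (intro mult_left_mono power_increasing mult_le_mono add_mono) auto
    finally show ?thesis .
  qed
  have "\<bar>laurent_eval (bracket (cable k ?D'))\<bar> \<le> (\<Sum>r\<le>k. \<bar>curl_factor b k r ^ m * e r\<bar>)"
    unfolding lev by (rule sum_abs)
  also have "\<dots> \<le> (\<Sum>r\<le>k. Q * a^(d * (k*k+2*k)))" by (intro sum_mono term_bound) simp
  also have "\<dots> = real (Suc k) * Q * a^(d * (k*k+2*k))" by simp
  also have "Q = 2^(k * length D) * a^(2 * k * length D)"
    by (simp add: Q_def power_mult_distrib power_mult[symmetric] mult.assoc)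
  finally show ?thesis by (simp add: power_add ac_simps)
qed

lemma laurent_eval_unknot_bound: "\<bar>laurent_eval (bracket (cable k unknot))\<bar> \<le> 2^k * a^(2 * k)"
proof -
  let ?one = "(\<lambda>_. 1) :: vec"
  have "closes_from 0 unknot" by (simp add: unknot_def)
  then have link: "link_diagram (cable k unknot)"
    using closes_cable[of 0 unknot k] by (simp add: link_diagram_def)
  define e where "e = laurent_eval (bracket (cable k unknot))"
  have "app (diagram_op piece_op (cable k unknot)) ?one = (\<lambda>s. e)" unfolding laurent_eval_bracket[OF link] e_def by (simp add: fun_eq_iff)
  then have op: "app (CapN 0 k) (app (CupN 0 k) ?one) = (\<lambda>s. e)" unfolding oplg_cable unknot_def by simp
  have c0: "confs 0 zero_conf = {zero_conf}" by (auto simp: confs_def)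
  have "e * e = nsq 0 zero_conf (app (CapN 0 k) (app (CupN 0 k) ?one))" unfolding op by (simp add: ip_def c0)
  also have "\<dots> \<le> (2 * a^2)^k * nsq (0 + 2 * k) zero_conf (app (CupN 0 k) ?one)" by (rule nsq_CapN) simp
  also have "\<dots> \<le> (2 * a^2)^k * ((2 * a^2)^k * nsq 0 zero_conf ?one)" by (intro mult_left_mono nsq_CupN) auto
  also have "\<dots> = ((2 * a^2)^k)^2" by (simp add: ip_def c0 power2_eq_square)
  finally have "e^2 \<le> ((2 * a^2)^k)^2" by (simp add: power2_eq_square)
  then have "\<bar>e\<bar> \<le> \<bar>(2 * a^2)^k\<bar>" by (simp only: abs_le_square_iff)
  also have "\<bar>(2 * a^2)^k\<bar> = 2^k * a^(2 * k)" by (simp add: power_mult_distrib power_mult abs_mult power_abs)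
  finally show ?thesis by (simp add: e_def)
qed

end

subsection \<open>Degrees of brackets\<close>

text \<open>The point \<open>a = S + \<bar>B\<bar> + 6\<close>, with \<open>S\<close> the sum of the
  moduli of the coefficients, is so large that the top monomial outweighs all others together with
  the assumed bound; the 6 also ensures \<open>a \<ge> 5\<close>.\<close>

lemma keys_le_of_growth:
  fixes f :: laurent
  assumes growth: "\<And>a. a \<ge> 5 \<Longrightarrow> \<bar>skein.laurent_eval a f\<bar> \<le> B * a ^ N" and k: "k \<in> Poly_Mapping.keys f"
  shows "k \<le> int N"
proof (rule ccontr)
  assume "\<not> k \<le> int N"
  define M where "M = Max (Poly_Mapping.keys f)"
  have ne: "Poly_Mapping.keys f \<noteq> {}" using k by auto
  have "k \<le> M" unfolding M_def using k by (intro Max_ge) auto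
  then have NM: "int N \<le> M - 1" using \<open>\<not> k \<le> int N\<close> by linarith
  define S where "S = (\<Sum>j\<in>Poly_Mapping.keys f. \<bar>real_of_int (Poly_Mapping.lookup f j)\<bar>)"
  have S: "S \<ge> 0" by (simp add: S_def sum_nonneg)
  define a where "a = S + \<bar>B\<bar> + 6"
  have a: "a \<ge> 5" "a > 1" "a > 0" using S by (auto simp: a_def)
  interpret skein a by unfold_locales (rule a)
  define c where "c = real_of_int (Poly_Mapping.lookup f M)"
  have Min: "M \<in> Poly_Mapping.keys f" unfolding M_def using ne by (intro Max_in) auto
  then have "Poly_Mapping.lookup f M \<noteq> 0" by (simp add: in_keys_iff)
  then have c1: "\<bar>c\<bar> \<ge> 1" unfolding c_def by linarith
  define rest where "rest = (\<Sum>j\<in>Poly_Mapping.keys f - {M}. of_int (Poly_Mapping.lookup f j) * a powi j)"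
  have split: "laurent_eval f = c * a powi M + rest"
    unfolding laurent_eval_def rest_def c_def using Min by (subst sum.remove[of _ M]) auto
  have "\<bar>rest\<bar> \<le> (\<Sum>j\<in>Poly_Mapping.keys f - {M}. \<bar>real_of_int (Poly_Mapping.lookup f j)\<bar> * a powi (M - 1))"
    unfolding rest_def
  proof (rule order_trans[OF sum_abs], rule sum_mono)
    fix j assume j: "j \<in> Poly_Mapping.keys f - {M}"
    then have "j \<le> M" unfolding M_def by (intro Max_ge) auto
    then have "j \<le> M - 1" using j by auto
    then have "a powi j \<le> a powi (M - 1)" using a(2) by (intro power_int_increasing) auto
    moreover have "a powi j > 0" using a(3) by simp
    ultimately show "\<bar>of_int (Poly_Mapping.lookup f j) * a powi j\<bar> \<le> \<bar>real_of_int (Poly_Mapping.lookup f j)\<bar> * a powi (M - 1)"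
      by (simp add: abs_mult mult_left_mono)
  qed
  also have "\<dots> \<le> S * a powi (M - 1)"
    unfolding S_def sum_distrib_right[symmetric] using a(3)
    by (intro mult_right_mono sum_mono2) auto
  finally have rest: "\<bar>rest\<bar> \<le> S * a powi (M - 1)" .
  have "a powi M \<le> \<bar>c * a powi M\<bar>" using c1 a(3) by (simp add: abs_mult)
  also have "\<dots> \<le> \<bar>laurent_eval f\<bar> + \<bar>rest\<bar>" using split by linarith
  also have "\<bar>laurent_eval f\<bar> \<le> \<bar>B\<bar> * a powi (M - 1)"
  proof -
    have "\<bar>laurent_eval f\<bar> \<le> B * a ^ N" by (rule growth[OF a(1)])
    also have "\<dots> \<le> \<bar>B\<bar> * a powi int N" using a(3) by (simp add: mult_right_mono)
    also have "\<dots> \<le> \<bar>B\<bar> * a powi (M - 1)" using NM a(2) by (intro mult_left_mono power_int_increasing) auto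
    finally show ?thesis .
  qed
  finally have "a powi M \<le> (\<bar>B\<bar> + S) * a powi (M - 1)" using rest by (simp add: distrib_right)
  moreover have "a powi M = a * a powi (M - 1)" using a(3) power_int_add_1'[of a "M - 1"] by simp
  ultimately have "a \<le> \<bar>B\<bar> + S" using a(3) by simp
  then show False by (simp add: a_def)
qed

lemma keys_knot_cable:
  assumes "knot_diagram D" "b \<Longrightarrow> d = crossings D + m" "\<not> b \<Longrightarrow> d + m = crossings D"
    "k \<le> n" "j \<in> Poly_Mapping.keys (bracket (cable k (add_curls m b D)))"
  shows "j \<le> int (d * (n*n+2*n) + 2 * n * length D)"
proof -
  have "j \<le> int (d * (k*k+2*k) + 2 * k * length D)"
  proof (rule keys_le_of_growth[OF _ assms(5)])
    fix a :: real assume "a \<ge> 5"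
    then interpret skein a by unfold_locales
    show "\<bar>skein.laurent_eval a (bracket (cable k (add_curls m b D)))\<bar> \<le> (real (Suc k) * 2^(k * length D)) * a^(d * (k*k+2*k) + 2 * k * length D)"
      by (rule laurent_eval_knot_bound[OF assms(1-3)])
  qed
  also have "\<dots> \<le> int (d * (n*n+2*n) + 2 * n * length D)"
    using assms(4) by (intro of_nat_mono add_mono mult_le_mono) auto
  finally show ?thesis .
qed

lemma keys_unknot_cable:
  assumes "k \<le> n" "j \<in> Poly_Mapping.keys (bracket (cable k unknot))"
  shows "j \<le> int (2 * n)"
proof -
  have "j \<le> int (2 * k)"
  proof (rule keys_le_of_growth[OF _ assms(2)])
    fix a :: real assume "a \<ge> 5"
    then interpret skein a by unfold_locales
    show "\<bar>skein.laurent_eval a (bracket (cable k unknot))\<bar> \<le> 2^k * a^(2 * k)" by (rule laurent_eval_unknot_bound)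
  qed
  then show ?thesis using assms(1) by linarith
qed

subsection \<open>Mirror images\<close>

fun mirror_piece :: "piece \<Rightarrow> piece" where
  "mirror_piece (Cross b i) = Cross (\<not> b) i"
| "mirror_piece p = p"

abbreviation mirror :: "diagram \<Rightarrow> diagram" where "mirror D \<equiv> map mirror_piece D"

lemma mirror_piece_simps [simp]: "fits (mirror_piece p) = fits p" "width_above (mirror_piece p) = width_above p"
  "through (mirror_piece p) = through p" "crossless (mirror_piece p) = crossless p"
  "mirror_piece p = Cup i \<longleftrightarrow> p = Cup i" "mirror_piece p = Cap i \<longleftrightarrow> p = Cap i"
  by (cases p; auto simp: fun_eq_iff)+

lemma width_mirror: "width (mirror D) t = width D t"
proof -
  have "fold width_above (mirror D) w = fold width_above D w" for w and D :: diagram by (induction D arbitrary: w) auto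
  then show ?thesis by (simp add: width_def take_map)
qed

lemma knot_mirror: "knot_diagram (mirror D) \<longleftrightarrow> knot_diagram D"
proof -
  have p: "points (mirror D) = points D" by (simp add: points_def width_mirror)
  have "through_arcs (mirror D) = through_arcs D" unfolding through_arcs_def p by (auto simp: nth_map)
  moreover have "turn_arcs (mirror D) = turn_arcs D"
  proof -
    have "(t < length D \<and> mirror D ! t = Cup i) = (t < length D \<and> D ! t = Cup i)"
      "(t < length D \<and> mirror D ! t = Cap i) = (t < length D \<and> D ! t = Cap i)" for t i by auto
    then show ?thesis unfolding turn_arcs_def by simp
  qed
  ultimately have "components (mirror D) = components D" by (simp add: components_def p)
  moreover have "closes_from w (mirror D) = closes_from w D" for w by (induction D arbitrary: w) auto
  ultimately show ?thesis by (simp add: knot_diagram_def link_diagram_def)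
qed

lemma crossings_mirror: "crossings (mirror D) = crossings D"
  by (simp add: crossings_def filter_map comp_def)

lemma cable_mirror: "cable k (mirror D) = mirror (cable k D)"
proof -
  have "cable_piece k (mirror_piece p) = mirror (cable_piece k p)" for p
    by (cases p) (simp_all add: map_concat comp_def rev_map)
  then show ?thesis by (simp add: cable_def map_concat comp_def)
qed

lemma add_curls_mirror: "mirror (add_curls m b D) = add_curls m (\<not> b) (mirror D)"
  by (simp add: add_curls_def take_map drop_map map_concat curl_def map_replicate)

lemma states_mirror: "states (mirror D) = map (\<lambda>(x, E). (- x, E)) (states D)"
proof (induction D)
  case (Cons p D)
  then show ?case by (cases p) (auto simp: case_prod_unfold comp_def)
qed simp

lemma lookup_single_times: "Poly_Mapping.lookup (Poly_Mapping.single x c * f) k = c * Poly_Mapping.lookup f (k - x)"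
  for f :: laurent
proof (cases "c = 0")
  case False
  have "Poly_Mapping.lookup (Poly_Mapping.single x c * f) (x + (k - x)) = Poly_Mapping.lookup (Poly_Mapping.single x c) x * Poly_Mapping.lookup f (k - x)"
    by (rule lookup_times_extremal) (use False in auto)
  then show ?thesis by simp
qed simp

lemma loop_power_symmetric: "Poly_Mapping.lookup (loop_value ^ m) (- k) = Poly_Mapping.lookup (loop_value ^ m) k"
proof (induction m arbitrary: k)
  case 0
  have "Poly_Mapping.lookup (Poly_Mapping.single 0 1 :: laurent) (- k) = Poly_Mapping.lookup (Poly_Mapping.single 0 1 :: laurent) k"
    by (simp add: lookup_single when_def del: single_one)
  then show ?case by simp
next
  case (Suc m)
  have l: "Poly_Mapping.lookup (loop_value ^ Suc m) k = - Poly_Mapping.lookup (loop_value ^ m) (k - 2) - Poly_Mapping.lookup (loop_value ^ m) (k + 2)" for k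
    unfolding loop_value_def power_Suc left_diff_distrib mult_minus_left lookup_minus lookup_uminus lookup_single_times by simp
  show ?case unfolding l using Suc[of "k + 2"] Suc[of "k - 2"] by simp
qed

text \<open>Reversing all crossings exchanges the two smoothings, which negates the exponents of the
  states and keeps their loops; the loop value is invariant under inverting
  \<open>A\<close>.\<close>

lemma lookup_bracket_mirror: "Poly_Mapping.lookup (bracket (mirror D)) k = Poly_Mapping.lookup (bracket D) (- k)"
proof -
  have "Poly_Mapping.lookup (\<Sum>(x, E)\<leftarrow>map (\<lambda>(x, E). (- x, E)) L. A_pow x * loop_value ^ card (components E)) k
    = Poly_Mapping.lookup (\<Sum>(x, E)\<leftarrow>L. A_pow x * loop_value ^ card (components E)) (- k)" for L :: "(int \<times> diagram) list"
  proof (induction L)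
    case (Cons y L)
    have "k + fst y = - (- k - fst y)" by simp
    then show ?case using Cons loop_power_symmetric[of _ "- k - fst y"]
      by (simp add: case_prod_unfold lookup_add lookup_single_times add.commute[of k])
  qed simp
  then show ?thesis unfolding bracket_def states_mirror .
qed

lemma keys_bracket_mirror: "k \<in> Poly_Mapping.keys (bracket (mirror D)) \<longleftrightarrow> - k \<in> Poly_Mapping.keys (bracket D)"
  by (simp add: in_keys_iff lookup_bracket_mirror)

subsection \<open>Degrees of the colored Jones function\<close>

lemma degree_chebyshev_S: "degree (chebyshev_S n) \<le> n"
proof (induction n rule: chebyshev_S.induct)
  case (3 k)
  have "degree ([:0, 1:] * chebyshev_S (Suc k)) \<le> Suc (Suc k)"
    using 3 degree_mult_le[of "[:0, 1:]" "chebyshev_S (Suc k)"] by simp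
  then show ?case using 3 by (auto intro!: degree_diff_le)
qed simp_all

lemma keys_S_bracket:
  assumes "j \<in> Poly_Mapping.keys (S_bracket n D)"
  obtains k where "k \<le> n" "j \<in> Poly_Mapping.keys (bracket (cable k D))"
proof -
  have "Poly_Mapping.keys (S_bracket n D) \<subseteq> (\<Union>k\<le>degree (chebyshev_S n). Poly_Mapping.keys (of_int (coeff (chebyshev_S n) k) * bracket (cable k D)))"
    unfolding S_bracket_def by (rule keys_sum)
  then obtain k where k: "k \<le> degree (chebyshev_S n)" "j \<in> Poly_Mapping.keys (of_int (coeff (chebyshev_S n) k) * bracket (cable k D))"
    using assms by auto
  have "of_int (coeff (chebyshev_S n) k) = (Poly_Mapping.single 0 (coeff (chebyshev_S n) k) :: laurent)"
    by (metis of_int_eq_id id_apply single_of_int)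
  then have "j \<in> Poly_Mapping.keys (bracket (cable k D))"
    using k(2) unfolding in_keys_iff by (simp only: lookup_single_times) auto
  then show thesis using that[of k] k(1) degree_chebyshev_S[of n] by linarith
qed

lemma crossings_eq: "c_plus D up + c_minus D up = crossings D"
proof -
  let ?A = "{t. t < length D \<and> (\<exists>b i. D ! t = Cross b i \<and> b = (up (t, i) = up (t, i + 1)))}"
  let ?B = "{t. t < length D \<and> (\<exists>b i. D ! t = Cross b i \<and> b \<noteq> (up (t, i) = up (t, i + 1)))}"
  have "crossless p \<longleftrightarrow> (\<nexists>b i. p = Cross b i)" for p by (cases p) auto
  then have "{t. t < length D \<and> \<not> crossless (D ! t)} = ?A \<union> ?B" by auto
  moreover have "?A \<inter> ?B = {}" by auto
  ultimately show ?thesis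
    by (simp add: crossings_def length_filter_conv_card c_plus_def c_minus_def card_Un_disjoint)
qed

text \<open>The zero framing adds curls of total sign minus the writhe, so the exponent becomes c^+
  + c^- - (c^+ - c^-) = 2 c^-. Mirroring exchanges c^+ and c^- and gives the other estimate.\<close>

lemma keys_S_bracket_zero_framed:
  assumes "knot_diagram D" "j \<in> Poly_Mapping.keys (S_bracket n (zero_framed D up))"
  shows "j \<le> int (2 * c_minus D up * (n*n+2*n) + 2 * n * length D)"
    and "- j \<le> int (2 * c_plus D up * (n*n+2*n) + 2 * n * length D)"
proof -
  define b where "b \<longleftrightarrow> writhe D up < 0"
  define m where "m = nat \<bar>writhe D up\<bar>"
  have m: "b \<Longrightarrow> c_plus D up + m = c_minus D up" "\<not> b \<Longrightarrow> c_plus D up = c_minus D up + m"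
    by (auto simp: b_def m_def writhe_def)
  have z: "zero_framed D up = add_curls m b D" by (simp add: zero_framed_add_curls b_def m_def)
  obtain k where k: "k \<le> n" "j \<in> Poly_Mapping.keys (bracket (cable k (add_curls m b D)))"
    using keys_S_bracket[OF assms(2)] unfolding z by blast
  note c = crossings_eq[of D up]
  show "j \<le> int (2 * c_minus D up * (n*n+2*n) + 2 * n * length D)"
    by (rule keys_knot_cable[OF assms(1) _ _ k]) (use c m in auto)
  have km: "- j \<in> Poly_Mapping.keys (bracket (cable k (add_curls m (\<not> b) (mirror D))))"
    using k(2) unfolding add_curls_mirror[symmetric] cable_mirror keys_bracket_mirror by simp
  have "- j \<le> int (2 * c_plus D up * (n*n+2*n) + 2 * n * length (mirror D))"
    by (rule keys_knot_cable[OF _ _ _ k(1) km]) (use c m assms(1) in \<open>auto simp: knot_mirror crossings_mirror\<close>)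
  then show "- j \<le> int (2 * c_plus D up * (n*n+2*n) + 2 * n * length D)" by simp
qed

lemma keys_S_bracket_unknot:
  assumes "j \<in> Poly_Mapping.keys (S_bracket n unknot)" shows "\<bar>j\<bar> \<le> int (2 * n)"
proof -
  obtain k where k: "k \<le> n" "j \<in> Poly_Mapping.keys (bracket (cable k unknot))"
    using keys_S_bracket[OF assms] by blast
  have "mirror unknot = unknot" by (simp add: unknot_def)
  then have "- j \<in> Poly_Mapping.keys (bracket (cable k unknot))"
    using k(2) keys_bracket_mirror[of "- j" "cable k unknot"] cable_mirror[of k unknot] by simp
  then show ?thesis using keys_unknot_cable[OF k] keys_unknot_cable[OF k(1), of "- j"] by linarith
qed

section \<open>From degree bounds to slopes\<close>

definition quadratic_bounds :: "nat \<Rightarrow> nat \<Rightarrow> rat \<Rightarrow> (nat \<Rightarrow> rat) \<Rightarrow> bool" where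
  "quadratic_bounds u v B d \<longleftrightarrow> (\<forall>n. d n \<le> of_nat u / 2 * of_nat n ^ 2 + B * of_nat n + B
     \<and> - d n \<le> of_nat v / 2 * of_nat n ^ 2 + B * of_nat n + B)"

text \<open>The degree bounds for numerator and denominator are combined and divided by 4, as
  \<open>q = A\<^sup>-\<^sup>4\<close>: the term 2 c n^2 becomes c/2 times n^2. Lower degrees in
  \<open>A\<close> bound upper degrees in \<open>q\<close>.\<close>

lemma delta_bounds:
  assumes knot: "knot_diagram D"
  shows "\<exists>B. quadratic_bounds (c_plus D up) (c_minus D up) B (delta D up) \<and> quadratic_bounds (c_plus D up) (c_minus D up) B (delta_star D up)"
proof -
  define cp where "cp = c_plus D up"
  define cm where "cm = c_minus D up"
  \<comment> \<open>Accounts for the unspecified degrees of 0, which occur if numerator or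
    denominator vanishes; they merely enlarge the constant \<open>B\<close>.\<close>
  define x0 where "x0 = \<bar>of_int (min_degree_A 0) / 4 :: rat\<bar> + \<bar>of_int (max_degree_A 0) / 4\<bar>"
  define B where "B = x0 + of_nat (cp + cm + length D + 1)"
  have x0: "x0 \<ge> 0" by (simp add: x0_def)
  have main: "y \<le> of_nat u / 2 * of_nat n ^ 2 + B * of_nat n + B"
    if "y * 4 \<le> of_nat (2 * u * (n*n+2*n) + 2 * n * length D + 2 * n) \<or> y \<le> x0" "u = cp \<or> u = cm" for y :: rat and u n
  proof -
    have nn: "of_nat n \<ge> (0::rat)" "of_nat u \<ge> (0::rat)" "of_nat (length D) \<ge> (0::rat)" by auto
    have B: "B \<ge> of_nat u + of_nat (length D) + 1" "B \<ge> x0" using that(2) x0 by (auto simp: B_def)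
    from that(1) show ?thesis
    proof
      assume y: "y * 4 \<le> of_nat (2 * u * (n*n+2*n) + 2 * n * length D + 2 * n)"
      have "of_nat (2 * u * (n*n+2*n) + 2 * n * length D + 2 * n) = 4 * (of_nat u / 2 * of_nat n ^ 2 + (of_nat u + of_nat (length D) / 2 + 1 / 2) * (of_nat n :: rat))"
        by (simp add: power2_eq_square algebra_simps)
      then have "y \<le> of_nat u / 2 * of_nat n ^ 2 + (of_nat u + of_nat (length D) / 2 + 1 / 2) * of_nat n" using y by simp
      also have "(of_nat u + of_nat (length D) / 2 + 1 / 2) * of_nat n \<le> B * (of_nat n :: rat)"
        using B nn by (intro mult_right_mono) auto
      finally show ?thesis using B nn by linarith
    next
      assume "y \<le> x0"
      moreover have "of_nat u / 2 * of_nat n ^ 2 + B * of_nat n \<ge> (0::rat)" using B x0 nn by (intro add_nonneg_nonneg mult_nonneg_nonneg) auto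
      ultimately show ?thesis using B by linarith
    qed
  qed
  have both: "(delta D up n * 4 \<le> of_nat (2 * cp * (n*n+2*n) + 2 * n * length D + 2 * n) \<or> delta D up n \<le> x0)
     \<and> (- delta D up n * 4 \<le> of_nat (2 * cm * (n*n+2*n) + 2 * n * length D + 2 * n) \<or> - delta D up n \<le> x0)
     \<and> (delta_star D up n * 4 \<le> of_nat (2 * cp * (n*n+2*n) + 2 * n * length D + 2 * n) \<or> delta_star D up n \<le> x0)
     \<and> (- delta_star D up n * 4 \<le> of_nat (2 * cm * (n*n+2*n) + 2 * n * length D + 2 * n) \<or> - delta_star D up n \<le> x0)" for n
  proof -
    let ?f = "S_bracket n (zero_framed D up)" and ?g = "S_bracket n unknot"
    show ?thesis
    proof (cases "?f = 0 \<or> ?g = 0")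
      case True
      then have "colored_jones D up n = 0"
        unfolding colored_jones_def by (auto simp: fract_collapse)
      then show ?thesis by (auto simp: delta_def delta_star_def x0_def)
    next
      case False
      let ?F = "Poly_Mapping.keys ?f" and ?G = "Poly_Mapping.keys ?g"
      have ne: "?F \<noteq> {}" "?G \<noteq> {}" using False by simp_all
      have F: "Max ?F \<in> ?F" "Min ?F \<in> ?F" and G: "Max ?G \<in> ?G" "Min ?G \<in> ?G"
        using ne by (auto intro: Max_in Min_in)
      note kF = keys_S_bracket_zero_framed[OF knot, where up=up, folded cp_def cm_def]
      have d: "delta D up n * 4 = of_int (- (Min ?F - Min ?G))" "delta_star D up n * 4 = of_int (- (Max ?F - Max ?G))"
        unfolding delta_def delta_star_def colored_jones_def
        using False min_degree_A_Fract[of ?f ?g] max_degree_A_Fract[of ?f ?g] by simp_all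
      have i: "of_int x \<le> (of_nat N :: rat) \<longleftrightarrow> x \<le> int N" for x N by (metis of_int_le_iff of_int_of_nat_eq)
      have m: "- x * 4 = - (x * 4)" for x :: rat by simp
      show ?thesis
        unfolding m d of_int_minus[symmetric] i
        using kF(1)[OF F(1)] kF(2)[OF F(1)] kF(1)[OF F(2)] kF(2)[OF F(2)] keys_S_bracket_unknot[OF G(1)] keys_S_bracket_unknot[OF G(2)]
        by (intro conjI disjI1) (auto simp: algebra_simps)
    qed
  qed
  have "quadratic_bounds cp cm B (delta D up)" "quadratic_bounds cp cm B (delta_star D up)"
    unfolding quadratic_bounds_def using both main by blast+
  then show ?thesis unfolding cp_def cm_def by blast
qed

lemma periodic_multiple: "\<forall>n. c (n + p) = c n \<Longrightarrow> c (n + m * p) = c (n :: nat)"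
  by (induction m) (simp_all, metis add.assoc add.commute)

text \<open>Along \<open>m0\<close> plus multiples of a common period all three coefficients are
  constant, so two genuine quadratic polynomials are compared at infinity.\<close>

lemma quadratic_coefficient_le:
  fixes d c2 c1 c0 :: "nat \<Rightarrow> rat"
  assumes per: "periodic c2" "periodic c1" "periodic c0"
    and quad: "\<forall>\<^sub>F n in sequentially. d n = c2 n * of_nat n ^ 2 + c1 n * of_nat n + c0 n"
    and le: "\<And>n. d n \<le> A * of_nat n ^ 2 + B * of_nat n + B"
  shows "c2 m0 \<le> A"
proof (rule ccontr)
  assume "\<not> c2 m0 \<le> A"
  define x where "x = c2 m0 - A"
  have x: "x > 0" using \<open>\<not> c2 m0 \<le> A\<close> by (simp add: x_def)
  obtain p2 p1 p0 where p: "p2 > 0" "\<forall>n. c2 (n + p2) = c2 n" "p1 > 0" "\<forall>n. c1 (n + p1) = c1 n" "p0 > 0" "\<forall>n. c0 (n + p0) = c0 n"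
    using per unfolding periodic_def by blast
  define p where "p = p2 * p1 * p0"
  have pp: "p > 0" using p by (simp add: p_def)
  have c: "c2 (m0 + m * p) = c2 m0" "c1 (m0 + m * p) = c1 m0" "c0 (m0 + m * p) = c0 m0" for m
    using periodic_multiple[OF p(2), of m0 "m * p1 * p0"] periodic_multiple[OF p(4), of m0 "m * p2 * p0"] periodic_multiple[OF p(6), of m0 "m * p2 * p1"]
    by (simp_all add: p_def mult.assoc mult.left_commute mult.commute)
  obtain N where N: "\<And>n. n \<ge> N \<Longrightarrow> d n = c2 n * of_nat n ^ 2 + c1 n * of_nat n + c0 n"
    using quad unfolding eventually_sequentially by blast
  define y where "y = \<bar>B - c1 m0\<bar> + \<bar>B - c0 m0\<bar>"
  obtain q :: nat where q: "y / x < of_nat q" using reals_Archimedean2 by blast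
  \<comment> \<open>Large enough for the quasi-polynomial formula and for the quadratic term to win;
    the extra 1 gives \<open>n \<ge> 1\<close>, so that constant terms are dominated by linear
    ones.\<close>
  define n where "n = m0 + (N + q + 1) * p"
  have "N + q + 1 \<le> (N + q + 1) * p"
    using mult_le_mono2[of 1 p "N + q + 1"] pp by simp
  then have n: "n \<ge> N" "n \<ge> q" "n \<ge> 1" by (auto simp: n_def)
  define r where "r = (of_nat n :: rat)"
  have r: "r \<ge> 1" "r \<ge> of_nat q" using n by (simp_all add: r_def)
  have "c2 m0 * r^2 + c1 m0 * r + c0 m0 \<le> A * r^2 + B * r + B"
    using le[of n] unfolding N[OF n(1)] r_def[symmetric] unfolding n_def c .
  then have "x * r^2 \<le> (B - c1 m0) * r + (B - c0 m0)" by (simp add: x_def algebra_simps)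
  also have "\<dots> \<le> \<bar>B - c1 m0\<bar> * r + \<bar>B - c0 m0\<bar> * r"
  proof (rule add_mono)
    show "(B - c1 m0) * r \<le> \<bar>B - c1 m0\<bar> * r" using r by (intro mult_right_mono) auto
    have "\<bar>B - c0 m0\<bar> * 1 \<le> \<bar>B - c0 m0\<bar> * r" using r by (intro mult_left_mono) auto
    then show "B - c0 m0 \<le> \<bar>B - c0 m0\<bar> * r" using abs_ge_self[of "B - c0 m0"] by simp
  qed
  also have "\<dots> = y * r" by (simp add: y_def algebra_simps)
  finally have "(x * r) * r \<le> y * r" by (simp add: power2_eq_square mult.assoc)
  then have "x * r \<le> y" using r by simp
  moreover have "y < x * r"
  proof -
    have "y / x < r" using q r by linarith
    then show ?thesis using x by (simp add: divide_less_eq mult.commute)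
  qed
  ultimately show False by simp
qed

lemma slopes_bounds:
  assumes "quadratic_bounds u v B d" "s \<in> slopes d"
  shows "- of_nat v \<le> s \<and> s \<le> of_nat u"
proof -
  obtain c2 c1 c0 n where s: "s = 2 * c2 n" and q: "quasi_polynomial_for d c2 c1 c0"
    using assms(2) by (auto simp: slopes_def)
  have per: "periodic c2" "periodic c1" "periodic c0"
    and quad: "\<forall>\<^sub>F n in sequentially. d n = c2 n * of_nat n ^ 2 + c1 n * of_nat n + c0 n"
    using q by (auto simp: quasi_polynomial_for_def)
  have "c2 n \<le> of_nat u / 2"
    by (rule quadratic_coefficient_le[where B = B, OF per quad]) (use assms(1) in \<open>simp add: quadratic_bounds_def\<close>)
  \<comment> \<open>The lower bound is the upper bound for the negated function, whose coefficients
    are the negated ones.\<close>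
  moreover have "- c2 n \<le> of_nat v / 2"
  proof (rule quadratic_coefficient_le[where B = B])
    show "periodic (\<lambda>n. - c2 n)" "periodic (\<lambda>n. - c1 n)" "periodic (\<lambda>n. - c0 n)"
      using per by (simp_all add: periodic_def)
    show "\<forall>\<^sub>F n in sequentially. - d n = - c2 n * of_nat n ^ 2 + - c1 n * of_nat n + - c0 n"
      using quad by (rule eventually_mono) simp
    show "- d n \<le> of_nat v / 2 * of_nat n ^ 2 + B * of_nat n + B" for n
      using assms(1) by (simp add: quadratic_bounds_def)
  qed
  ultimately show ?thesis unfolding s by simp
qed

theorem proposition1p9:
  fixes D :: diagram and up :: "nat \<times> nat \<Rightarrow> bool"
  assumes "knot_diagram D" and "orientation D up"
  shows "(\<forall>s \<in> js D up. - of_nat (c_minus D up) \<le> s \<and> s \<le> of_nat (c_plus D up)) \<and>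
    (\<forall>s \<in> js_star D up. - of_nat (c_minus D up) \<le> s \<and> s \<le> of_nat (c_plus D up))"
  using delta_bounds[OF assms(1), of up] slopes_bounds unfolding js_def js_star_def by blast

end
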